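(* Let $S$ be a finitely generated commutative ring over $\mathbb{Z}$, or a completion of such a ring, and let $R$ be a finitely presented associative $S$-algebra. Then for all integers $d\geq 0$ and $n\geq 1$, $$0\leq a_n(\widehat{\zeta}_R(s))-a_n(\zeta_{R^d}(s+d)) \leq 2n\log n \cdot a_n(\widehat{\zeta}_R(s))\cdot 2^{-d}.$$ As a consequence, one has a coefficientwise limit of formal Dirichlet series $$\widehat{\zeta}_R(s)=\lim_{d\to \infty} \zeta_{R^d}(s+d).$$
   Context: A formal Dirichlet series is a formal expression $f(s)=\sum_{n\geq 1}a_n n^{-s}$ with $a_n\in\mathbb{C}$; $a_n(f)$ denotes its $n^{-s}$ coefficient. For an integer $k$, $f(s+k):=\sum_{n\ge 1} a_n(f)\, n^{-k}\, n^{-s}$. A finitely presented associative $S$-algebra is one of the form $R=S\{T_1,\dots,T_m\}/(f_1,\dots,f_r)$ with noncommuting generators $T_i$ and finitely many relations $f_j$. $\widehat{\zeta}_R(s)=\sum_{M}\frac{1}{|\mathrm{Aut}_R(M)|}|M|^{-s}$, summed over isomorphism classes of finite-cardinality left $R$-modules $M$. $\zeta_{R^d}(s)=\sum_{E\subseteq R^d}|R^d/E|^{-s}$, summed over left $R$-submodules $E$ of finite index in $R^d$. $\log$ is the natural logarithm. *)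

theory Defs
  imports Complex_Main "HOL-Algebra.Algebra"
begin

section \<open>Base rings\<close>

definition fg_cring :: "('a, 'b) ring_scheme \<Rightarrow> bool" where
  "fg_cring A \<longleftrightarrow> cring A \<and>
     (\<exists>G. finite G \<and> G \<subseteq> carrier A \<and> generate_ring A G = carrier A)"

text \<open>
  The \<open>I\<close>-adic completion, i.e. the inverse limit of the rings \<open>A / I^k\<close>, as the ring of
  coherent sequences of cosets: each component is the image of the next one under
  \<open>A / I^(k + 1) \<rightarrow> A / I^k\<close>. The library's monoid of ideals supplies \<open>I^k\<close>, with
  \<open>I^0 = A\<close>.
\<close>

definition adic_quot :: "('a, 'b) ring_scheme \<Rightarrow> 'a set \<Rightarrow> nat \<Rightarrow> 'a set ring" where
  "adic_quot A I k = A Quot (I [^]\<^bsub>ideals_set A\<^esub> k)"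

definition adic_completion :: "('a, 'b) ring_scheme \<Rightarrow> 'a set \<Rightarrow> (nat \<Rightarrow> 'a set) ring" where
  "adic_completion A I =
    \<lparr>carrier = {x. \<forall>k. \<exists>a\<in>carrier A.
        x (Suc k) = (I [^]\<^bsub>ideals_set A\<^esub> Suc k) +>\<^bsub>A\<^esub> a \<and>
        x k = (I [^]\<^bsub>ideals_set A\<^esub> k) +>\<^bsub>A\<^esub> a},
     monoid.mult = (\<lambda>x y k. x k \<otimes>\<^bsub>adic_quot A I k\<^esub> y k),
     one = (\<lambda>k. \<one>\<^bsub>adic_quot A I k\<^esub>),
     ring.zero = (\<lambda>k. \<zero>\<^bsub>adic_quot A I k\<^esub>),
     ring.add = (\<lambda>x y k. x k \<oplus>\<^bsub>adic_quot A I k\<^esub> y k)\<rparr>"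

section \<open>Finitely presented associative algebras\<close>

text \<open>
  The free algebra on noncommuting \<open>T_0, \<dots>, T_(m-1)\<close>: a word \<open>T_i T_j \<dots>\<close> is the list
  \<open>[i, j, \<dots>]\<close>, an element is its finitely supported family of coefficients, and the product
  is the convolution over all ways of cutting a word into a prefix and a suffix.
\<close>

definition free_algebra :: "('s, 'b) ring_scheme \<Rightarrow> nat \<Rightarrow> (nat list \<Rightarrow> 's) ring" where
  "free_algebra S m =
    \<lparr>carrier = {f. (\<forall>w. f w \<in> carrier S) \<and> finite {w. f w \<noteq> \<zero>\<^bsub>S\<^esub>} \<and>
                   (\<forall>w. w \<notin> lists {..<m} \<longrightarrow> f w = \<zero>\<^bsub>S\<^esub>)},
     monoid.mult = (\<lambda>f g w. \<Oplus>\<^bsub>S\<^esub>k\<in>{..length w}. f (take k w) \<otimes>\<^bsub>S\<^esub> g (drop k w)),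
     one = (\<lambda>w. if w = [] then \<one>\<^bsub>S\<^esub> else \<zero>\<^bsub>S\<^esub>),
     ring.zero = (\<lambda>w. \<zero>\<^bsub>S\<^esub>),
     ring.add = (\<lambda>f g w. f w \<oplus>\<^bsub>S\<^esub> g w)\<rparr>"

definition free_algebra_const :: "('s, 'b) ring_scheme \<Rightarrow> 's \<Rightarrow> nat list \<Rightarrow> 's" where
  "free_algebra_const S s = (\<lambda>w. if w = [] then s else \<zero>\<^bsub>S\<^esub>)"

definition assoc_algebra ::
    "('s, 'b) ring_scheme \<Rightarrow> ('r, 'c) ring_scheme \<Rightarrow> ('s \<Rightarrow> 'r) \<Rightarrow> bool" where
  "assoc_algebra S R \<sigma> \<longleftrightarrow> cring S \<and> ring R \<and> \<sigma> \<in> ring_hom S R \<and>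
     (\<forall>s\<in>carrier S. \<forall>r\<in>carrier R. \<sigma> s \<otimes>\<^bsub>R\<^esub> r = r \<otimes>\<^bsub>R\<^esub> \<sigma> s)"

text \<open>
  \<open>R\<close>, with structure map \<open>\<sigma>\<close>, is isomorphic as an \<open>S\<close>-algebra to the free algebra on \<open>m\<close>
  letters modulo the two-sided ideal generated by the finite set \<open>F\<close>.
\<close>

definition finitely_presented_algebra ::
    "('s, 'b) ring_scheme \<Rightarrow> ('r, 'c) ring_scheme \<Rightarrow> ('s \<Rightarrow> 'r) \<Rightarrow> bool" where
  "finitely_presented_algebra S R \<sigma> \<longleftrightarrow> assoc_algebra S R \<sigma> \<and>
     (\<exists>m F h. finite F \<and> F \<subseteq> carrier (free_algebra S m) \<and>
        h \<in> ring_iso (free_algebra S m Quot (Idl\<^bsub>free_algebra S m\<^esub> F)) R \<and>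
        (\<forall>s\<in>carrier S.
           h ((Idl\<^bsub>free_algebra S m\<^esub> F) +>\<^bsub>free_algebra S m\<^esub> free_algebra_const S s) = \<sigma> s))"

section \<open>Left modules\<close>

text \<open>
  The library's locale \<^locale>\<open>module\<close> requires a commutative ring of scalars; this is the
  same notion without commutativity. As there, the fields \<open>mult\<close> and \<open>one\<close>
  of the record \<open>M\<close> play no role.
\<close>

locale left_module = R?: ring R + M?: abelian_group M
  for R :: "('r, 'c) ring_scheme" (structure) and M :: "('r, 'm, 'd) module_scheme" (structure) +
  assumes smult_closed:
      "\<lbrakk>a \<in> carrier R; x \<in> carrier M\<rbrakk> \<Longrightarrow> a \<odot>\<^bsub>M\<^esub> x \<in> carrier M"
    and smult_l_distr:
      "\<lbrakk>a \<in> carrier R; b \<in> carrier R; x \<in> carrier M\<rbrakk> \<Longrightarrow>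
        (a \<oplus>\<^bsub>R\<^esub> b) \<odot>\<^bsub>M\<^esub> x = a \<odot>\<^bsub>M\<^esub> x \<oplus>\<^bsub>M\<^esub> b \<odot>\<^bsub>M\<^esub> x"
    and smult_r_distr:
      "\<lbrakk>a \<in> carrier R; x \<in> carrier M; y \<in> carrier M\<rbrakk> \<Longrightarrow>
        a \<odot>\<^bsub>M\<^esub> (x \<oplus>\<^bsub>M\<^esub> y) = a \<odot>\<^bsub>M\<^esub> x \<oplus>\<^bsub>M\<^esub> a \<odot>\<^bsub>M\<^esub> y"
    and smult_assoc:
      "\<lbrakk>a \<in> carrier R; b \<in> carrier R; x \<in> carrier M\<rbrakk> \<Longrightarrow>
        (a \<otimes>\<^bsub>R\<^esub> b) \<odot>\<^bsub>M\<^esub> x = a \<odot>\<^bsub>M\<^esub> (b \<odot>\<^bsub>M\<^esub> x)"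
    and smult_one: "x \<in> carrier M \<Longrightarrow> \<one>\<^bsub>R\<^esub> \<odot>\<^bsub>M\<^esub> x = x"

lemma left_module_imp_module:
  assumes "cring R" "left_module R M"
  shows "module R M"
proof -
  interpret left_module R M by fact
  show ?thesis
    by (intro moduleI assms(1) M.abelian_group_axioms smult_closed smult_l_distr
        smult_r_distr smult_assoc smult_one)
qed

lemma module_imp_left_module:
  assumes "module R M"
  shows "left_module R M"
proof -
  interpret module R M by fact
  show ?thesis
    by unfold_locales (simp_all add: smult_l_distr smult_r_distr smult_assoc1)
qed

definition left_module_iso ::
    "('r, 'c) ring_scheme \<Rightarrow> ('r, 'm, 'd) module_scheme \<Rightarrow> ('r, 'n, 'e) module_scheme
      \<Rightarrow> ('m \<Rightarrow> 'n) set" where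
  "left_module_iso R M N =
    {h. bij_betw h (carrier M) (carrier N) \<and>
        (\<forall>x\<in>carrier M. \<forall>y\<in>carrier M. h (x \<oplus>\<^bsub>M\<^esub> y) = h x \<oplus>\<^bsub>N\<^esub> h y) \<and>
        (\<forall>a\<in>carrier R. \<forall>x\<in>carrier M. h (a \<odot>\<^bsub>M\<^esub> x) = a \<odot>\<^bsub>N\<^esub> h x)}"

text \<open>Extensional functions only, so that each automorphism is counted once.\<close>

definition left_module_auto ::
    "('r, 'c) ring_scheme \<Rightarrow> ('r, 'm, 'd) module_scheme \<Rightarrow> ('m \<Rightarrow> 'm) set" where
  "left_module_auto R M = left_module_iso R M M \<inter> extensional (carrier M)"

text \<open>
  The left module \<open>R^d\<close>. Its fields \<open>mult\<close> and \<open>one\<close> are irrelevant.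
\<close>

definition free_left_module :: "('r, 'c) ring_scheme \<Rightarrow> nat \<Rightarrow> ('r, nat \<Rightarrow> 'r) module" where
  "free_left_module R d =
    \<lparr>carrier = {..<d} \<rightarrow>\<^sub>E carrier R,
     monoid.mult = (\<lambda>x y. \<lambda>i\<in>{..<d}. x i \<otimes>\<^bsub>R\<^esub> y i),
     one = (\<lambda>i\<in>{..<d}. \<one>\<^bsub>R\<^esub>),
     ring.zero = (\<lambda>i\<in>{..<d}. \<zero>\<^bsub>R\<^esub>),
     ring.add = (\<lambda>x y. \<lambda>i\<in>{..<d}. x i \<oplus>\<^bsub>R\<^esub> y i),
     smult = (\<lambda>a x. \<lambda>i\<in>{..<d}. a \<otimes>\<^bsub>R\<^esub> x i)\<rparr>"

section \<open>Formal Dirichlet series and the two zeta functions\<close>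

text \<open>
  A formal Dirichlet series is its sequence of coefficients \<open>n \<mapsto> a_n\<close>, of which only those
  with \<open>n \<ge> 1\<close> are meaningful. Both zeta functions have rational coefficients and are given
  as real series, since their coefficients are compared by inequalities.
\<close>

type_synonym 'a formal_dirichlet = "nat \<Rightarrow> 'a"

text \<open>\<open>f(s + k)\<close>\<close>

definition dirichlet_shift :: "int \<Rightarrow> 'a::field formal_dirichlet \<Rightarrow> 'a formal_dirichlet" where
  "dirichlet_shift k f = (\<lambda>n. f n * of_nat n powi (- k))"

text \<open>
  Isomorphism classes of left modules of cardinality \<open>n \<ge> 1\<close>. Every finite module has a copy
  whose underlying set consists of natural numbers, so such modules represent all classes.
\<close>

definition finite_left_modules :: "('r, 'c) ring_scheme \<Rightarrow> nat \<Rightarrow> ('r, nat) module set" where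
  "finite_left_modules R n = {M. left_module R M \<and> finite (carrier M) \<and> card (carrier M) = n}"

definition left_module_classes :: "('r, 'c) ring_scheme \<Rightarrow> nat \<Rightarrow> ('r, nat) module set set" where
  "left_module_classes R n = finite_left_modules R n //
     {(M, N). M \<in> finite_left_modules R n \<and> N \<in> finite_left_modules R n \<and>
              left_module_iso R M N \<noteq> {}}"

definition zeta_hat :: "('r, 'c) ring_scheme \<Rightarrow> real formal_dirichlet" where
  "zeta_hat R = (\<lambda>n. \<Sum>C\<in>left_module_classes R n.
     1 / real (card (left_module_auto R (SOME M. M \<in> C))))"

definition submodules_of_index ::
    "('r, 'c) ring_scheme \<Rightarrow> ('r, 'm, 'd) module_scheme \<Rightarrow> nat \<Rightarrow> 'm set set" where
  "submodules_of_index R M n =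
     {E. submodule E R M \<and> finite (a_rcosets\<^bsub>M\<^esub> E) \<and> card (a_rcosets\<^bsub>M\<^esub> E) = n}"

definition submodule_zeta ::
    "('r, 'c) ring_scheme \<Rightarrow> ('r, 'm, 'd) module_scheme \<Rightarrow> real formal_dirichlet" where
  "submodule_zeta R M = (\<lambda>n. real (card (submodules_of_index R M n)))"

end

theory Submission
  imports Defs
begin

text \<open>
  A submodule of index \<open>n\<close> of \<open>R\<^sup>d\<close> is the kernel of an epimorphism from \<open>R\<^sup>d\<close> onto a module \<open>M\<close>
  of order \<open>n\<close>, and \<open>M\<close> is unique up to isomorphism. Such an epimorphism is the same as a
  \<open>d\<close>-tuple that generates \<open>M\<close>, and two of them have the same kernel if and only if they differ
  by an automorphism of \<open>M\<close>. Let \<open>g(M, d)\<close> be the number of generating \<open>d\<close>-tuples of \<open>M\<close>. Then the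
  \<open>n\<close>-th coefficient of \<open>\<zeta>(s + d)\<close> of \<open>R\<^sup>d\<close> is \<open>\<Sum> g(M, d) / (n\<^sup>d |Aut M|)\<close>, where \<open>M\<close> runs over
  the isomorphism classes of modules of order \<open>n\<close> (\<open>card_generating_tuples\<close>,
  \<open>submodules_of_index_eq\<close>, \<open>dirichlet_coeff_eq\<close>). So its difference from the coefficient
  \<open>\<Sum> 1 / |Aut M|\<close> weights each class with the proportion \<open>1 - g(M, d) / n\<^sup>d\<close> of the
  \<open>d\<close>-tuples that do not generate.

  A tuple that does not generate lies in a maximal submodule, of index at least \<open>2\<close>. There are at
  most \<open>n\<close> maximal submodules: the functions \<open>[M : H] 1\<^sub>H - 1\<close> that belong to them are
  orthogonal in \<open>\<real>\<^sup>M\<close> (\<open>card_comaximal_subgroups\<close>). Hence the proportion is at most \<open>n / 2\<^sup>d\<close>,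
  which is at most \<open>2 n log n / 2\<^sup>d\<close> unless \<open>n = 1\<close>, when it is \<open>0\<close>.

  The sums make sense because there are finitely many isomorphism classes of order \<open>n\<close>, for
  which it suffices that the action of \<open>R\<close> on a finite module is determined by that of a finite
  set of scalars (\<open>exists_determining_set\<close>). Since \<open>R\<close> is finitely generated over
  \<open>S\<close>, this is clear if \<open>S\<close> is a finitely generated ring. If \<open>S\<close>
  is the completion of a finitely generated ring \<open>A\<close> at an ideal \<open>I\<close>, it holds because every
  ideal of finite index in \<open>S\<close> contains the kernel of \<open>S \<rightarrow> A / I\<^sup>k\<close> for some \<open>k\<close>
  (\<open>finite_index_contains_K\<close>); here \<open>I\<close> must be finitely generated, which follows from Hilbert's
  basis theorem (\<open>hilbert_basis\<close>).
\<close>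

section \<open>Homomorphisms of left modules\<close>

context left_module
begin

lemma smult_r_null:
  assumes a: "a \<in> carrier R"
  shows "a \<odot>\<^bsub>M\<^esub> \<zero>\<^bsub>M\<^esub> = \<zero>\<^bsub>M\<^esub>"
proof -
  have "a \<odot>\<^bsub>M\<^esub> \<zero>\<^bsub>M\<^esub> \<oplus>\<^bsub>M\<^esub> a \<odot>\<^bsub>M\<^esub> \<zero>\<^bsub>M\<^esub> = a \<odot>\<^bsub>M\<^esub> \<zero>\<^bsub>M\<^esub>"
    using smult_r_distr[OF a M.zero_closed M.zero_closed] by simp
  then show ?thesis
    using M.add.l_cancel_one smult_closed[OF a M.zero_closed] by blast
qed

lemma smult_l_null:
  assumes x: "x \<in> carrier M"
  shows "\<zero>\<^bsub>R\<^esub> \<odot>\<^bsub>M\<^esub> x = \<zero>\<^bsub>M\<^esub>"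
proof -
  have "\<zero>\<^bsub>R\<^esub> \<odot>\<^bsub>M\<^esub> x \<oplus>\<^bsub>M\<^esub> \<zero>\<^bsub>R\<^esub> \<odot>\<^bsub>M\<^esub> x = \<zero>\<^bsub>R\<^esub> \<odot>\<^bsub>M\<^esub> x"
    using smult_l_distr[OF R.zero_closed R.zero_closed x] by simp
  then show ?thesis
    using M.add.l_cancel_one smult_closed[OF R.zero_closed x] by blast
qed

lemma smult_l_minus:
  assumes a: "a \<in> carrier R" and x: "x \<in> carrier M"
  shows "(\<ominus>\<^bsub>R\<^esub> a) \<odot>\<^bsub>M\<^esub> x = \<ominus>\<^bsub>M\<^esub> (a \<odot>\<^bsub>M\<^esub> x)"
proof -
  have "(\<ominus>\<^bsub>R\<^esub> a) \<odot>\<^bsub>M\<^esub> x \<oplus>\<^bsub>M\<^esub> a \<odot>\<^bsub>M\<^esub> x = \<zero>\<^bsub>M\<^esub>"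
    using smult_l_distr[of "\<ominus>\<^bsub>R\<^esub> a" a x] a x by (simp add: R.l_neg smult_l_null)
  then show ?thesis
    using a x smult_closed by (metis M.minus_equality R.a_inv_closed)
qed

lemma smult_finsum:
  assumes a: "a \<in> carrier R" and "finite B" and "f \<in> B \<rightarrow> carrier M"
  shows "a \<odot>\<^bsub>M\<^esub> finsum M f B = finsum M (\<lambda>i. a \<odot>\<^bsub>M\<^esub> f i) B"
  using assms(2,3)
proof (induction B rule: finite_induct)
  case empty
  then show ?case by (simp add: smult_r_null a)
next
  case (insert b B)
  then have "f b \<in> carrier M" "f \<in> B \<rightarrow> carrier M" by auto
  moreover have "(\<lambda>i. a \<odot>\<^bsub>M\<^esub> f i) \<in> insert b B \<rightarrow> carrier M"
    using insert.prems a by (auto intro!: smult_closed)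
  ultimately show ?case
    using insert by (simp add: smult_r_distr[OF a] Pi_def)
qed

end

lemma submodule_abelian_subgroup:
  assumes "submodule E R M" "abelian_group M"
  shows "abelian_subgroup E M"
proof -
  interpret M: abelian_group M by fact
  interpret E: submodule E R M by fact
  show ?thesis
    by (intro abelian_subgroupI3 additive_subgroup.intro E.subgroup_axioms M.abelian_group_axioms)
qed

lemma (in abelian_subgroup) rcos_eq_iff:
  assumes "x \<in> carrier G" "y \<in> carrier G"
  shows "H +> x = H +> y \<longleftrightarrow> x \<ominus> y \<in> H"
  using assms by (metis a_rcos_module a_repr_independence' a_rcos_self minus_eq)

text \<open>
  Homomorphisms are constrained on the carrier only. Elsewhere their values are arbitrary.
\<close>

definition left_module_hom ::
    "('r, 'c) ring_scheme \<Rightarrow> ('r, 'm, 'd) module_scheme \<Rightarrow> ('r, 'n, 'e) module_scheme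
      \<Rightarrow> ('m \<Rightarrow> 'n) set" where
  "left_module_hom R M N =
    {h. h \<in> carrier M \<rightarrow> carrier N \<and>
        (\<forall>x\<in>carrier M. \<forall>y\<in>carrier M. h (x \<oplus>\<^bsub>M\<^esub> y) = h x \<oplus>\<^bsub>N\<^esub> h y) \<and>
        (\<forall>a\<in>carrier R. \<forall>x\<in>carrier M. h (a \<odot>\<^bsub>M\<^esub> x) = a \<odot>\<^bsub>N\<^esub> h x)}"

lemma left_module_iso_iff:
  "h \<in> left_module_iso R M N \<longleftrightarrow>
    h \<in> left_module_hom R M N \<and> bij_betw h (carrier M) (carrier N)"
  unfolding left_module_iso_def left_module_hom_def by (auto dest: bij_betwE)

lemma left_module_hom_comp:
  assumes "h \<in> left_module_hom R M N" "g \<in> left_module_hom R N P"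
  shows "g \<circ> h \<in> left_module_hom R M P"
  using assms by (auto simp: left_module_hom_def Pi_iff)

lemma left_module_hom_cong:
  assumes "left_module R M" "h \<in> left_module_hom R M N" "\<And>x. x \<in> carrier M \<Longrightarrow> g x = h x"
  shows "g \<in> left_module_hom R M N"
proof -
  interpret left_module R M by fact
  show ?thesis
    using assms(2,3) smult_closed by (auto simp: left_module_hom_def Pi_iff)
qed

lemma left_module_iso_comp:
  assumes "h \<in> left_module_iso R M N" "g \<in> left_module_iso R N P"
  shows "g \<circ> h \<in> left_module_iso R M P"
  using assms left_module_hom_comp bij_betw_trans unfolding left_module_iso_iff by blast

lemma left_module_iso_id: "id \<in> left_module_iso R M M"
  by (auto simp: left_module_iso_def)

lemma left_module_iso_inv:
  assumes "left_module R M" "h \<in> left_module_iso R M N"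
  shows "inv_into (carrier M) h \<in> left_module_iso R N M"
proof -
  interpret left_module R M by fact
  let ?g = "inv_into (carrier M) h"
  have h: "bij_betw h (carrier M) (carrier N)"
    "\<And>x y. x \<in> carrier M \<Longrightarrow> y \<in> carrier M \<Longrightarrow> h (x \<oplus>\<^bsub>M\<^esub> y) = h x \<oplus>\<^bsub>N\<^esub> h y"
    "\<And>a x. a \<in> carrier R \<Longrightarrow> x \<in> carrier M \<Longrightarrow> h (a \<odot>\<^bsub>M\<^esub> x) = a \<odot>\<^bsub>N\<^esub> h x"
    using assms(2) by (auto simp: left_module_iso_def)
  have g: "bij_betw ?g (carrier N) (carrier M)"
    using h(1) by (rule bij_betw_inv_into)
  have gm: "?g x \<in> carrier M" if "x \<in> carrier N" for x
    using g that by (rule bij_betw_apply)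
  have hg: "h (?g x) = x" if "x \<in> carrier N" for x
    using h(1) that by (rule bij_betw_inv_into_right)
  have gh: "?g (h x) = x" if "x \<in> carrier M" for x
    using h(1) that by (rule bij_betw_inv_into_left)
  have "?g (x \<oplus>\<^bsub>N\<^esub> y) = ?g x \<oplus>\<^bsub>M\<^esub> ?g y" if "x \<in> carrier N" "y \<in> carrier N" for x y
    using gh[of "?g x \<oplus>\<^bsub>M\<^esub> ?g y"] h(2)[of "?g x" "?g y"] gm that hg by simp
  moreover have "?g (a \<odot>\<^bsub>N\<^esub> x) = a \<odot>\<^bsub>M\<^esub> ?g x" if "a \<in> carrier R" "x \<in> carrier N" for a x
    using gh[of "a \<odot>\<^bsub>M\<^esub> ?g x"] h(3)[of a "?g x"] gm that hg smult_closed by simp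
  ultimately show ?thesis
    using g by (simp add: left_module_iso_def)
qed

lemma left_module_hom_abelian_group_hom:
  assumes "left_module R M" "left_module R N" "h \<in> left_module_hom R M N"
  shows "abelian_group_hom M N h"
proof -
  interpret M: left_module R M by fact
  interpret N: left_module R N by fact
  show ?thesis
    using assms(3)
    by (intro abelian_group_homI group_hom.intro group_hom_axioms.intro
        M.M.abelian_group_axioms N.M.abelian_group_axioms M.M.a_group N.M.a_group)
      (auto simp: left_module_hom_def hom_def)
qed

lemma left_module_hom_zero:
  assumes "left_module R M" "left_module R N" "h \<in> left_module_hom R M N"
  shows "h \<zero>\<^bsub>M\<^esub> = \<zero>\<^bsub>N\<^esub>"
  using abelian_group_hom.hom_zero[OF left_module_hom_abelian_group_hom[OF assms]] .

lemma left_module_hom_finsum: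
  assumes "left_module R M" "left_module R N" "h \<in> left_module_hom R M N"
    and "finite B" "f \<in> B \<rightarrow> carrier M"
  shows "h (finsum M f B) = finsum N (\<lambda>i. h (f i)) B"
proof -
  interpret M: left_module R M by fact
  interpret N: left_module R N by fact
  interpret h: abelian_group_hom M N h
    by (rule left_module_hom_abelian_group_hom) fact+
  show ?thesis
    using assms(4,5)
  proof (induction B rule: finite_induct)
    case (insert b B)
    then have "f b \<in> carrier M" "f \<in> B \<rightarrow> carrier M" "(\<lambda>i. h (f i)) \<in> B \<rightarrow> carrier N"
      by (auto simp: Pi_iff)
    with insert show ?case by simp
  qed simp
qed

lemma left_module_hom_minus_eq_zero:
  assumes "left_module R M" "left_module R N" "h \<in> left_module_hom R M N"
    and "x \<in> carrier M" "y \<in> carrier M"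
  shows "h (x \<ominus>\<^bsub>M\<^esub> y) = \<zero>\<^bsub>N\<^esub> \<longleftrightarrow> h x = h y"
proof -
  interpret M: left_module R M by fact
  interpret N: left_module R N by fact
  interpret h: abelian_group_hom M N h
    by (rule left_module_hom_abelian_group_hom) fact+
  have "h (x \<ominus>\<^bsub>M\<^esub> y) = h x \<ominus>\<^bsub>N\<^esub> h y"
    using assms(4,5) by (simp add: a_minus_def)
  moreover have "u \<ominus>\<^bsub>N\<^esub> v = \<zero>\<^bsub>N\<^esub> \<longleftrightarrow> u = v" if "u \<in> carrier N" "v \<in> carrier N" for u v
    using that by (metis N.M.a_inv_closed N.M.minus_equality N.M.minus_minus N.M.r_neg a_minus_def)
  ultimately show ?thesis
    using assms(4,5) by simp
qed

lemma submodule_kernel: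
  assumes "left_module R M" "left_module R N" "h \<in> left_module_hom R M N"
  shows "submodule {x \<in> carrier M. h x = \<zero>\<^bsub>N\<^esub>} R M"
proof -
  interpret M: left_module R M by fact
  interpret N: left_module R N by fact
  interpret h: abelian_group_hom M N h
    by (rule left_module_hom_abelian_group_hom) fact+
  have "additive_subgroup {x \<in> carrier M. h x = \<zero>\<^bsub>N\<^esub>} M"
    using h.additive_subgroup_a_kernel unfolding a_kernel_def' .
  then show ?thesis
    using assms(3) M.smult_closed N.smult_r_null
    by (intro submodule.intro submodule_axioms.intro additive_subgroup.a_subgroup)
      (auto simp: left_module_hom_def)
qed

lemma rcosets_kernel_bij:
  assumes "left_module R M" "left_module R N" "h \<in> left_module_hom R M N"
    and "h ` carrier M = carrier N"
  shows "bij_betw (\<lambda>Y. the_elem (h ` Y)) (a_rcosets\<^bsub>M\<^esub> {x \<in> carrier M. h x = \<zero>\<^bsub>N\<^esub>}) (carrier N)"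
proof -
  interpret M: left_module R M by fact
  interpret N: left_module R N by fact
  interpret h: abelian_group_hom M N h
    by (rule left_module_hom_abelian_group_hom) fact+
  show ?thesis
    using h.A_FactGroup_iso_set[OF assms(4)]
    unfolding iso_def a_kernel_def' A_FactGroup_def' by simp
qed

text \<open>Two epimorphisms with the same kernel differ by an isomorphism of their targets.\<close>

lemma left_module_iso_of_kernels:
  assumes mods: "left_module R F" "left_module R M" "left_module R N"
    and h: "h \<in> left_module_hom R F M" "h ` carrier F = carrier M"
    and h': "h' \<in> left_module_hom R F N" "h' ` carrier F = carrier N"
    and ker: "{x \<in> carrier F. h x = \<zero>\<^bsub>M\<^esub>} = {x \<in> carrier F. h' x = \<zero>\<^bsub>N\<^esub>}"
  obtains g where "g \<in> left_module_iso R M N" "\<And>x. x \<in> carrier F \<Longrightarrow> g (h x) = h' x"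
proof -
  interpret F: left_module R F by fact
  have eq: "h x = h y \<longleftrightarrow> h' x = h' y" if "x \<in> carrier F" "y \<in> carrier F" for x y
    using left_module_hom_minus_eq_zero[OF mods(1,2) h(1) that]
      left_module_hom_minus_eq_zero[OF mods(1,3) h'(1) that] ker that F.M.minus_closed[OF that]
    by blast
  define g where "g = h' \<circ> inv_into (carrier F) h"
  have gh: "g (h x) = h' x" if "x \<in> carrier F" for x
  proof -
    have "inv_into (carrier F) h (h x) \<in> carrier F" "h (inv_into (carrier F) h (h x)) = h x"
      using that by (auto intro: inv_into_into f_inv_into_f)
    then show ?thesis using eq that unfolding g_def by simp
  qed
  have "bij_betw g (carrier M) (carrier N)"
    unfolding bij_betw_def
  proof
    show "inj_on g (carrier M)"
      unfolding h(2)[symmetric] by (auto simp: inj_on_def gh eq)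
    show "g ` carrier M = carrier N"
      unfolding h(2)[symmetric] h'(2)[symmetric] by (force simp: gh)
  qed
  moreover have "g (x \<oplus>\<^bsub>M\<^esub> y) = g x \<oplus>\<^bsub>N\<^esub> g y" if "x \<in> carrier M" "y \<in> carrier M" for x y
  proof -
    have "x \<in> h ` carrier F" "y \<in> h ` carrier F" using that h(2) by simp_all
    then obtain u v where uv: "u \<in> carrier F" "v \<in> carrier F" "x = h u" "y = h v" by blast
    then have "x \<oplus>\<^bsub>M\<^esub> y = h (u \<oplus>\<^bsub>F\<^esub> v)" using h(1) by (simp add: left_module_hom_def)
    then show ?thesis using uv gh h'(1) by (simp add: left_module_hom_def)
  qed
  moreover have "g (a \<odot>\<^bsub>M\<^esub> x) = a \<odot>\<^bsub>N\<^esub> g x" if "a \<in> carrier R" "x \<in> carrier M" for a x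
  proof -
    have "x \<in> h ` carrier F" using that h(2) by simp
    then obtain u where uv: "u \<in> carrier F" "x = h u" by blast
    then have "a \<odot>\<^bsub>M\<^esub> x = h (a \<odot>\<^bsub>F\<^esub> u)" using h(1) that by (simp add: left_module_hom_def)
    then show ?thesis using uv gh h'(1) that F.smult_closed by (simp add: left_module_hom_def)
  qed
  ultimately have "g \<in> left_module_iso R M N" by (simp add: left_module_iso_def)
  then show thesis using gh by (rule that)
qed

section \<open>The free module and generating tuples\<close>

lemma abelian_group_PiE:
  assumes "abelian_group (G :: ('g, 'b) ring_scheme)"
    and "carrier P = I \<rightarrow>\<^sub>E carrier G" "\<zero>\<^bsub>P\<^esub> = (\<lambda>i\<in>I. \<zero>\<^bsub>G\<^esub>)"
    and "\<And>x y. x \<oplus>\<^bsub>P\<^esub> y = (\<lambda>i\<in>I. x i \<oplus>\<^bsub>G\<^esub> y i)"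
  shows "abelian_group P"
proof -
  interpret G: abelian_group G by fact
  have mem: "x i \<in> carrier G" if "x \<in> carrier P" "i \<in> I" for x i
    using that assms(2) by (auto simp: PiE_def)
  show ?thesis
  proof (rule abelian_groupI)
    fix x y z assume xyz: "x \<in> carrier P" "y \<in> carrier P" "z \<in> carrier P"
    show "x \<oplus>\<^bsub>P\<^esub> y \<oplus>\<^bsub>P\<^esub> z = x \<oplus>\<^bsub>P\<^esub> (y \<oplus>\<^bsub>P\<^esub> z)"
      using xyz mem by (auto simp: assms(4) G.a_assoc intro!: restrict_ext)
  next
    fix x y assume xyz: "x \<in> carrier P" "y \<in> carrier P"
    show "x \<oplus>\<^bsub>P\<^esub> y = y \<oplus>\<^bsub>P\<^esub> x"
      using xyz mem by (auto simp: assms(4) G.a_comm intro!: restrict_ext)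
    show "x \<oplus>\<^bsub>P\<^esub> y \<in> carrier P"
      using xyz mem by (auto simp: assms(2,4))
  next
    show "\<zero>\<^bsub>P\<^esub> \<in> carrier P" by (auto simp: assms)
  next
    fix x assume x: "x \<in> carrier P"
    then have e: "x = (\<lambda>i\<in>I. x i)" using assms(2) by auto
    have "\<zero>\<^bsub>P\<^esub> \<oplus>\<^bsub>P\<^esub> x = (\<lambda>i\<in>I. x i)"
      using x mem by (auto simp: assms(3,4) intro!: restrict_ext)
    then show "\<zero>\<^bsub>P\<^esub> \<oplus>\<^bsub>P\<^esub> x = x" using e by simp
    show "\<exists>y\<in>carrier P. y \<oplus>\<^bsub>P\<^esub> x = \<zero>\<^bsub>P\<^esub>"
      by (rule bexI[of _ "\<lambda>i\<in>I. \<ominus>\<^bsub>G\<^esub> x i"])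
        (use x mem in \<open>auto simp: assms(2,3,4) G.l_neg intro!: restrict_ext\<close>)
  qed
qed

lemma left_module_free:
  assumes "ring R"
  shows "left_module R (free_left_module R d)"
proof -
  interpret R: ring R by fact
  interpret P: abelian_group "free_left_module R d"
    by (rule abelian_group_PiE[OF R.abelian_group_axioms, where I = "{..<d}"])
      (simp_all add: free_left_module_def)
  have mem: "x i \<in> carrier R" if "x \<in> carrier (free_left_module R d)" "i < d" for x i
    using that by (auto simp: free_left_module_def PiE_def)
  show ?thesis
  proof unfold_locales
    fix a x assume "a \<in> carrier R" "x \<in> carrier (free_left_module R d)"
    then show "a \<odot>\<^bsub>free_left_module R d\<^esub> x \<in> carrier (free_left_module R d)"
      using mem by (auto simp: free_left_module_def)
  next
    fix x assume x: "x \<in> carrier (free_left_module R d)"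
    show "\<one>\<^bsub>R\<^esub> \<odot>\<^bsub>free_left_module R d\<^esub> x = x"
    proof
      fix i
      show "(\<one>\<^bsub>R\<^esub> \<odot>\<^bsub>free_left_module R d\<^esub> x) i = x i"
      proof (cases "i < d")
        case True
        with mem[OF x True] show ?thesis by (simp add: free_left_module_def)
      next
        case False
        with x show ?thesis by (auto simp: free_left_module_def PiE_def extensional_def)
      qed
    qed
  qed (use mem in \<open>auto simp: free_left_module_def R.l_distr R.r_distr R.m_assoc
      intro!: restrict_ext\<close>)
qed

text \<open>The linear combination \<open>\<Sum> x\<^sub>i t\<^sub>i\<close>, as a function of the tuple \<open>x\<close> of scalars.\<close>

definition lincomb ::
    "('r, 'm, 'd) module_scheme \<Rightarrow> nat \<Rightarrow> (nat \<Rightarrow> 'm) \<Rightarrow> (nat \<Rightarrow> 'r) \<Rightarrow> 'm" where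
  "lincomb M d t x = finsum M (\<lambda>i. x i \<odot>\<^bsub>M\<^esub> t i) {..<d}"

lemma lincomb_hom:
  assumes "left_module R M" "t \<in> {..<d} \<rightarrow> carrier M"
  shows "lincomb M d t \<in> left_module_hom R (free_left_module R d) M"
proof -
  interpret left_module R M by fact
  have t: "t i \<in> carrier M" if "i < d" for i using assms(2) that by auto
  have mem: "x i \<in> carrier R" if "x \<in> carrier (free_left_module R d)" "i < d" for x i
    using that by (auto simp: free_left_module_def PiE_def)
  have cl: "(\<lambda>i. x i \<odot>\<^bsub>M\<^esub> t i) \<in> {..<d} \<rightarrow> carrier M"
    if "x \<in> carrier (free_left_module R d)" for x
    using mem[OF that] t smult_closed by auto
  show ?thesis
    unfolding left_module_hom_def
  proof (safe)
    fix x assume x: "x \<in> carrier (free_left_module R d)"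
    show "lincomb M d t x \<in> carrier M"
      unfolding lincomb_def using cl[OF x] by (rule M.finsum_closed)
    fix a assume a: "a \<in> carrier R"
    have "lincomb M d t (a \<odot>\<^bsub>free_left_module R d\<^esub> x)
        = finsum M (\<lambda>i. a \<odot>\<^bsub>M\<^esub> (x i \<odot>\<^bsub>M\<^esub> t i)) {..<d}"
      unfolding lincomb_def using mem[OF x] t a
      by (intro M.finsum_cong')
        (auto simp: free_left_module_def smult_assoc intro!: smult_closed)
    also have "\<dots> = a \<odot>\<^bsub>M\<^esub> lincomb M d t x"
      unfolding lincomb_def using smult_finsum[OF a _ cl[OF x]] by simp
    finally show "lincomb M d t (a \<odot>\<^bsub>free_left_module R d\<^esub> x) = a \<odot>\<^bsub>M\<^esub> lincomb M d t x" .
  next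
    fix x y
    assume x: "x \<in> carrier (free_left_module R d)" and y: "y \<in> carrier (free_left_module R d)"
    have "lincomb M d t (x \<oplus>\<^bsub>free_left_module R d\<^esub> y)
        = finsum M (\<lambda>i. x i \<odot>\<^bsub>M\<^esub> t i \<oplus>\<^bsub>M\<^esub> y i \<odot>\<^bsub>M\<^esub> t i) {..<d}"
      unfolding lincomb_def using mem[OF x] mem[OF y] t
      by (intro M.finsum_cong')
        (auto simp: free_left_module_def smult_l_distr intro!: smult_closed)
    also have "\<dots> = lincomb M d t x \<oplus>\<^bsub>M\<^esub> lincomb M d t y"
      unfolding lincomb_def using M.finsum_addf[OF cl[OF x] cl[OF y]] .
    finally show "lincomb M d t (x \<oplus>\<^bsub>free_left_module R d\<^esub> y)
        = lincomb M d t x \<oplus>\<^bsub>M\<^esub> lincomb M d t y" .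
  qed
qed

text \<open>The \<open>i\<close>-th standard basis vector of \<open>R\<^sup>d\<close>, extensional like all elements of \<open>R\<^sup>d\<close>.\<close>

definition unit_tuple :: "('r, 'c) ring_scheme \<Rightarrow> nat \<Rightarrow> nat \<Rightarrow> nat \<Rightarrow> 'r" where
  "unit_tuple R d i = (\<lambda>j\<in>{..<d}. if j = i then \<one>\<^bsub>R\<^esub> else \<zero>\<^bsub>R\<^esub>)"

lemma unit_tuple_closed:
  assumes "ring R"
  shows "unit_tuple R d i \<in> carrier (free_left_module R d)"
proof -
  interpret ring R by fact
  show ?thesis by (auto simp: unit_tuple_def free_left_module_def)
qed

lemma lincomb_unit_tuple:
  assumes "left_module R M" "t \<in> {..<d} \<rightarrow> carrier M" "i < d"
  shows "lincomb M d t (unit_tuple R d i) = t i"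
proof -
  interpret left_module R M by fact
  have t: "t i \<in> carrier M" if "i < d" for i using assms(2) that by auto
  have "lincomb M d t (unit_tuple R d i)
      = finsum M (\<lambda>j. if i = j then t j else \<zero>\<^bsub>M\<^esub>) {..<d}"
    unfolding lincomb_def
    by (intro M.finsum_cong') (auto simp: unit_tuple_def t smult_one smult_l_null)
  also have "\<dots> = t i"
    using assms(2,3) by (intro M.finsum_singleton) auto
  finally show ?thesis .
qed

text \<open>The standard basis vectors generate \<open>R\<^sup>d\<close>.\<close>

lemma free_left_module_expand:
  assumes "ring R" "x \<in> carrier (free_left_module R d)"
  shows "lincomb (free_left_module R d) d (unit_tuple R d) x = x"
proof -
  interpret R: ring R by fact
  interpret F: left_module R "free_left_module R d" using assms(1) by (rule left_module_free)
  let ?F = "free_left_module R d"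
  have mem: "x i \<in> carrier R" if "i < d" for i
    using that assms(2) by (auto simp: free_left_module_def PiE_def)
  have u: "unit_tuple R d i \<in> carrier ?F" for i using assms(1) by (rule unit_tuple_closed)
  have cl: "(\<lambda>i. x i \<odot>\<^bsub>?F\<^esub> unit_tuple R d i) \<in> B \<rightarrow> carrier ?F" if "B \<subseteq> {..<d}" for B
    using that mem u by (auto intro!: F.smult_closed)
  have "finsum ?F (\<lambda>i. x i \<odot>\<^bsub>?F\<^esub> unit_tuple R d i) B = (\<lambda>j\<in>{..<d}. if j \<in> B then x j else \<zero>\<^bsub>R\<^esub>)"
    if "finite B" "B \<subseteq> {..<d}" for B
    using that
  proof (induction B rule: finite_induct)
    case empty
    show ?case unfolding F.M.finsum_empty by (auto simp: free_left_module_def)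
  next
    case (insert b B)
    then have b: "b < d" and B: "B \<subseteq> {..<d}" by auto
    have 1: "finsum ?F (\<lambda>i. x i \<odot>\<^bsub>?F\<^esub> unit_tuple R d i) (insert b B)
        = x b \<odot>\<^bsub>?F\<^esub> unit_tuple R d b \<oplus>\<^bsub>?F\<^esub> finsum ?F (\<lambda>i. x i \<odot>\<^bsub>?F\<^esub> unit_tuple R d i) B"
      using insert by (intro F.M.finsum_insert cl) (auto intro!: F.smult_closed mem u)
    show ?case
      unfolding 1 insert.IH[OF B]
    proof
      fix j
      show "(x b \<odot>\<^bsub>?F\<^esub> unit_tuple R d b \<oplus>\<^bsub>?F\<^esub> (\<lambda>j\<in>{..<d}. if j \<in> B then x j else \<zero>\<^bsub>R\<^esub>)) j
          = (\<lambda>j\<in>{..<d}. if j \<in> insert b B then x j else \<zero>\<^bsub>R\<^esub>) j"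
        using insert.hyps(2) b mem[of j] mem[of b]
        by (cases "j < d"; cases "j = b"; cases "j \<in> B")
          (simp_all add: free_left_module_def unit_tuple_def)
    qed
  qed
  from this[of "{..<d}"] have "lincomb ?F d (unit_tuple R d) x = (\<lambda>j\<in>{..<d}. x j)"
    unfolding lincomb_def by (auto intro!: restrict_ext)
  also have "\<dots> = x" using assms(2) by (auto simp: free_left_module_def)
  finally show ?thesis .
qed

text \<open>A homomorphism out of \<open>R\<^sup>d\<close> is determined by the images of the standard basis.\<close>

lemma left_module_hom_free:
  assumes "left_module R M" "h \<in> left_module_hom R (free_left_module R d) M"
    and "x \<in> carrier (free_left_module R d)"
  shows "h x = lincomb M d (\<lambda>i. h (unit_tuple R d i)) x"
proof -
  interpret left_module R M by fact
  let ?F = "free_left_module R d"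
  interpret F: left_module R ?F using R.ring_axioms by (rule left_module_free)
  have mem: "x i \<in> carrier R" if "i < d" for i
    using that assms(3) by (auto simp: free_left_module_def PiE_def)
  have u: "unit_tuple R d i \<in> carrier ?F" for i using R.ring_axioms by (rule unit_tuple_closed)
  have hu: "h (unit_tuple R d i) \<in> carrier M" for i
    using assms(2) u by (auto simp: left_module_hom_def)
  have "h x = h (lincomb ?F d (unit_tuple R d) x)"
    using free_left_module_expand[OF R.ring_axioms assms(3)] by simp
  also have "\<dots> = finsum M (\<lambda>i. h (x i \<odot>\<^bsub>?F\<^esub> unit_tuple R d i)) {..<d}"
    unfolding lincomb_def
    by (rule left_module_hom_finsum[OF F.left_module_axioms assms(1,2)])
      (auto intro!: F.smult_closed mem u)
  also have "\<dots> = lincomb M d (\<lambda>i. h (unit_tuple R d i)) x"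
    unfolding lincomb_def using assms(2) mem u hu
    by (intro M.finsum_cong') (auto simp: left_module_hom_def intro!: smult_closed)
  finally show ?thesis .
qed

lemma lincomb_cong:
  assumes "left_module R M" "t \<in> {..<d} \<rightarrow> carrier M"
    and "x \<in> carrier (free_left_module R d)" "\<And>i. i < d \<Longrightarrow> t' i = t i"
  shows "lincomb M d t' x = lincomb M d t x"
proof -
  interpret left_module R M by fact
  have "x i \<in> carrier R" if "i < d" for i
    using that assms(3) by (auto simp: free_left_module_def PiE_def)
  then show ?thesis
    unfolding lincomb_def using assms(2,4)
    by (intro M.finsum_cong') (auto intro!: smult_closed)
qed

lemma hom_lincomb:
  assumes "left_module R M" "left_module R N" "g \<in> left_module_hom R M N"
    and "t \<in> {..<d} \<rightarrow> carrier M" "x \<in> carrier (free_left_module R d)"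
  shows "g (lincomb M d t x) = lincomb N d (g \<circ> t) x"
proof -
  interpret M: left_module R M by fact
  interpret N: left_module R N by fact
  have mem: "x i \<in> carrier R" if "i < d" for i
    using that assms(5) by (auto simp: free_left_module_def PiE_def)
  have "g (lincomb M d t x) = finsum N (\<lambda>i. g (x i \<odot>\<^bsub>M\<^esub> t i)) {..<d}"
    unfolding lincomb_def using assms(4) mem
    by (intro left_module_hom_finsum[OF assms(1-3)]) (auto intro!: M.smult_closed)
  also have "\<dots> = lincomb N d (g \<circ> t) x"
    unfolding lincomb_def using assms(3,4) mem
    by (intro N.M.finsum_cong')
      (auto simp: left_module_hom_def Pi_iff intro!: N.smult_closed)
  finally show ?thesis .
qed

text \<open>
  The \<open>d\<close>-tuples that generate \<open>M\<close>, that is, the epimorphisms \<open>R\<^sup>d \<rightarrow> M\<close>. Tuples are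
  extensional, so that each is counted once.
\<close>

definition generating_tuples ::
    "('r, 'c) ring_scheme \<Rightarrow> ('r, 'm, 'd) module_scheme \<Rightarrow> nat \<Rightarrow> (nat \<Rightarrow> 'm) set" where
  "generating_tuples R M d =
    {t \<in> {..<d} \<rightarrow>\<^sub>E carrier M. lincomb M d t ` carrier (free_left_module R d) = carrier M}"

text \<open>The kernel of the epimorphism \<open>R\<^sup>d \<rightarrow> M\<close> that belongs to a generating tuple.\<close>

definition tuple_relations ::
    "('r, 'c) ring_scheme \<Rightarrow> ('r, 'm, 'd) module_scheme \<Rightarrow> nat \<Rightarrow> (nat \<Rightarrow> 'm)
      \<Rightarrow> (nat \<Rightarrow> 'r) set" where
  "tuple_relations R M d t = {x \<in> carrier (free_left_module R d). lincomb M d t x = \<zero>\<^bsub>M\<^esub>}"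

lemma generating_tuples_hom:
  assumes "left_module R M" "t \<in> generating_tuples R M d"
  shows "lincomb M d t \<in> left_module_hom R (free_left_module R d) M"
    "lincomb M d t ` carrier (free_left_module R d) = carrier M"
  using assms by (auto simp: generating_tuples_def intro!: lincomb_hom)

lemma tuple_relations_index:
  assumes "left_module R M" "finite (carrier M)" "t \<in> generating_tuples R M d"
  shows "tuple_relations R M d t
    \<in> submodules_of_index R (free_left_module R d) (card (carrier M))"
proof -
  interpret left_module R M by fact
  interpret F: left_module R "free_left_module R d"
    using R.ring_axioms by (rule left_module_free)
  note h = generating_tuples_hom[OF assms(1,3)]
  note b = rcosets_kernel_bij[OF F.left_module_axioms assms(1) h]
  show ?thesis
    unfolding submodules_of_index_def tuple_relations_def
    using submodule_kernel[OF F.left_module_axioms assms(1) h(1)]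
      bij_betw_finite[OF b] bij_betw_same_card[OF b] assms(2) by simp
qed

lemma iso_of_tuple_relations:
  assumes "left_module R M" "left_module R N"
    and "t \<in> generating_tuples R M d" "t' \<in> generating_tuples R N d"
    and "tuple_relations R M d t = tuple_relations R N d t'"
  obtains g where "g \<in> left_module_iso R M N" "\<And>i. i < d \<Longrightarrow> g (t i) = t' i"
proof -
  interpret left_module R M by fact
  have F: "left_module R (free_left_module R d)" using R.ring_axioms by (rule left_module_free)
  obtain g where g: "g \<in> left_module_iso R M N"
    "\<And>x. x \<in> carrier (free_left_module R d) \<Longrightarrow> g (lincomb M d t x) = lincomb N d t' x"
    using left_module_iso_of_kernels[OF F assms(1,2) generating_tuples_hom[OF assms(1,3)]
        generating_tuples_hom[OF assms(2,4)] assms(5)[unfolded tuple_relations_def]] by blast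
  have "g (t i) = t' i" if "i < d" for i
    using g(2)[OF unit_tuple_closed[OF R.ring_axioms], of i] that assms(3,4)
      lincomb_unit_tuple[OF assms(1), of t d i] lincomb_unit_tuple[OF assms(2), of t' d i]
    by (auto simp: generating_tuples_def PiE_def)
  with g(1) show thesis by (rule that)
qed

lemma generating_tuples_iso:
  assumes "left_module R M" "left_module R N" "g \<in> left_module_iso R M N"
    and t: "t \<in> generating_tuples R M d"
  shows "restrict (g \<circ> t) {..<d} \<in> generating_tuples R N d"
    "tuple_relations R N d (restrict (g \<circ> t) {..<d}) = tuple_relations R M d t"
proof -
  interpret left_module R M by fact
  have g: "g \<in> left_module_hom R M N" "bij_betw g (carrier M) (carrier N)"
    using assms(3) by (auto simp: left_module_iso_iff)
  have tM: "t \<in> {..<d} \<rightarrow> carrier M" using t by (auto simp: generating_tuples_def)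
  have gt: "g \<circ> t \<in> {..<d} \<rightarrow> carrier N" using tM bij_betwE[OF g(2)] by auto
  have lc: "lincomb N d (restrict (g \<circ> t) {..<d}) x = g (lincomb M d t x)"
    if "x \<in> carrier (free_left_module R d)" for x
    using lincomb_cong[OF assms(2) gt that, of "restrict (g \<circ> t) {..<d}"]
      hom_lincomb[OF assms(1,2) g(1) tM that] by simp
  have "lincomb N d (restrict (g \<circ> t) {..<d}) ` carrier (free_left_module R d)
      = g ` lincomb M d t ` carrier (free_left_module R d)"
    using lc by (auto simp: image_iff)
  also have "\<dots> = carrier N"
    using t g(2) by (auto simp: generating_tuples_def bij_betw_def)
  finally show "restrict (g \<circ> t) {..<d} \<in> generating_tuples R N d"
    using gt by (auto simp: generating_tuples_def)
  have "g y = \<zero>\<^bsub>N\<^esub> \<longleftrightarrow> y = \<zero>\<^bsub>M\<^esub>" if "y \<in> carrier M" for y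
    using left_module_hom_zero[OF assms(1,2) g(1)] g(2) that
    by (metis M.zero_closed bij_betw_def inj_on_eq_iff)
  moreover have "lincomb M d t x \<in> carrier M" if "x \<in> carrier (free_left_module R d)" for x
    using lincomb_hom[OF assms(1) tM] that by (auto simp: left_module_hom_def)
  ultimately show "tuple_relations R N d (restrict (g \<circ> t) {..<d}) = tuple_relations R M d t"
    unfolding tuple_relations_def using lc by auto
qed

lemma (in left_module) finite_generating_tuples:
  assumes "finite (carrier M)"
  shows "finite (generating_tuples R M d)"
  by (rule finite_subset[of _ "{..<d} \<rightarrow>\<^sub>E carrier M"])
    (use assms in \<open>auto simp: generating_tuples_def intro!: finite_PiE\<close>)

text \<open>
  The automorphism group of a finite module \<open>M\<close> acts freely on the generating tuples, and its
  orbits are the fibres of the map that sends a generating tuple to its relations.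
\<close>

lemma card_generating_tuples:
  assumes M: "left_module R M" and fin: "finite (carrier M)"
  shows "card (generating_tuples R M d)
    = card (left_module_auto R M) * card (tuple_relations R M d ` generating_tuples R M d)"
proof -
  interpret left_module R M by fact
  let ?T = "generating_tuples R M d" and ?ker = "tuple_relations R M d"
  have finT: "finite ?T" using fin by (rule finite_generating_tuples)
  have fibre: "card {t \<in> ?T. ?ker t = E} = card (left_module_auto R M)"
    if "E \<in> ?ker ` ?T" for E
  proof -
    obtain t where t: "t \<in> ?T" and E: "E = ?ker t" using \<open>E \<in> ?ker ` ?T\<close> by auto
    have tM: "t \<in> {..<d} \<rightarrow> carrier M" using t by (auto simp: generating_tuples_def)
    have "bij_betw (\<lambda>g. restrict (g \<circ> t) {..<d}) (left_module_auto R M) {t' \<in> ?T. ?ker t' = E}"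
      unfolding bij_betw_def
    proof
      show "inj_on (\<lambda>g. restrict (g \<circ> t) {..<d}) (left_module_auto R M)"
      proof (rule inj_onI)
        fix g g'
        assume g: "g \<in> left_module_auto R M" and g': "g' \<in> left_module_auto R M"
          and eq: "restrict (g \<circ> t) {..<d} = restrict (g' \<circ> t) {..<d}"
        have h: "g \<in> left_module_hom R M M" "g' \<in> left_module_hom R M M"
          "g \<in> extensional (carrier M)" "g' \<in> extensional (carrier M)"
          using g g' by (auto simp: left_module_auto_def left_module_iso_iff)
        have gt: "g \<circ> t \<in> {..<d} \<rightarrow> carrier M"
          using h(1) tM by (auto simp: left_module_hom_def)
        have "g y = g' y" if "y \<in> carrier M" for y
        proof -
          have "y \<in> lincomb M d t ` carrier (free_left_module R d)"
            using t that by (simp add: generating_tuples_def)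
          then obtain x where x: "x \<in> carrier (free_left_module R d)" "y = lincomb M d t x"
            by blast
          have "(g' \<circ> t) i = (g \<circ> t) i" if "i < d" for i
            using fun_cong[OF eq, of i] that by simp
          then have "lincomb M d (g' \<circ> t) x = lincomb M d (g \<circ> t) x"
            by (rule lincomb_cong[OF M gt x(1)])
          then show ?thesis
            using hom_lincomb[OF M M h(1) tM x(1)] hom_lincomb[OF M M h(2) tM x(1)] x(2) by simp
        qed
        then show "g = g'" using h(3,4) by (rule extensionalityI[rotated 2])
      qed
      show "(\<lambda>g. restrict (g \<circ> t) {..<d}) ` left_module_auto R M = {t' \<in> ?T. ?ker t' = E}"
      proof (intro equalityI subsetI)
        fix s assume "s \<in> (\<lambda>g. restrict (g \<circ> t) {..<d}) ` left_module_auto R M"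
        then show "s \<in> {t' \<in> ?T. ?ker t' = E}"
          using generating_tuples_iso[OF M M _ t] E by (auto simp: left_module_auto_def)
      next
        fix s assume "s \<in> {t' \<in> ?T. ?ker t' = E}"
        then have s: "s \<in> ?T" "?ker t = ?ker s" using E by auto
        obtain g where g: "g \<in> left_module_iso R M M" "\<And>i. i < d \<Longrightarrow> g (t i) = s i"
          by (rule iso_of_tuple_relations[OF M M t s], rule that)
        \<comment> \<open>automorphisms are counted as extensional functions\<close>
        define g' where "g' = restrict g (carrier M)"
        have "g' \<in> left_module_hom R M M"
          by (rule left_module_hom_cong[OF M, of g]) (use g(1) in \<open>auto simp: left_module_iso_iff g'_def\<close>)
        moreover have "bij_betw g' (carrier M) (carrier M)"
          using g(1) bij_betw_cong[of "carrier M" g' g] by (auto simp: left_module_iso_iff g'_def)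
        ultimately have "g' \<in> left_module_auto R M"
          by (auto simp: left_module_auto_def left_module_iso_iff g'_def)
        moreover have "s = restrict (g' \<circ> t) {..<d}"
        proof
          fix i show "s i = restrict (g' \<circ> t) {..<d} i"
            using s(1) g(2) tM by (auto simp: generating_tuples_def g'_def PiE_def extensional_def)
        qed
        ultimately show "s \<in> (\<lambda>g. restrict (g \<circ> t) {..<d}) ` left_module_auto R M" by blast
      qed
    qed
    then show ?thesis by (simp add: bij_betw_same_card)
  qed
  have "card ?T = (\<Sum>E\<in>?ker ` ?T. card {t \<in> ?T. ?ker t = E})"
    using sum.image_gen[OF finT, of "\<lambda>_. 1 :: nat" ?ker] by simp
  also have "\<dots> = (\<Sum>E\<in>?ker ` ?T. card (left_module_auto R M))"
    by (rule sum.cong) (auto simp: fibre)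
  finally show ?thesis by simp
qed

section \<open>Maximal submodules of a finite module\<close>

text \<open>The fibres of the addition \<open>H \<times> K \<rightarrow> H + K\<close> are translates of \<open>{(w, -w) | w \<in> H \<inter> K}\<close>.\<close>

lemma (in abelian_group) card_subgroup_product:
  assumes fin: "finite (carrier G)" and H: "additive_subgroup H G" and K: "additive_subgroup K G"
    and sum: "H <+> K = carrier G"
  shows "card H * card K = card (H \<inter> K) * card (carrier G)"
proof -
  interpret H: additive_subgroup H G by fact
  interpret K: additive_subgroup K G by fact
  let ?f = "\<lambda>(x, y). x \<oplus> y"
  have finHK: "finite (H \<times> K)"
    using fin H.a_subset K.a_subset by (auto intro: finite_subset)
  have im: "?f ` (H \<times> K) = carrier G"
    unfolding sum[symmetric] set_add_def' by auto
  have fibre: "card {p \<in> H \<times> K. ?f p = z} = card (H \<inter> K)" if z: "z \<in> carrier G" for z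
  proof -
    from z im obtain x y where xy: "x \<in> H" "y \<in> K" "z = x \<oplus> y" by force
    have c: "x \<in> carrier G" "y \<in> carrier G" using xy by auto
    have "bij_betw (\<lambda>w. (x \<oplus> w, y \<ominus> w)) (H \<inter> K) {p \<in> H \<times> K. ?f p = z}"
      unfolding bij_betw_def
    proof
      show "inj_on (\<lambda>w. (x \<oplus> w, y \<ominus> w)) (H \<inter> K)"
        using c by (auto simp: inj_on_def)
      show "(\<lambda>w. (x \<oplus> w, y \<ominus> w)) ` (H \<inter> K) = {p \<in> H \<times> K. ?f p = z}"
      proof (intro equalityI subsetI)
        fix p assume "p \<in> (\<lambda>w. (x \<oplus> w, y \<ominus> w)) ` (H \<inter> K)"
        then obtain w where w: "w \<in> H" "w \<in> K" "p = (x \<oplus> w, y \<ominus> w)" by auto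
        have "w \<in> carrier G" using w by auto
        then have "(x \<oplus> w) \<oplus> (y \<ominus> w) = x \<oplus> y"
          using c by (simp add: a_minus_def a_comm[of y "\<ominus> w"] a_assoc r_neg2)
        moreover have "y \<ominus> w \<in> K" using w xy by (simp add: a_minus_def)
        ultimately show "p \<in> {p \<in> H \<times> K. ?f p = z}" using w xy by auto
      next
        fix p assume "p \<in> {p \<in> H \<times> K. ?f p = z}"
        then obtain u v where uv: "u \<in> H" "v \<in> K" "p = (u, v)" "u \<oplus> v = x \<oplus> y"
          using xy by auto
        have c': "u \<in> carrier G" "v \<in> carrier G" using uv by auto
        have "u \<oplus> \<ominus> x = (u \<oplus> v) \<oplus> (\<ominus> v \<oplus> \<ominus> x)"
          using c c' by (simp add: a_assoc r_neg2)
        also have "\<dots> = \<ominus> x \<oplus> (x \<oplus> (y \<oplus> \<ominus> v))"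
          unfolding uv(4) using c c' by (simp add: a_ac)
        also have "\<dots> = y \<oplus> \<ominus> v" using c c' by (simp add: r_neg1)
        finally have "u \<ominus> x = y \<ominus> v" by (simp add: a_minus_def)
        moreover have "u \<ominus> x \<in> H" "y \<ominus> v \<in> K" using uv xy by (auto simp: a_minus_def)
        ultimately have w: "u \<ominus> x \<in> H \<inter> K" by simp
        have "x \<oplus> (u \<ominus> x) = u" using c c' by (simp add: a_minus_def a_comm[of u "\<ominus> x"] r_neg2)
        moreover have "y \<ominus> (u \<ominus> x) = v"
          unfolding \<open>u \<ominus> x = y \<ominus> v\<close> using c c'
          by (simp add: a_minus_def minus_add r_neg2)
        ultimately show "p \<in> (\<lambda>w. (x \<oplus> w, y \<ominus> w)) ` (H \<inter> K)"
          using w uv(3) by (intro image_eqI[OF _ w]) simp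
      qed
    qed
    then show ?thesis by (simp add: bij_betw_same_card)
  qed
  have "card (H \<times> K) = (\<Sum>z\<in>?f ` (H \<times> K). card {p \<in> H \<times> K. ?f p = z})"
    using sum.image_gen[OF finHK, of "\<lambda>_. 1 :: nat" ?f] by simp
  also have "\<dots> = (\<Sum>z\<in>carrier G. card (H \<inter> K))"
    unfolding im by (rule sum.cong) (auto simp: fibre)
  finally show ?thesis by (simp add: card_cartesian_product)
qed

lemma (in abelian_group) card_additive_subgroup_dvd:
  assumes "additive_subgroup H G"
  shows "card H dvd card (carrier G)"
proof -
  interpret H: additive_subgroup H G by fact
  show ?thesis
    using add.lagrange[OF H.a_subgroup] by (simp add: order_def) (metis dvd_triv_right)
qed

text \<open>
  The functions \<open>u\<^sub>H = [G : H] 1\<^sub>H - 1\<close>, for \<open>H\<close> in a family of proper subgroups with pairwise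
  sum \<open>G\<close>, are orthogonal in \<open>\<real>\<^sup>G\<close>, with \<open>|u\<^sub>H|\<^sup>2 = |G| ([G : H] - 1) = |G| u\<^sub>H(0)\<close>. So for
  \<open>F = \<Sum> u\<^sub>H\<close> one has \<open>F(0)\<^sup>2 \<le> |F|\<^sup>2 = |G| F(0)\<close>, that is \<open>\<Sum> ([G : H] - 1) \<le> |G|\<close>.
\<close>

lemma (in abelian_group) card_comaximal_subgroups:
  assumes fin: "finite (carrier G)"
    and sub: "\<And>H. H \<in> \<H> \<Longrightarrow> additive_subgroup H G"
    and proper: "\<And>H. H \<in> \<H> \<Longrightarrow> H \<noteq> carrier G"
    and comax: "\<And>H K. H \<in> \<H> \<Longrightarrow> K \<in> \<H> \<Longrightarrow> H \<noteq> K \<Longrightarrow> H <+> K = carrier G"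
  shows "card \<H> \<le> card (carrier G)"
proof -
  define n where "n = real (card (carrier G))"
  define p where "p H = n / real (card H)" for H :: "'a set"
  define u where "u H g = p H * of_bool (g \<in> H) - 1" for H and g :: 'a
  define T where "T = (\<Sum>H\<in>\<H>. p H - 1)"
  have subH: "H \<subseteq> carrier G" "\<zero> \<in> H" if "H \<in> \<H>" for H
    using additive_subgroup.a_subset[OF sub[OF that]] additive_subgroup.zero_closed[OF sub[OF that]]
    by simp_all
  have finH: "finite H" if "H \<in> \<H>" for H
    using subH(1)[OF that] fin by (rule finite_subset)
  have fin\<H>: "finite \<H>"
    by (rule finite_subset[of \<H> "Pow (carrier G)"]) (use subH(1) fin in auto)
  have cardH: "0 < card H" if "H \<in> \<H>" for H
    using subH(2)[OF that] finH[OF that] by (auto simp: card_gt_0_iff)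
  have n: "n > 0" unfolding n_def using fin by (auto simp: card_gt_0_iff)
  have p2: "p H \<ge> 2" if H: "H \<in> \<H>" for H
  proof -
    obtain k where k: "card (carrier G) = card H * k"
      using card_additive_subgroup_dvd[OF sub[OF H]] by (auto elim: dvdE)
    have "card H < card (carrier G)"
      using subH(1)[OF H] proper[OF H] fin by (intro psubset_card_mono) auto
    then have "card H * 1 < card H * k" unfolding k by simp
    then have "2 \<le> k" unfolding mult_less_cancel1 by simp
    then show ?thesis unfolding p_def n_def using k cardH[OF H] by simp
  qed
  have ind: "(\<Sum>g\<in>carrier G. of_bool (g \<in> A) :: real) = card A" if "A \<subseteq> carrier G" for A
    using that fin by (simp add: sum_of_bool_eq Int_absorb1)
  have uu: "(\<Sum>g\<in>carrier G. u H g * u K g) = p H * p K * card (H \<inter> K) - n"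
    if H: "H \<in> \<H>" and K: "K \<in> \<H>" for H K
  proof -
    have "(\<Sum>g\<in>carrier G. u H g * u K g)
        = (\<Sum>g\<in>carrier G. p H * p K * of_bool (g \<in> H \<inter> K) - p H * of_bool (g \<in> H)
            - p K * of_bool (g \<in> K) + 1)"
      by (rule sum.cong) (auto simp: u_def algebra_simps)
    also have "\<dots> = p H * p K * card (H \<inter> K) - p H * card H - p K * card K + n"
      using subH(1)[OF H] subH(1)[OF K]
      by (simp add: sum.distrib sum_subtractf sum_distrib_left[symmetric] ind n_def le_infI1
          del: Int_iff)
    also have "\<dots> = p H * p K * card (H \<inter> K) - n"
      using cardH[OF H] cardH[OF K] by (simp add: p_def)
    finally show ?thesis .
  qed
  have orth: "(\<Sum>g\<in>carrier G. u H g * u K g) = (if H = K then n * (p H - 1) else 0)"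
    if H: "H \<in> \<H>" and K: "K \<in> \<H>" for H K
  proof (cases "H = K")
    case True
    then show ?thesis
      unfolding uu[OF H K] using cardH[OF H] by (simp add: p_def field_simps)
  next
    case False
    have "card H * card K = card (H \<inter> K) * card (carrier G)"
      using card_subgroup_product[OF fin sub[OF H] sub[OF K] comax[OF H K False]] .
    then have "real (card H) * real (card K) = real (card (H \<inter> K)) * n"
      unfolding n_def by (metis of_nat_mult)
    moreover from this have "card (H \<inter> K) \<noteq> 0"
      using cardH[OF H] cardH[OF K] by (intro notI) simp
    moreover have "p H * p K * real (card (H \<inter> K))
        = n * (real (card (H \<inter> K)) * n) / (real (card H) * real (card K))"
      by (simp add: p_def)
    ultimately have "p H * p K * real (card (H \<inter> K)) = n"
      using n by simp
    then show ?thesis unfolding uu[OF H K] using False by simp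
  qed
  have "(\<Sum>H\<in>\<H>. u H \<zero>) = T"
    unfolding T_def u_def using subH(2) by (intro sum.cong) auto
  moreover have "(\<Sum>H\<in>\<H>. u H \<zero>)\<^sup>2 \<le> (\<Sum>g\<in>carrier G. (\<Sum>H\<in>\<H>. u H g)\<^sup>2)"
    using fin by (intro member_le_sum) auto
  moreover have "(\<Sum>g\<in>carrier G. (\<Sum>H\<in>\<H>. u H g)\<^sup>2) = n * T"
  proof -
    have "(\<Sum>g\<in>carrier G. (\<Sum>H\<in>\<H>. u H g)\<^sup>2)
        = (\<Sum>g\<in>carrier G. \<Sum>H\<in>\<H>. \<Sum>K\<in>\<H>. u H g * u K g)"
      by (simp add: power2_eq_square sum_product)
    also have "\<dots> = (\<Sum>H\<in>\<H>. \<Sum>K\<in>\<H>. \<Sum>g\<in>carrier G. u H g * u K g)"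
      by (simp add: sum.swap[of _ \<H> "carrier G"])
    also have "\<dots> = (\<Sum>H\<in>\<H>. \<Sum>K\<in>\<H>. if H = K then n * (p H - 1) else 0)"
      by (intro sum.cong refl orth)
    also have "\<dots> = n * T"
      using fin\<H> by (simp add: T_def sum_distrib_left)
    finally show ?thesis .
  qed
  ultimately have "T * T \<le> n * T" by (simp add: power2_eq_square)
  moreover have "real (card \<H>) \<le> T"
    unfolding T_def using sum_bounded_below[of \<H> 1 "\<lambda>H. p H - 1"] p2 by force
  ultimately have "real (card \<H>) \<le> n"
    using n by (cases "T \<le> 0") (auto simp: mult_le_cancel_right)
  then show ?thesis unfolding n_def by simp
qed

text \<open>The maximal elements among the proper submodules.\<close>

definition maximal_submodules ::
    "('r, 'c) ring_scheme \<Rightarrow> ('r, 'm, 'd) module_scheme \<Rightarrow> 'm set set" where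
  "maximal_submodules R M =
    {H. submodule H R M \<and> H \<noteq> carrier M \<and>
        (\<forall>K. submodule K R M \<longrightarrow> H \<subseteq> K \<longrightarrow> K \<noteq> carrier M \<longrightarrow> K = H)}"

context left_module
begin

lemma additive_subgroup_submodule:
  assumes "submodule H R M"
  shows "additive_subgroup H M"
  using assms by (intro additive_subgroup.intro submodule.axioms)

lemma submodule_set_add:
  assumes "submodule H R M" "submodule K R M"
  shows "submodule (H <+>\<^bsub>M\<^esub> K) R M"
proof -
  interpret H: additive_subgroup H M using assms(1) by (rule additive_subgroup_submodule)
  interpret K: additive_subgroup K M using assms(2) by (rule additive_subgroup_submodule)
  have "additive_subgroup (H <+>\<^bsub>M\<^esub> K) M"
    using H.additive_subgroup_axioms K.additive_subgroup_axioms by (rule M.add_additive_subgroups)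
  moreover have "a \<odot>\<^bsub>M\<^esub> x \<in> H <+>\<^bsub>M\<^esub> K" if a: "a \<in> carrier R" and x: "x \<in> H <+>\<^bsub>M\<^esub> K" for a x
  proof -
    from x obtain h k where hk: "h \<in> H" "k \<in> K" "x = h \<oplus>\<^bsub>M\<^esub> k" unfolding set_add_def' by auto
    then have "a \<odot>\<^bsub>M\<^esub> x = a \<odot>\<^bsub>M\<^esub> h \<oplus>\<^bsub>M\<^esub> a \<odot>\<^bsub>M\<^esub> k" using a by (simp add: smult_r_distr)
    moreover have "a \<odot>\<^bsub>M\<^esub> h \<in> H" "a \<odot>\<^bsub>M\<^esub> k \<in> K"
      using submodule.smult_closed[OF assms(1) a hk(1)] submodule.smult_closed[OF assms(2) a hk(2)] .
    ultimately show ?thesis unfolding set_add_def' by auto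
  qed
  ultimately show ?thesis
    by (intro submodule.intro submodule_axioms.intro additive_subgroup.a_subgroup)
qed

text \<open>Two distinct maximal submodules have sum \<open>M\<close>, so the preceding count applies to them.\<close>

lemma card_maximal_submodules:
  assumes fin: "finite (carrier M)"
  shows "card (maximal_submodules R M) \<le> card (carrier M)"
proof (rule M.card_comaximal_subgroups[OF fin])
  fix H K assume HK: "H \<in> maximal_submodules R M" "K \<in> maximal_submodules R M" "H \<noteq> K"
  then have sm: "submodule H R M" "submodule K R M" by (auto simp: maximal_submodules_def)
  interpret H: additive_subgroup H M using sm(1) by (rule additive_subgroup_submodule)
  interpret K: additive_subgroup K M using sm(2) by (rule additive_subgroup_submodule)
  have "H \<subseteq> H <+>\<^bsub>M\<^esub> K"
  proof
    fix h assume "h \<in> H"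
    then have "h = h \<oplus>\<^bsub>M\<^esub> \<zero>\<^bsub>M\<^esub>" by simp
    then show "h \<in> H <+>\<^bsub>M\<^esub> K" using \<open>h \<in> H\<close> K.zero_closed unfolding set_add_def' by blast
  qed
  moreover have "K \<subseteq> H <+>\<^bsub>M\<^esub> K"
  proof
    fix k assume "k \<in> K"
    then have "k = \<zero>\<^bsub>M\<^esub> \<oplus>\<^bsub>M\<^esub> k" by simp
    then show "k \<in> H <+>\<^bsub>M\<^esub> K" using \<open>k \<in> K\<close> H.zero_closed unfolding set_add_def' by blast
  qed
  ultimately show "H <+>\<^bsub>M\<^esub> K = carrier M"
    using HK submodule_set_add[OF sm] unfolding maximal_submodules_def by blast
qed (auto simp: maximal_submodules_def intro: additive_subgroup_submodule)

lemma proper_submodule_le_maximal: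
  assumes fin: "finite (carrier M)" and N: "submodule N R M" "N \<noteq> carrier M"
  obtains H where "H \<in> maximal_submodules R M" "N \<subseteq> H"
proof -
  let ?A = "{K. submodule K R M \<and> N \<subseteq> K \<and> K \<noteq> carrier M}"
  have "?A \<subseteq> Pow (carrier M)"
    using additive_subgroup_submodule additive_subgroup.a_subset by blast
  then have "finite ?A" using fin by (auto intro: finite_subset)
  moreover have "N \<in> ?A" using N by auto
  ultimately have "\<exists>H\<in>?A. N \<subseteq> H \<and> (\<forall>K\<in>?A. H \<subseteq> K \<longrightarrow> H = K)"
    by (rule finite_has_maximal2)
  then obtain H where H: "H \<in> ?A" and max: "N \<subseteq> H \<and> (\<forall>K\<in>?A. H \<subseteq> K \<longrightarrow> H = K)"
    by (rule bexE)
  have "K = H" if "submodule K R M" "H \<subseteq> K" "K \<noteq> carrier M" for K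
  proof -
    have "K \<in> ?A" using that max by auto
    then have "H = K" using max that(2) by blast
    then show ?thesis ..
  qed
  then have "H \<in> maximal_submodules R M" unfolding maximal_submodules_def using H by simp
  then show thesis by (rule that[OF _ conjunct1[OF max]])
qed

lemma submodule_lincomb_image:
  assumes t: "t \<in> {..<d} \<rightarrow> carrier M"
  shows "submodule (lincomb M d t ` carrier (free_left_module R d)) R M"
proof -
  let ?F = "free_left_module R d"
  interpret F: left_module R ?F using R.ring_axioms by (rule left_module_free)
  have h: "lincomb M d t \<in> left_module_hom R ?F M"
    using left_module_axioms t by (rule lincomb_hom)
  interpret h: abelian_group_hom ?F M "lincomb M d t"
    using F.left_module_axioms left_module_axioms h by (rule left_module_hom_abelian_group_hom)
  have "subgroup (lincomb M d t ` carrier ?F) (add_monoid M)"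
    using group_hom.img_is_subgroup[OF h.a_group_hom] by simp
  moreover have "a \<odot>\<^bsub>M\<^esub> y \<in> lincomb M d t ` carrier ?F"
    if a: "a \<in> carrier R" and y: "y \<in> lincomb M d t ` carrier ?F" for a y
  proof -
    from y obtain x where x: "x \<in> carrier ?F" "y = lincomb M d t x" by blast
    then have "a \<odot>\<^bsub>M\<^esub> y = lincomb M d t (a \<odot>\<^bsub>?F\<^esub> x)"
      using h a by (simp add: left_module_hom_def)
    then show ?thesis using F.smult_closed[OF a x(1)] by blast
  qed
  ultimately show ?thesis by (intro submodule.intro submodule_axioms.intro)
qed

lemma card_generating_tuples_le:
  assumes fin: "finite (carrier M)"
  shows "card (generating_tuples R M d) \<le> card (carrier M) ^ d"
proof -
  have "card (generating_tuples R M d) \<le> card ({..<d} \<rightarrow>\<^sub>E carrier M)"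
    by (rule card_mono) (auto simp: generating_tuples_def intro!: finite_PiE fin)
  then show ?thesis by (simp add: card_PiE)
qed

text \<open>
  A tuple that does not generate lies in a maximal submodule, and this has index at least \<open>2\<close>.
\<close>

lemma card_generating_tuples_ge:
  assumes fin: "finite (carrier M)"
  defines "n \<equiv> real (card (carrier M))"
  shows "n ^ d - real (card (generating_tuples R M d)) \<le> n * (n / 2) ^ d"
proof -
  let ?A = "{..<d} \<rightarrow>\<^sub>E carrier M" and ?T = "generating_tuples R M d"
  let ?Max = "maximal_submodules R M"
  have sub: "?T \<subseteq> ?A" by (auto simp: generating_tuples_def)
  have finA: "finite ?A" using fin by (auto intro!: finite_PiE)
  have finMax: "finite ?Max"
    by (rule finite_subset[of _ "Pow (carrier M)"])
      (use fin additive_subgroup_submodule additive_subgroup.a_subset in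
        \<open>auto simp: maximal_submodules_def\<close>)
  have Max: "additive_subgroup H M" "H \<subseteq> carrier M" "H \<noteq> carrier M" if "H \<in> ?Max" for H
    using that additive_subgroup_submodule additive_subgroup.a_subset
    by (auto simp: maximal_submodules_def)
  have half: "2 * card H \<le> card (carrier M)" if H: "H \<in> ?Max" for H
  proof -
    obtain k where k: "card (carrier M) = card H * k"
      using M.card_additive_subgroup_dvd[OF Max(1)[OF H]] by (auto elim: dvdE)
    have "card H < card (carrier M)"
      using Max(2,3)[OF H] fin by (intro psubset_card_mono) auto
    then have "card H * 1 < card H * k" unfolding k by simp
    then have "2 \<le> k" unfolding mult_less_cancel1 by simp
    then have "card H * 2 \<le> card H * k" by (rule mult_le_mono2)
    then show ?thesis unfolding k by simp
  qed
  have "?A - ?T \<subseteq> (\<Union>H\<in>?Max. {..<d} \<rightarrow>\<^sub>E H)"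
  proof
    fix t assume t: "t \<in> ?A - ?T"
    then have tM: "t \<in> {..<d} \<rightarrow> carrier M" by auto
    let ?N = "lincomb M d t ` carrier (free_left_module R d)"
    have "?N \<noteq> carrier M" using t by (auto simp: generating_tuples_def)
    then obtain H where H: "H \<in> ?Max" "?N \<subseteq> H"
      using proper_submodule_le_maximal[OF fin submodule_lincomb_image[OF tM]] by blast
    have "t i \<in> H" if "i < d" for i
      using H(2) lincomb_unit_tuple[OF left_module_axioms tM that]
        unit_tuple_closed[OF R.ring_axioms, of d i] by (metis imageI subsetD)
    then have "t \<in> {..<d} \<rightarrow>\<^sub>E H" using t by (auto simp: PiE_def)
    then show "t \<in> (\<Union>H\<in>?Max. {..<d} \<rightarrow>\<^sub>E H)" using H(1) by blast
  qed
  then have "card (?A - ?T) \<le> card (\<Union>H\<in>?Max. {..<d} \<rightarrow>\<^sub>E H)"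
    using finMax finite_subset[OF Max(2) fin] by (intro card_mono finite_UN_I finite_PiE) auto
  also have "\<dots> \<le> (\<Sum>H\<in>?Max. card ({..<d} \<rightarrow>\<^sub>E H))"
    using finMax by (rule card_UN_le)
  also have "\<dots> = (\<Sum>H\<in>?Max. card H ^ d)" by (simp add: card_PiE)
  finally have "real (card (?A - ?T)) \<le> (\<Sum>H\<in>?Max. real (card H) ^ d)"
    by (metis (mono_tags, lifting) of_nat_le_iff of_nat_power of_nat_sum sum.cong)
  also have "\<dots> \<le> (\<Sum>H\<in>?Max. (n / 2) ^ d)"
  proof (intro sum_mono power_mono)
    fix H assume "H \<in> ?Max"
    from half[OF this] have "real (2 * card H) \<le> n" unfolding n_def by (rule of_nat_mono)
    then show "real (card H) \<le> n / 2" by simp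
  qed simp
  also have "\<dots> = real (card ?Max) * (n / 2) ^ d" by simp
  also have "\<dots> \<le> n * (n / 2) ^ d"
    using card_maximal_submodules[OF fin] by (intro mult_right_mono) (auto simp: n_def)
  finally have "real (card (?A - ?T)) \<le> n * (n / 2) ^ d" .
  moreover have "real (card (?A - ?T)) = n ^ d - real (card ?T)"
    using card_mono[OF finA sub] card_Diff_subset[OF finite_subset[OF sub finA] sub]
    by (simp add: of_nat_diff card_PiE n_def)
  ultimately show ?thesis by simp
qed

end

section \<open>Finitely generated commutative rings are Noetherian\<close>

text \<open>
  Hilbert's basis theorem is proved for subrings \<open>B\<close> of a fixed commutative ring, with
  polynomials over \<open>B\<close> evaluated at an element \<open>g\<close> of that ring in place of formal
  polynomials.

  The set of linear combinations of elements of \<open>F\<close> with coefficients in \<open>B\<close>: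
\<close>

inductive_set lin_span :: "('a, 'b) ring_scheme \<Rightarrow> 'a set \<Rightarrow> 'a set \<Rightarrow> 'a set"
  for A (structure) and B F where
  zero: "\<zero> \<in> lin_span A B F"
| add: "\<lbrakk>b \<in> B; f \<in> F; x \<in> lin_span A B F\<rbrakk> \<Longrightarrow> b \<otimes> f \<oplus> x \<in> lin_span A B F"

text \<open>\<open>J\<close> is an ideal of the subring \<open>B\<close>. Negatives exist because \<open>-1 \<in> B\<close>.\<close>

definition ideal_in :: "('a, 'b) ring_scheme \<Rightarrow> 'a set \<Rightarrow> 'a set \<Rightarrow> bool" where
  "ideal_in A B J \<longleftrightarrow> J \<subseteq> B \<and> \<zero>\<^bsub>A\<^esub> \<in> J \<and> (\<forall>x\<in>J. \<forall>y\<in>J. x \<oplus>\<^bsub>A\<^esub> y \<in> J) \<and>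
     (\<forall>b\<in>B. \<forall>x\<in>J. b \<otimes>\<^bsub>A\<^esub> x \<in> J)"

text \<open>A subring all of whose ideals are finitely generated.\<close>

definition noetherian_subring :: "('a, 'b) ring_scheme \<Rightarrow> 'a set \<Rightarrow> bool" where
  "noetherian_subring A B \<longleftrightarrow> subring B A \<and>
     (\<forall>J. ideal_in A B J \<longrightarrow> (\<exists>F. finite F \<and> F \<subseteq> J \<and> J \<subseteq> lin_span A B F))"

text \<open>The values at \<open>g\<close> of the polynomials of degree less than \<open>d\<close> with coefficients in \<open>B\<close>.\<close>

primrec poly_below :: "('a, 'b) ring_scheme \<Rightarrow> 'a set \<Rightarrow> 'a \<Rightarrow> nat \<Rightarrow> 'a set" where
  "poly_below A B g 0 = {\<zero>\<^bsub>A\<^esub>}"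
| "poly_below A B g (Suc d) =
    {x \<oplus>\<^bsub>A\<^esub> b \<otimes>\<^bsub>A\<^esub> g [^]\<^bsub>A\<^esub> d |x b. x \<in> poly_below A B g d \<and> b \<in> B}"

lemma ideal_inD:
  assumes "ideal_in A B J"
  shows "J \<subseteq> B" "\<zero>\<^bsub>A\<^esub> \<in> J" "\<And>x y. x \<in> J \<Longrightarrow> y \<in> J \<Longrightarrow> x \<oplus>\<^bsub>A\<^esub> y \<in> J"
    "\<And>b x. b \<in> B \<Longrightarrow> x \<in> J \<Longrightarrow> b \<otimes>\<^bsub>A\<^esub> x \<in> J"
  using assms by (auto simp: ideal_in_def)

context cring
begin

lemma lin_span_least:
  assumes "ideal_in R B J" "F \<subseteq> J"
  shows "lin_span R B F \<subseteq> J"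
proof
  fix x assume "x \<in> lin_span R B F"
  then show "x \<in> J"
  proof induction
    case (add b f x)
    then have "b \<otimes> f \<in> J" using ideal_inD(4)[OF assms(1)] assms(2) by auto
    then show ?case using ideal_inD(3)[OF assms(1)] add by auto
  qed (rule ideal_inD(2)[OF assms(1)])
qed

context
  fixes B assumes B: "subring B R"
begin

lemma subring_mem:
  "B \<subseteq> carrier R" "\<zero> \<in> B" "\<one> \<in> B" "\<And>x y. x \<in> B \<Longrightarrow> y \<in> B \<Longrightarrow> x \<oplus> y \<in> B"
  "\<And>x y. x \<in> B \<Longrightarrow> y \<in> B \<Longrightarrow> x \<otimes> y \<in> B" "\<And>x. x \<in> B \<Longrightarrow> \<ominus> x \<in> B"
  using subringE[OF B] by auto

lemma ideal_in_minus:
  assumes "ideal_in R B J" "x \<in> J" "y \<in> J"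
  shows "x \<ominus> y \<in> J"
proof -
  have c: "x \<in> carrier R" "y \<in> carrier R"
    using assms ideal_inD(1)[OF assms(1)] subring_mem(1) by auto
  have "x \<oplus> \<ominus> \<one> \<otimes> y \<in> J"
    using assms subring_mem by (intro ideal_inD(3,4)[OF assms(1)])
  then show ?thesis using c by (simp add: a_minus_def l_minus)
qed

lemma lin_span_ideal_in:
  assumes F: "F \<subseteq> B"
  shows "ideal_in R B (lin_span R B F)"
proof -
  have sub: "lin_span R B F \<subseteq> B"
  proof
    fix x assume "x \<in> lin_span R B F"
    then show "x \<in> B" by induction (use F subring_mem in auto)
  qed
  have add: "x \<oplus> y \<in> lin_span R B F" if "x \<in> lin_span R B F" "y \<in> lin_span R B F" for x y
    using that(1)
  proof induction
    case zero
    then show ?case using that(2) sub subring_mem(1) by (metis l_zero subsetD)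
  next
    case (add b f x)
    have "b \<otimes> f \<in> carrier R" "x \<in> carrier R" "y \<in> carrier R"
      using add F sub subring_mem(1) that(2) by auto
    then have "b \<otimes> f \<oplus> x \<oplus> y = b \<otimes> f \<oplus> (x \<oplus> y)" by (rule a_assoc)
    then show ?case using add by (auto intro: lin_span.add)
  qed
  have mult: "c \<otimes> x \<in> lin_span R B F" if "c \<in> B" "x \<in> lin_span R B F" for c x
    using that(2)
  proof induction
    case zero
    have "c \<in> carrier R" using that(1) subring_mem(1) by auto
    then show ?case by (simp add: lin_span.zero)
  next
    case (add b f x)
    have c: "c \<in> carrier R" "b \<in> carrier R" "f \<in> carrier R" "x \<in> carrier R"
      using add F sub subring_mem(1) that(1) by auto
    have "c \<otimes> (b \<otimes> f \<oplus> x) = (c \<otimes> b) \<otimes> f \<oplus> c \<otimes> x" using c by algebra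
    then show ?case using add that(1) subring_mem(5) by (auto intro: lin_span.add)
  qed
  show ?thesis unfolding ideal_in_def using sub add mult lin_span.zero by blast
qed

lemma lin_span_incl:
  assumes "F \<subseteq> B" "f \<in> F"
  shows "f \<in> lin_span R B F"
proof -
  have "f \<in> carrier R" using assms subring_mem(1) by auto
  then show ?thesis
    using lin_span.add[OF subring_mem(3) assms(2) lin_span.zero, of R] by simp
qed

context
  fixes g assumes g: "g \<in> carrier R"
begin

lemma poly_below_carrier: "poly_below R B g d \<subseteq> carrier R"
  using subring_mem(1) g by (induction d) auto

lemma poly_below_zero: "\<zero> \<in> poly_below R B g d"
proof (induction d)
  case (Suc d)
  have "\<zero> = \<zero> \<oplus> \<zero> \<otimes> g [^] d" using g by simp
  then show ?case using Suc subring_mem(2) by auto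
qed simp

lemma poly_below_add:
  "x \<in> poly_below R B g d \<Longrightarrow> y \<in> poly_below R B g d \<Longrightarrow> x \<oplus> y \<in> poly_below R B g d"
proof (induction d arbitrary: x y)
  case (Suc d)
  then obtain u b v c where uv: "x = u \<oplus> b \<otimes> g [^] d" "u \<in> poly_below R B g d" "b \<in> B"
    "y = v \<oplus> c \<otimes> g [^] d" "v \<in> poly_below R B g d" "c \<in> B" by auto
  have "u \<in> carrier R" "v \<in> carrier R" "b \<in> carrier R" "c \<in> carrier R" "g [^] d \<in> carrier R"
    using uv poly_below_carrier subring_mem(1) g by auto
  then have "x \<oplus> y = (u \<oplus> v) \<oplus> (b \<oplus> c) \<otimes> g [^] d" unfolding uv by algebra
  moreover have "u \<oplus> v \<in> poly_below R B g d" "b \<oplus> c \<in> B"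
    using uv Suc.IH subring_mem(4) by auto
  ultimately show ?case by auto
qed simp

lemma poly_below_smult:
  "c \<in> B \<Longrightarrow> x \<in> poly_below R B g d \<Longrightarrow> c \<otimes> x \<in> poly_below R B g d"
proof (induction d arbitrary: x)
  case 0
  have "c \<in> carrier R" using 0 subring_mem(1) by auto
  then show ?case using 0 by simp
next
  case (Suc d)
  then obtain u b where uv: "x = u \<oplus> b \<otimes> g [^] d" "u \<in> poly_below R B g d" "b \<in> B"
    by auto
  have "u \<in> carrier R" "b \<in> carrier R" "c \<in> carrier R" "g [^] d \<in> carrier R"
    using uv Suc poly_below_carrier subring_mem(1) g by auto
  then have "c \<otimes> x = c \<otimes> u \<oplus> (c \<otimes> b) \<otimes> g [^] d" unfolding uv by algebra
  moreover have "c \<otimes> u \<in> poly_below R B g d" "c \<otimes> b \<in> B"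
    using uv Suc subring_mem(5) by auto
  ultimately show ?case by auto
qed

lemma poly_below_minus:
  assumes "x \<in> poly_below R B g d" "y \<in> poly_below R B g d"
  shows "x \<ominus> y \<in> poly_below R B g d"
proof -
  have c: "x \<in> carrier R" "y \<in> carrier R" using assms poly_below_carrier by auto
  have "x \<oplus> \<ominus> \<one> \<otimes> y \<in> poly_below R B g d"
    using assms subring_mem by (intro poly_below_add poly_below_smult)
  then show ?thesis using c by (simp add: a_minus_def l_minus)
qed

lemma poly_below_Suc: "poly_below R B g d \<subseteq> poly_below R B g (Suc d)"
proof
  fix x assume x: "x \<in> poly_below R B g d"
  have "x \<in> carrier R" using x poly_below_carrier by auto
  then have "x = x \<oplus> \<zero> \<otimes> g [^] d" using g by simp
  then show "x \<in> poly_below R B g (Suc d)" using x subring_mem(2) by auto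
qed

lemma poly_below_mono: "d \<le> e \<Longrightarrow> poly_below R B g d \<subseteq> poly_below R B g e"
  by (rule lift_Suc_mono_le[of "poly_below R B g"]) (rule poly_below_Suc)

lemma poly_below_mult_g:
  "x \<in> poly_below R B g d \<Longrightarrow> g \<otimes> x \<in> poly_below R B g (Suc d)"
proof (induction d arbitrary: x)
  case 0
  then show ?case using g poly_below_zero[of "Suc 0"] by (simp del: poly_below.simps(2))
next
  case (Suc d)
  then obtain u b where uv: "x = u \<oplus> b \<otimes> g [^] d" "u \<in> poly_below R B g d" "b \<in> B"
    by auto
  have "u \<in> carrier R" "b \<in> carrier R" "g [^] d \<in> carrier R"
    using uv poly_below_carrier subring_mem(1) g by auto
  then have "g \<otimes> x = g \<otimes> u \<oplus> b \<otimes> g [^] Suc d" unfolding uv nat_pow_Suc using g by algebra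
  moreover have "g \<otimes> u \<in> poly_below R B g (Suc d)" by (rule Suc.IH) fact
  ultimately show ?case using uv(3) by (subst poly_below.simps) blast
qed

lemma poly_below_mult_pow:
  "x \<in> poly_below R B g d \<Longrightarrow> g [^] k \<otimes> x \<in> poly_below R B g (d + k)"
proof (induction k)
  case 0
  then have "x \<in> carrier R" using poly_below_carrier by auto
  then show ?case using 0 by simp
next
  case (Suc k)
  have "x \<in> carrier R" "g [^] k \<in> carrier R" using Suc poly_below_carrier g by auto
  then have "g [^] Suc k \<otimes> x = g \<otimes> (g [^] k \<otimes> x)" unfolding nat_pow_Suc using g by algebra
  then show ?case using poly_below_mult_g[OF Suc.IH[OF Suc.prems]] by simp
qed

lemma poly_below_mult:
  "x \<in> poly_below R B g d \<Longrightarrow> y \<in> poly_below R B g e \<Longrightarrow> x \<otimes> y \<in> poly_below R B g (d + e)"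
proof (induction d arbitrary: x)
  case 0
  have "y \<in> carrier R" using 0 poly_below_carrier by auto
  then show ?case using 0 poly_below_zero by simp
next
  case (Suc d)
  then obtain u b where uv: "x = u \<oplus> b \<otimes> g [^] d" "u \<in> poly_below R B g d" "b \<in> B"
    by auto
  have "u \<in> carrier R" "b \<in> carrier R" "g [^] d \<in> carrier R" "y \<in> carrier R"
    using uv Suc poly_below_carrier subring_mem(1) g by auto
  then have *: "x \<otimes> y = u \<otimes> y \<oplus> b \<otimes> (g [^] d \<otimes> y)" unfolding uv by algebra
  have "u \<otimes> y \<in> poly_below R B g (d + e)" using Suc uv by simp
  moreover have "b \<otimes> (g [^] d \<otimes> y) \<in> poly_below R B g (d + e)"
    using poly_below_smult[OF uv(3) poly_below_mult_pow[OF Suc.prems(2), of d]]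
    by (simp add: add.commute)
  ultimately have "x \<otimes> y \<in> poly_below R B g (d + e)"
    unfolding * by (rule poly_below_add)
  then show ?case using poly_below_mono[of "d + e" "Suc d + e"] by auto
qed

text \<open>
  Hilbert's basis theorem. The ideal \<open>L d\<close> consists of the coefficients of \<open>g\<^sup>d\<close> in those
  elements of \<open>J\<close> that can be written as polynomials of degree at most \<open>d\<close> in \<open>g\<close>; such an
  expression need not be unique. These ideals increase with \<open>d\<close> and become stationary at some
  \<open>N\<close>. Elements of \<open>J\<close> whose leading coefficients generate \<open>L 0, \<dots>, L N\<close> generate \<open>J\<close>, since
  they allow the reduction of the degree of any element of \<open>J\<close>.
\<close>

lemma hilbert_basis:
  assumes noeth: "noetherian_subring R B"
    and C: "subring C R" "B \<subseteq> C" "g \<in> C" "C \<subseteq> (\<Union>d. poly_below R B g d)"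
  shows "noetherian_subring R C"
  unfolding noetherian_subring_def
proof (intro conjI allI impI C(1))
  fix J assume J: "ideal_in R C J"
  note CR = subringE(1)[OF C(1)]
  have gpow: "g [^] k \<in> C" for k :: nat
    using C(1,3) subringE(3,6)[OF C(1)] by (induction k) auto
  define L where "L d = {b \<in> B. \<exists>x\<in>poly_below R B g d. x \<oplus> b \<otimes> g [^] d \<in> J}" for d :: nat
  have L: "ideal_in R B (L d)" for d
    unfolding ideal_in_def
  proof (intro conjI ballI)
    show "L d \<subseteq> B" by (auto simp: L_def)
    show "\<zero> \<in> L d"
      unfolding L_def using subring_mem(2) poly_below_zero ideal_inD(2)[OF J] g
      by (auto intro!: bexI[of _ \<zero>])
  next
    fix b c assume "b \<in> L d" "c \<in> L d"
    then obtain x y where xy: "x \<in> poly_below R B g d" "x \<oplus> b \<otimes> g [^] d \<in> J"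
      "y \<in> poly_below R B g d" "y \<oplus> c \<otimes> g [^] d \<in> J" "b \<in> B" "c \<in> B" by (auto simp: L_def)
    have "x \<in> carrier R" "y \<in> carrier R" "b \<in> carrier R" "c \<in> carrier R" "g [^] d \<in> carrier R"
      using xy poly_below_carrier subring_mem(1) g by auto
    then have "(x \<oplus> b \<otimes> g [^] d) \<oplus> (y \<oplus> c \<otimes> g [^] d) = (x \<oplus> y) \<oplus> (b \<oplus> c) \<otimes> g [^] d"
      by algebra
    then have "(x \<oplus> y) \<oplus> (b \<oplus> c) \<otimes> g [^] d \<in> J" using ideal_inD(3)[OF J xy(2,4)] by simp
    then show "b \<oplus> c \<in> L d"
      unfolding L_def using poly_below_add[OF xy(1,3)] subring_mem(4)[OF xy(5,6)] by blast
  next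
    fix c b assume c: "c \<in> B" and "b \<in> L d"
    then obtain x where x: "x \<in> poly_below R B g d" "x \<oplus> b \<otimes> g [^] d \<in> J" "b \<in> B"
      by (auto simp: L_def)
    have "x \<in> carrier R" "b \<in> carrier R" "c \<in> carrier R" "g [^] d \<in> carrier R"
      using x c poly_below_carrier subring_mem(1) g by auto
    then have "c \<otimes> (x \<oplus> b \<otimes> g [^] d) = c \<otimes> x \<oplus> (c \<otimes> b) \<otimes> g [^] d" by algebra
    then have "c \<otimes> x \<oplus> (c \<otimes> b) \<otimes> g [^] d \<in> J"
      using ideal_inD(4)[OF J _ x(2), of c] C(2) c by auto
    then show "c \<otimes> b \<in> L d"
      unfolding L_def using poly_below_smult[OF c x(1)] subring_mem(5)[OF c x(3)] by blast
  qed
  have "L d \<subseteq> L (Suc d)" for d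
  proof
    fix b assume "b \<in> L d"
    then obtain x where x: "x \<in> poly_below R B g d" "x \<oplus> b \<otimes> g [^] d \<in> J" "b \<in> B"
      by (auto simp: L_def)
    have "x \<in> carrier R" "b \<in> carrier R" "g [^] d \<in> carrier R"
      using x poly_below_carrier subring_mem(1) g by auto
    then have "g \<otimes> (x \<oplus> b \<otimes> g [^] d) = g \<otimes> x \<oplus> b \<otimes> g [^] Suc d"
      unfolding nat_pow_Suc using g by algebra
    then have "g \<otimes> x \<oplus> b \<otimes> g [^] Suc d \<in> J"
      using ideal_inD(4)[OF J C(3) x(2)] by simp
    then show "b \<in> L (Suc d)"
      unfolding L_def using poly_below_mult_g[OF x(1)] x(3) by blast
  qed
  then have Lmono: "L d \<subseteq> L e" if "d \<le> e" for d e using that by (rule lift_Suc_mono_le)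
  have fg: "\<exists>F. finite F \<and> F \<subseteq> K \<and> K \<subseteq> lin_span R B F" if "ideal_in R B K" for K
    using noeth that by (auto simp: noetherian_subring_def)
  obtain N where N: "L d \<subseteq> L N" for d
  proof -
    have "ideal_in R B (\<Union>d. L d)"
      unfolding ideal_in_def
    proof (intro conjI ballI)
      fix x y assume "x \<in> (\<Union>d. L d)" "y \<in> (\<Union>d. L d)"
      then obtain d e where "x \<in> L d" "y \<in> L e" by auto
      then have "x \<in> L (max d e)" "y \<in> L (max d e)"
        using Lmono[of d "max d e"] Lmono[of e "max d e"] by auto
      then have "x \<oplus> y \<in> L (max d e)" by (rule ideal_inD(3)[OF L])
      then show "x \<oplus> y \<in> (\<Union>d. L d)" by blast
    next
      show "(\<Union>d. L d) \<subseteq> B" using ideal_inD(1)[OF L] by (rule UN_least)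
      show "\<zero> \<in> (\<Union>d. L d)" using ideal_inD(2)[OF L, of 0] by blast
    next
      fix b x assume "b \<in> B" "x \<in> (\<Union>d. L d)"
      then obtain d where "b \<in> B" "x \<in> L d" by auto
      then have "b \<otimes> x \<in> L d" by (rule ideal_inD(4)[OF L])
      then show "b \<otimes> x \<in> (\<Union>d. L d)" by blast
    qed
    from fg[OF this]
    obtain F where F: "finite F" "F \<subseteq> (\<Union>d. L d)" "(\<Union>d. L d) \<subseteq> lin_span R B F"
      by (elim exE conjE)
    from F(1,2) have "\<exists>N. F \<subseteq> L N"
    proof (induction F rule: finite_induct)
      case (insert b F)
      then have "\<exists>N. F \<subseteq> L N" "\<exists>d. b \<in> L d" by simp_all
      then obtain N d where "F \<subseteq> L N" "b \<in> L d" by (elim exE)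
      then have "insert b F \<subseteq> L (max N d)"
        using Lmono[of N "max N d"] Lmono[of d "max N d"] by auto
      then show ?case ..
    qed simp
    then obtain N where "F \<subseteq> L N" ..
    then have "(\<Union>d. L d) \<subseteq> L N" using F(3) lin_span_least[OF L] by blast
    then show thesis using that by blast
  qed
  have "\<exists>F. finite F \<and> F \<subseteq> L d \<and> L d \<subseteq> lin_span R B F" for d by (rule fg) (rule L)
  then obtain F where F: "finite (F d)" "F d \<subseteq> L d" "L d \<subseteq> lin_span R B (F d)" for d
    by metis
  have ex_w: "\<exists>w. w \<in> J \<and> (\<exists>x\<in>poly_below R B g d. w = x \<oplus> f \<otimes> g [^] d)" if "f \<in> F d" for d f
  proof -
    have "f \<in> L d" using F(2) that by blast
    then obtain x where "x \<in> poly_below R B g d" "x \<oplus> f \<otimes> g [^] d \<in> J" by (auto simp: L_def)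
    then show ?thesis by blast
  qed
  define w where
    "w d f = (SOME w. w \<in> J \<and> (\<exists>x\<in>poly_below R B g d. w = x \<oplus> f \<otimes> g [^] d))" for d f
  have w: "w d f \<in> J" "\<exists>x\<in>poly_below R B g d. w d f = x \<oplus> f \<otimes> g [^] d" if "f \<in> F d" for d f
    using someI_ex[OF ex_w[OF that]] unfolding w_def by (rule conjunct1, rule conjunct2)
  define Y where "Y = (\<Union>d\<le>N. w d ` F d)"
  have YJ: "finite Y" "Y \<subseteq> J" unfolding Y_def using F(1) w(1) by auto
  have YC: "Y \<subseteq> C" using YJ(2) ideal_inD(1)[OF J] by auto
  note span = cring.lin_span_ideal_in[OF cring_axioms C(1) YC]
  have lift: "\<exists>x\<in>poly_below R B g d. x \<oplus> b \<otimes> g [^] d \<in> lin_span R C Y"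
    if "b \<in> lin_span R B (F d)" "d \<le> N" for b d
    using that(1)
  proof induction
    case zero
    then show ?case
      using poly_below_zero g lin_span.zero by (auto intro!: bexI[of _ \<zero>])
  next
    case (add c f b)
    obtain x where x: "x \<in> poly_below R B g d" "x \<oplus> b \<otimes> g [^] d \<in> lin_span R C Y"
      using add by blast
    obtain y where y: "y \<in> poly_below R B g d" "w d f = y \<oplus> f \<otimes> g [^] d"
      using w(2) add by blast
    have "w d f \<in> Y" unfolding Y_def using that(2) add by auto
    then have "w d f \<in> lin_span R C Y"
      by (rule cring.lin_span_incl[OF cring_axioms C(1) YC])
    then have *: "c \<otimes> w d f \<oplus> (x \<oplus> b \<otimes> g [^] d) \<in> lin_span R C Y"
      using ideal_inD(3,4)[OF span] x(2) add C(2) by auto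
    have FB: "F d \<subseteq> B" using F(2)[of d] by (auto simp: L_def)
    have bB: "b \<in> B"
      using add(3) lin_span_ideal_in[OF FB] ideal_inD(1) by blast
    have "x \<in> carrier R" "y \<in> carrier R" "b \<in> carrier R" "c \<in> carrier R" "f \<in> carrier R"
      "g [^] d \<in> carrier R"
      using x y bB FB add poly_below_carrier subring_mem(1) g by auto
    then have "c \<otimes> w d f \<oplus> (x \<oplus> b \<otimes> g [^] d) = (c \<otimes> y \<oplus> x) \<oplus> (c \<otimes> f \<oplus> b) \<otimes> g [^] d"
      unfolding y(2) by algebra
    moreover have "c \<otimes> y \<oplus> x \<in> poly_below R B g d"
      using poly_below_add[OF poly_below_smult[OF add(1) y(1)] x(1)] .
    ultimately show ?case using * by (metis (no_types, lifting))
  qed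
  have main: "z \<in> poly_below R B g e \<Longrightarrow> z \<in> J \<Longrightarrow> z \<in> lin_span R C Y" for z e
  proof (induction e arbitrary: z)
    case 0
    then show ?case by (auto intro: lin_span.zero)
  next
    case (Suc e)
    obtain x b where xb: "z = x \<oplus> b \<otimes> g [^] e" "x \<in> poly_below R B g e" "b \<in> B"
      using Suc.prems(1) by auto
    then have "b \<in> L e" using Suc.prems(2) by (auto simp: L_def)
    \<comment> \<open>the leading coefficient \<open>b\<close> already occurs in degree \<open>d \<le> N\<close>; multiply by \<open>g\<^sup>e\<^sup>-\<^sup>d\<close>\<close>
    define d where "d = min e N"
    define k where "k = e - d"
    have dk: "d \<le> N" "e = d + k" by (auto simp: d_def k_def)
    have "b \<in> L d" using \<open>b \<in> L e\<close> N[of e] by (auto simp: d_def min_def)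
    then have "b \<in> lin_span R B (F d)" using F(3) by blast
    then obtain y where y: "y \<in> poly_below R B g d" "y \<oplus> b \<otimes> g [^] d \<in> lin_span R C Y"
      using lift[OF _ dk(1)] by blast
    define v where "v = g [^] k \<otimes> (y \<oplus> b \<otimes> g [^] d)"
    have v: "v \<in> lin_span R C Y" unfolding v_def by (rule ideal_inD(4)[OF span gpow y(2)])
    have vJ: "v \<in> J" using v lin_span_least[OF J YJ(2)] by auto
    have c: "x \<in> carrier R" "y \<in> carrier R" "b \<in> carrier R" "g [^] d \<in> carrier R"
      "g [^] k \<in> carrier R" "g [^] e \<in> carrier R"
      using xb y poly_below_carrier subring_mem(1) g by auto
    have ve: "v = g [^] k \<otimes> y \<oplus> b \<otimes> g [^] e"
      unfolding v_def dk(2) nat_pow_mult[OF g, symmetric] using c by algebra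
    have zv: "z \<ominus> v = x \<ominus> g [^] k \<otimes> y"
      unfolding ve xb(1) using c g by algebra
    have "g [^] k \<otimes> y \<in> poly_below R B g e"
      using poly_below_mult_pow[OF y(1), of k] dk(2) by simp
    then have "z \<ominus> v \<in> poly_below R B g e"
      unfolding zv by (rule poly_below_minus[OF xb(2)])
    moreover have "z \<ominus> v \<in> J"
      using cring.ideal_in_minus[OF cring_axioms C(1) J Suc.prems(2) vJ] .
    ultimately have "z \<ominus> v \<in> lin_span R C Y" by (rule Suc.IH)
    then have "v \<oplus> (z \<ominus> v) \<in> lin_span R C Y" by (rule ideal_inD(3)[OF span v])
    moreover have "v \<oplus> (z \<ominus> v) = z" unfolding zv unfolding ve xb(1) using c g by algebra
    ultimately show ?case by simp
  qed
  have "J \<subseteq> lin_span R C Y"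
    using main ideal_inD(1)[OF J] C(4) by blast
  then show "\<exists>F. finite F \<and> F \<subseteq> J \<and> J \<subseteq> lin_span R C F" using YJ by blast
qed

end

end

text \<open>The subring generated by \<open>1\<close> is an image of the integers, hence a principal ideal ring.\<close>

lemma noetherian_prime_subring: "noetherian_subring R (generate_ring R {})"
  unfolding noetherian_subring_def
proof (intro conjI allI impI)
  let ?B = "generate_ring R {}"
  show B: "subring ?B R" by (rule generate_ring_is_subring) simp
  fix J assume J: "ideal_in R ?B J"
  have BZ: "\<exists>n::int. x = add_pow R n \<one>" if "x \<in> ?B" for x
    using that
  proof induction
    case one
    have "\<one> = add_pow R (1::int) \<one>" by simp
    then show ?case by blast
  next
    case (a_inv h)
    then obtain n :: int where "h = add_pow R n \<one>" by blast
    then have "\<ominus> h = add_pow R (-n) \<one>" using add.int_pow_neg[of \<one> n] by (simp add: a_inv_def)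
    then show ?case by blast
  next
    case (eng_add h1 h2)
    then obtain n m :: int where "h1 = add_pow R n \<one>" "h2 = add_pow R m \<one>" by blast
    then have "h1 \<oplus> h2 = add_pow R (n + m) \<one>" using add.int_pow_mult[of \<one> n m] by simp
    then show ?case by blast
  next
    case (eng_mult h1 h2)
    then obtain n m :: int where "h1 = add_pow R n \<one>" "h2 = add_pow R m \<one>" by blast
    then have "h1 \<otimes> h2 = add_pow R (n * m) \<one>"
      using add_pow_ldistr_int[of \<one> "add_pow R m \<one>" n] add.int_pow_pow[of \<one> n m]
      by (simp add: mult.commute)
    then show ?case by blast
  qed simp
  have ZB: "add_pow R n \<one> \<in> ?B" for n :: int
  proof -
    have nat: "add_pow R k \<one> \<in> ?B" for k :: nat
      using subringE(2,3,7)[OF B] by (induction k) auto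
    show ?thesis
      using nat subringE(5)[OF B] by (cases "n \<ge> 0") (auto simp: add_pow_int_ge add_pow_int_lt)
  qed
  have JR: "J \<subseteq> carrier R" using ideal_inD(1)[OF J] subringE(1)[OF B] by auto
  show "\<exists>F. finite F \<and> F \<subseteq> J \<and> J \<subseteq> lin_span R ?B F"
  proof (cases "\<exists>m::nat. m > 0 \<and> add_pow R (int m) \<one> \<in> J")
    case True
    define m where "m = (LEAST m::nat. m > 0 \<and> add_pow R (int m) \<one> \<in> J)"
    have m: "m > 0" "add_pow R (int m) \<one> \<in> J"
      using LeastI_ex[OF True] by (auto simp: m_def)
    have min: "\<not> (k > 0 \<and> add_pow R (int k) \<one> \<in> J)" if "k < m" for k
      using not_less_Least that unfolding m_def by blast
    have "J \<subseteq> lin_span R ?B {add_pow R (int m) \<one>}"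
    proof
      fix x assume x: "x \<in> J"
      then obtain n :: int where n: "x = add_pow R n \<one>" using BZ ideal_inD(1)[OF J] by blast
      define q r where "q = n div int m" and "r = nat (n mod int m)"
      have r: "int r = n mod int m" "r < m" using m(1) by (auto simp: r_def nat_less_iff)
      have nqr: "n = q * int m + int r" unfolding r q_def by simp
      have qm: "add_pow R (q * int m) \<one> = add_pow R q \<one> \<otimes> add_pow R (int m) \<one>"
        using add_pow_ldistr_int[of \<one> "add_pow R (int m) \<one>" q] add.int_pow_pow[of \<one> q "int m"]
        by (simp add: mult.commute)
      have xe: "x = add_pow R q \<one> \<otimes> add_pow R (int m) \<one> \<oplus> add_pow R (int r) \<one>"
        unfolding n nqr qm[symmetric] by (simp add: add.int_pow_mult)
      have *: "add_pow R q \<one> \<otimes> add_pow R (int m) \<one> \<in> J" by (rule ideal_inD(4)[OF J ZB m(2)])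
      have "x \<ominus> add_pow R q \<one> \<otimes> add_pow R (int m) \<one> \<in> J"
        by (rule ideal_in_minus[OF B J x *])
      moreover have "x \<ominus> add_pow R q \<one> \<otimes> add_pow R (int m) \<one> = add_pow R (int r) \<one>"
      proof -
        have "add_pow R q \<one> \<in> carrier R" "add_pow R (int m) \<one> \<in> carrier R" "add_pow R (int r) \<one> \<in> carrier R" by auto
        then show ?thesis unfolding xe by algebra
      qed
      ultimately have "r = 0" using min[OF r(2)] by auto
      then have "x = add_pow R q \<one> \<otimes> add_pow R (int m) \<one> \<oplus> \<zero>"
        unfolding xe by (simp add: add_pow_int_ge)
      then show "x \<in> lin_span R ?B {add_pow R (int m) \<one>}"
        by (simp only:) (intro lin_span.add ZB lin_span.zero singletonI)
    qed
    then show ?thesis using m(2) by blast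
  next
    case False
    have "x = \<zero>" if x: "x \<in> J" for x
    proof -
      obtain n :: int where n: "x = add_pow R n \<one>" using x BZ ideal_inD(1)[OF J] by blast
      have "\<zero> \<ominus> x \<in> J" using ideal_in_minus[OF B J ideal_inD(2)[OF J] x] .
      moreover have "\<zero> \<ominus> x = add_pow R (-n) \<one>"
        unfolding n using add.int_pow_neg[of \<one> n] by (simp add: a_inv_def a_minus_def)
      ultimately have "add_pow R (-n) \<one> \<in> J" "add_pow R n \<one> \<in> J" using x n by auto
      then have "\<not> n > 0" "\<not> - n > 0"
        using False by (metis zero_less_imp_eq_int)+
      then show ?thesis using n by (simp add: add_pow_int_ge)
    qed
    then have "J \<subseteq> lin_span R ?B {}" using lin_span.zero by auto
    then show ?thesis by blast
  qed
qed

lemma noetherian_generate_ring: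
  assumes "finite G" "G \<subseteq> carrier R"
  shows "noetherian_subring R (generate_ring R G)"
  using assms
proof (induction G rule: finite_induct)
  case empty
  show ?case by (rule noetherian_prime_subring)
next
  case (insert g G)
  let ?B = "generate_ring R G" and ?C = "generate_ring R (insert g G)"
  have g: "g \<in> carrier R" and G: "G \<subseteq> carrier R" using insert.prems by auto
  have B: "subring ?B R" using G by (rule generate_ring_is_subring)
  have C: "subring ?C R" using insert.prems by (rule generate_ring_is_subring)
  have BC: "?B \<subseteq> ?C"
    by (rule generate_ring_min_subring1[OF G C]) (auto intro: generate_ring.incl)
  let ?P = "poly_below R ?B g"
  note BP = subring_mem[OF B]
  have const: "b \<in> ?P 1" if "b \<in> ?B" for b
  proof -
    have "b = \<zero> \<oplus> b \<otimes> g [^] (0::nat)" using that BP(1) by auto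
    then show ?thesis using that by auto
  qed
  have CP: "x \<in> (\<Union>d. ?P d)" if "x \<in> ?C" for x
    using that
  proof induction
    case one
    then show ?case using const[OF BP(3)] by blast
  next
    case (incl h)
    show ?case
    proof (cases "h = g")
      case True
      have "g \<otimes> \<one> \<in> ?P (Suc 1)" by (rule poly_below_mult_g[OF B g const[OF BP(3)]])
      then have "h \<in> ?P (Suc 1)" using True g by simp
      then show ?thesis by blast
    next
      case False
      then have "h \<in> ?B" using incl by (auto intro: generate_ring.incl)
      then show ?thesis using const by blast
    qed
  next
    case (a_inv h)
    then obtain d where d: "h \<in> ?P d" by auto
    then have "\<zero> \<ominus> h \<in> ?P d" using poly_below_minus[OF B g poly_below_zero[OF B g] d] by simp
    moreover have "h \<in> carrier R" using d poly_below_carrier[OF B g] by auto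
    ultimately show ?case by (auto simp: a_minus_def)
  next
    case (eng_add h1 h2)
    then obtain d e where de: "h1 \<in> ?P d" "h2 \<in> ?P e" by auto
    then have "h1 \<in> ?P (max d e)" "h2 \<in> ?P (max d e)"
      using poly_below_mono[OF B g, of d "max d e"] poly_below_mono[OF B g, of e "max d e"] by auto
    then show ?case using poly_below_add[OF B g] by blast
  next
    case (eng_mult h1 h2)
    then show ?case using poly_below_mult[OF B g] by blast
  qed
  show ?case
    by (rule hilbert_basis[OF B g insert.IH[OF G] C BC])
      (use CP in \<open>auto intro: generate_ring.incl\<close>)
qed

end

lemma fg_cring_ideal_finite_span:
  assumes "fg_cring A" "ideal I A"
  obtains F where "finite F" "F \<subseteq> I" "I \<subseteq> lin_span A (carrier A) F"
proof -
  interpret A: cring A using assms(1) by (simp add: fg_cring_def)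
  interpret I: ideal I A by fact
  obtain G where G: "finite G" "G \<subseteq> carrier A" "generate_ring A G = carrier A"
    using assms(1) by (auto simp: fg_cring_def)
  have "noetherian_subring A (carrier A)"
    using A.noetherian_generate_ring[OF G(1,2)] unfolding G(3) .
  moreover have "ideal_in A (carrier A) I"
    unfolding ideal_in_def by (auto intro: I.I_l_closed)
  ultimately show thesis using that unfolding noetherian_subring_def by metis
qed

section \<open>Ideals of finite index in adic completions\<close>

lemma finite_image_factor:
  assumes "finite (f ` S)" "\<And>x y. x \<in> S \<Longrightarrow> y \<in> S \<Longrightarrow> f x = f y \<Longrightarrow> g x = g y"
  shows "finite (g ` S)"
proof (rule finite_subset)
  show "g ` S \<subseteq> (\<lambda>z. g (inv_into S f z)) ` f ` S"
  proof
    fix y assume "y \<in> g ` S"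
    then obtain x where x: "x \<in> S" "y = g x" by auto
    have "inv_into S f (f x) \<in> S" "f (inv_into S f (f x)) = f x"
      using x by (auto intro: inv_into_into f_inv_into_f)
    then have "g (inv_into S f (f x)) = g x" using assms(2) x(1) by blast
    then show "y \<in> (\<lambda>z. g (inv_into S f z)) ` f ` S" using x by force
  qed
qed (use assms(1) in simp)

lemma (in ideal) a_rcos_eq_iff:
  assumes "x \<in> carrier R" "y \<in> carrier R"
  shows "I +> x = I +> y \<longleftrightarrow> x \<ominus> y \<in> I"
proof -
  have 1: "x \<in> I +> y \<longleftrightarrow> x \<ominus> y \<in> I"
    using assms by (simp add: a_rcos_module_minus ring_axioms)
  show ?thesis
    using assms 1 a_repr_independence'[of x y] a_rcos_self[of x] by blast
qed

text \<open>
  If the elements of the finite set \<open>F\<close> are nilpotent modulo \<open>J\<close>, then a set that is not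
  contained in \<open>J\<close> has a multiple that is not contained in \<open>J\<close> either, but is annihilated by
  \<open>F\<close> modulo \<open>J\<close>.
\<close>

lemma (in cring) exists_annihilated_multiple:
  assumes "ideal J R" "Y \<subseteq> carrier R" "\<not> Y \<subseteq> J" "finite F" "F \<subseteq> carrier R"
    and nil: "\<And>f. f \<in> F \<Longrightarrow> \<exists>n::nat. f [^] n \<in> J"
  shows "\<exists>a\<in>carrier R. (\<exists>x\<in>Y. a \<otimes> x \<notin> J) \<and> (\<forall>f\<in>F. \<forall>x\<in>Y. f \<otimes> (a \<otimes> x) \<in> J)"
  using assms(4,5) nil
proof (induction F rule: finite_induct)
  case empty
  obtain x where "x \<in> Y" "x \<notin> J" using assms(3) by auto
  then have "\<one> \<otimes> x = x" using assms(2) by auto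
  with \<open>x \<in> Y\<close> \<open>x \<notin> J\<close> show ?case by (intro bexI[of _ \<one>] conjI bexI[of _ x]) auto
next
  case (insert g F)
  interpret J: ideal J R by fact
  obtain a where a: "a \<in> carrier R" "\<exists>x\<in>Y. a \<otimes> x \<notin> J"
    "\<And>f x. f \<in> F \<Longrightarrow> x \<in> Y \<Longrightarrow> f \<otimes> (a \<otimes> x) \<in> J"
  proof -
    have "\<exists>a\<in>carrier R. (\<exists>x\<in>Y. a \<otimes> x \<notin> J) \<and> (\<forall>f\<in>F. \<forall>x\<in>Y. f \<otimes> (a \<otimes> x) \<in> J)"
      by (rule insert.IH) (use insert.prems in auto)
    then show thesis using that by blast
  qed
  have g: "g \<in> carrier R" using insert.prems by auto
  obtain n :: nat where n: "g [^] n \<in> J" using insert.prems(2)[of g] by auto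
  let ?Q = "\<lambda>t::nat. \<forall>x\<in>Y. g [^] t \<otimes> (a \<otimes> x) \<in> J"
  have "?Q n" using n a(1) assms(2) by (auto intro!: J.I_r_closed)
  then have Q: "?Q (LEAST t. ?Q t)" by (rule LeastI)
  obtain z where z: "z \<in> Y" "a \<otimes> z \<notin> J" using a(2) by blast
  then have "g [^] (0::nat) \<otimes> (a \<otimes> z) = a \<otimes> z" using a(1) assms(2) by auto
  then have "\<not> ?Q 0" using z by metis
  then have "(LEAST t. ?Q t) \<noteq> 0" using Q by metis
  then obtain t where t: "(LEAST t. ?Q t) = Suc t" using not0_implies_Suc by blast
  have "\<not> ?Q t" by (rule not_less_Least) (simp add: t)
  then obtain y where y: "y \<in> Y" "g [^] t \<otimes> (a \<otimes> y) \<notin> J" by auto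
  have gt: "g [^] t \<in> carrier R" using g by simp
  have "(g [^] t \<otimes> a) \<otimes> y \<notin> J" using y gt a(1) assms(2) by (simp add: m_assoc subset_iff)
  moreover have "f \<otimes> ((g [^] t \<otimes> a) \<otimes> x) \<in> J" if f: "f \<in> insert g F" and x: "x \<in> Y" for f x
  proof (cases "f = g")
    case True
    have "x \<in> carrier R" using x assms(2) by auto
    then have "f \<otimes> ((g [^] t \<otimes> a) \<otimes> x) = g [^] Suc t \<otimes> (a \<otimes> x)"
      unfolding True nat_pow_Suc using g gt a(1) by algebra
    then show ?thesis using Q x unfolding t by auto
  next
    case False
    then have fF: "f \<in> F" using f by simp
    then have "x \<in> carrier R" "f \<in> carrier R" using x assms(2) insert.prems(1) by auto
    then have "f \<otimes> ((g [^] t \<otimes> a) \<otimes> x) = g [^] t \<otimes> (f \<otimes> (a \<otimes> x))"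
      using gt a(1) by algebra
    then show ?thesis using J.I_l_closed[OF a(3)[OF fF x] gt] by simp
  qed
  ultimately show ?case using y(1) gt a(1) by (intro bexI[of _ "g [^] t \<otimes> a"]) auto
qed

text \<open>The power \<open>I\<^sup>k\<close> in the monoid of ideals, with \<open>I\<^sup>0 = A\<close>.\<close>

definition ideal_power :: "('a, 'b) ring_scheme \<Rightarrow> 'a set \<Rightarrow> nat \<Rightarrow> 'a set" where
  "ideal_power A I k = I [^]\<^bsub>ideals_set A\<^esub> k"

lemma ideal_power_0: "ideal_power A I 0 = carrier A"
  by (simp add: ideal_power_def ideals_set_def nat_pow_def)

lemma ideal_power_Suc: "ideal_power A I (Suc k) = ideal_power A I k \<cdot>\<^bsub>A\<^esub> I"
  by (simp add: ideal_power_def ideals_set_def nat_pow_def)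

text \<open>
  A commutative ring \<open>S\<close> with an isomorphism \<open>h\<close> onto the \<open>I\<close>-adic completion of \<open>A\<close>.
\<close>

locale completed_ring = A: cring A + ideal I A + S: cring S
  for A :: "('a, 'b) ring_scheme" (structure) and I and S :: "('s, 'c) ring_scheme"
    and h :: "'s \<Rightarrow> nat \<Rightarrow> 'a set" +
  assumes h_iso: "h \<in> ring_iso S (adic_completion A I)"
begin

abbreviation P :: "nat \<Rightarrow> 'a set" where "P \<equiv> ideal_power A I"

lemma P_ideal: "ideal (P k) A"
proof (induction k)
  case 0
  show ?case unfolding ideal_power_0 by (rule A.oneideal)
next
  case (Suc k)
  show ?case unfolding ideal_power_Suc by (rule A.ideal_prod_is_ideal[OF Suc ideal_axioms])
qed

lemma P_carrier: "x \<in> P k \<Longrightarrow> x \<in> carrier A"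
  using ideal.Icarr[OF P_ideal] .

lemma P_Suc_le: "P (Suc k) \<subseteq> P k"
  unfolding ideal_power_Suc using A.ideal_prod_inter[OF P_ideal ideal_axioms] by blast

lemma P_mono: "k \<le> l \<Longrightarrow> P l \<subseteq> P k"
  by (rule lift_Suc_antimono_le[of P]) (rule P_Suc_le)

lemma P_zero: "\<zero> \<in> P k"
  using additive_subgroup.zero_closed[OF ideal.axioms(1)[OF P_ideal]] .

lemma P_add: "x \<in> P k \<Longrightarrow> y \<in> P k \<Longrightarrow> x \<oplus> y \<in> P k"
  using additive_subgroup.a_closed[OF ideal.axioms(1)[OF P_ideal]] .

lemma P_neg: "x \<in> P k \<Longrightarrow> \<ominus> x \<in> P k"
  using additive_subgroup.a_inv_closed[OF ideal.axioms(1)[OF P_ideal]] .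

lemma P_mult: "x \<in> P k \<Longrightarrow> y \<in> carrier A \<Longrightarrow> x \<otimes> y \<in> P k"
  using ideal.I_r_closed[OF P_ideal] .

lemma P_diff: "x \<in> P k \<Longrightarrow> y \<in> P k \<Longrightarrow> x \<ominus> y \<in> P k"
  unfolding a_minus_def by (intro P_add P_neg)

lemma pow_in_P: "g \<in> I \<Longrightarrow> g [^] k \<in> P k"
proof (induction k)
  case 0
  show ?case by (simp add: ideal_power_0)
next
  case (Suc k)
  then show ?case by (simp add: ideal_power_Suc ideal_prod.prod)
qed

text \<open>Elements of \<open>I\<^sup>k\<^sup>+\<^sup>1\<close> in terms of generators of \<open>I\<close>.\<close>

lemma P_Suc_expand:
  assumes F: "finite F" "F \<subseteq> I" "I \<subseteq> lin_span A (carrier A) F" and x: "x \<in> P (Suc k)"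
  obtains c where "\<And>f. f \<in> F \<Longrightarrow> c f \<in> P k" "x = (\<Oplus>f\<in>F. f \<otimes> c f)"
proof -
  have FA: "F \<subseteq> carrier A" using F(2) Icarr by auto
  let ?E = "\<lambda>x. \<exists>c. (\<forall>f\<in>F. c f \<in> P k) \<and> x = (\<Oplus>f\<in>F. f \<otimes> c f)"
  have E_add: "?E (x \<oplus> y)" if x: "?E x" and y: "?E y" for x y
  proof -
    from x obtain c where c: "\<forall>f\<in>F. c f \<in> P k" "x = (\<Oplus>f\<in>F. f \<otimes> c f)" by (elim exE conjE)
    from y obtain d where d: "\<forall>f\<in>F. d f \<in> P k" "y = (\<Oplus>f\<in>F. f \<otimes> d f)" by (elim exE conjE)
    have car: "f \<in> carrier A" "c f \<in> carrier A" "d f \<in> carrier A" if "f \<in> F" for f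
      using that FA P_carrier[of "c f"] P_carrier[of "d f"] c(1) d(1) by auto
    have "x \<oplus> y = (\<Oplus>f\<in>F. f \<otimes> c f \<oplus> f \<otimes> d f)"
      unfolding c(2) d(2) using car by (intro A.finsum_addf[symmetric]) auto
    also have "\<dots> = (\<Oplus>f\<in>F. f \<otimes> (c f \<oplus> d f))"
      using car by (intro A.finsum_cong') (auto simp: A.r_distr)
    finally show ?thesis
      using c(1) d(1) by (intro exI[of _ "\<lambda>f. c f \<oplus> d f"]) (auto intro: P_add)
  qed
  have single: "?E (i \<otimes> (b \<otimes> f))" if i: "i \<in> P k" and b: "b \<in> carrier A" and f: "f \<in> F" for i b f
  proof -
    have fA: "f \<in> carrier A" "i \<in> carrier A" using f FA i P_carrier by auto
    define c where "c f' = (if f = f' then i \<otimes> b else \<zero>)" for f'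
    have "(\<Oplus>f'\<in>F. f' \<otimes> c f') = (\<Oplus>f'\<in>F. if f = f' then f' \<otimes> (i \<otimes> b) else \<zero>)"
      using FA fA b by (intro A.finsum_cong') (auto simp: c_def)
    also have "\<dots> = f \<otimes> (i \<otimes> b)"
      using FA fA b F(1) f by (intro A.finsum_singleton) auto
    also have "\<dots> = i \<otimes> (b \<otimes> f)" using fA b by algebra
    finally show ?thesis
      by (intro exI[of _ c]) (auto simp: c_def P_zero P_mult i b)
  qed
  have E_zero: "?E \<zero>"
  proof (intro exI[of _ "\<lambda>_. \<zero>"] conjI ballI P_zero)
    have "(\<Oplus>f\<in>F. f \<otimes> \<zero>) = (\<Oplus>f\<in>F. \<zero>)" using FA by (intro A.finsum_cong') auto
    then show "\<zero> = (\<Oplus>f\<in>F. f \<otimes> \<zero>)" by simp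
  qed
  have "?E x"
    using x unfolding ideal_power_Suc
  proof induction
    case (prod i j)
    from prod(2) F(3) have "j \<in> lin_span A (carrier A) F" by auto
    then show ?case
    proof induction
      case zero
      then show ?case using P_carrier[OF prod(1)] E_zero by simp
    next
      case (add b f y)
      have "y \<in> carrier A"
      proof -
        have "ideal_in A (carrier A) (carrier A)" by (auto simp: ideal_in_def)
        then show ?thesis using A.lin_span_least FA add(3) by blast
      qed
      moreover have "f \<in> carrier A" "i \<in> carrier A" using add FA P_carrier[OF prod(1)] by auto
      ultimately have "i \<otimes> (b \<otimes> f \<oplus> y) = i \<otimes> (b \<otimes> f) \<oplus> i \<otimes> y"
        using add(1) by algebra
      moreover have "?E (i \<otimes> (b \<otimes> f) \<oplus> i \<otimes> y)"
        by (rule E_add[OF single[OF prod(1) add(1,2)] add(4)])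
      ultimately show ?case by simp
    qed
  next
    case (sum s1 s2)
    from E_add[OF sum(3,4)] show ?case .
  qed
  then show thesis using that by blast
qed

subsection \<open>Coherent sequences\<close>

text \<open>
  Elements of the completion are handled through sequences of representatives of their
  components: \<open>coherent a\<close> says that the cosets of the \<open>a k\<close> modulo \<open>I\<^sup>k\<close> are compatible, and
  \<open>rep s a\<close> that the element \<open>s\<close> of \<open>S\<close> corresponds to this sequence of cosets.
\<close>

definition coherent :: "(nat \<Rightarrow> 'a) \<Rightarrow> bool" where
  "coherent a \<longleftrightarrow> (\<forall>k. a k \<in> carrier A \<and> a (Suc k) \<ominus> a k \<in> P k)"

definition rep :: "'s \<Rightarrow> (nat \<Rightarrow> 'a) \<Rightarrow> bool" where
  "rep s a \<longleftrightarrow> s \<in> carrier S \<and> coherent a \<and> h s = (\<lambda>k. P k +> a k)"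

lemma coherentD: "coherent a \<Longrightarrow> a k \<in> carrier A" "coherent a \<Longrightarrow> a (Suc k) \<ominus> a k \<in> P k"
  by (auto simp: coherent_def)

lemma coset_eq: "x \<in> carrier A \<Longrightarrow> y \<in> carrier A \<Longrightarrow> P k +> x = P k +> y \<longleftrightarrow> x \<ominus> y \<in> P k"
  by (rule ideal.a_rcos_eq_iff[OF P_ideal])

lemma coherent_const: "a \<in> carrier A \<Longrightarrow> coherent (\<lambda>_. a)"
  unfolding coherent_def by (simp add: a_minus_def A.r_neg P_zero)

lemma coherent_diff:
  assumes "coherent a" "k \<le> l"
  shows "a l \<ominus> a k \<in> P k"
  using assms(2)
proof (induction l rule: dec_induct)
  case base
  then show ?case using coherentD(1)[OF assms(1)] by (simp add: a_minus_def A.r_neg P_zero)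
next
  case (step l)
  have c: "a k \<in> carrier A" "a l \<in> carrier A" "a (Suc l) \<in> carrier A"
    using coherentD(1)[OF assms(1)] by auto
  have "(a (Suc l) \<ominus> a l) \<oplus> (a l \<ominus> a k) \<in> P k"
    using coherentD(2)[OF assms(1), of l] P_mono[OF step(1)] step.IH by (intro P_add) auto
  also have "(a (Suc l) \<ominus> a l) \<oplus> (a l \<ominus> a k) = a (Suc l) \<ominus> a k" using c by algebra
  finally show ?case .
qed

lemma completion_carrier:
  "x \<in> carrier (adic_completion A I) \<longleftrightarrow> (\<exists>a. coherent a \<and> x = (\<lambda>k. P k +> a k))"
proof
  assume x: "x \<in> carrier (adic_completion A I)"
  then have "\<forall>k. \<exists>a\<in>carrier A. x (Suc k) = P (Suc k) +> a \<and> x k = P k +> a"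
    by (simp add: adic_completion_def ideal_power_def)
  then have "\<forall>k. \<exists>a. a \<in> carrier A \<and> x (Suc k) = P (Suc k) +> a \<and> x k = P k +> a"
    by (simp add: Bex_def)
  then obtain a where a: "\<forall>k. a k \<in> carrier A \<and> x (Suc k) = P (Suc k) +> a k \<and> x k = P k +> a k"
    by (rule choice[THEN exE])
  have "a (Suc k) \<ominus> a k \<in> P (Suc k)" for k
  proof -
    have "P (Suc k) +> a (Suc k) = P (Suc k) +> a k" using a by metis
    then show ?thesis using coset_eq a by blast
  qed
  then have "coherent a" unfolding coherent_def using a P_Suc_le by blast
  moreover have "x = (\<lambda>k. P k +> a k)" using a by (intro ext) simp
  ultimately show "\<exists>a. coherent a \<and> x = (\<lambda>k. P k +> a k)" by blast
next
  assume "\<exists>a. coherent a \<and> x = (\<lambda>k. P k +> a k)"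
  then obtain a where a: "coherent a" "x = (\<lambda>k. P k +> a k)" by blast
  have "\<exists>b\<in>carrier A. x (Suc k) = P (Suc k) +> b \<and> x k = P k +> b" for k
    using a coherentD[OF a(1)] coset_eq[of "a (Suc k)" "a k" k]
    by (intro bexI[of _ "a (Suc k)"]) simp_all
  then show "x \<in> carrier (adic_completion A I)"
    unfolding adic_completion_def ideal_power_def[symmetric] by simp
qed

lemma rep_ex: "s \<in> carrier S \<Longrightarrow> \<exists>a. rep s a"
  using h_iso completion_carrier[of "h s"] unfolding rep_def ring_iso_def ring_hom_def by auto

lemma rep_of_coherent:
  assumes "coherent a"
  shows "\<exists>s. rep s a"
proof -
  have "(\<lambda>k. P k +> a k) \<in> h ` carrier S"
    using h_iso completion_carrier[of "\<lambda>k. P k +> a k"] assms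
    unfolding ring_iso_def bij_betw_def by auto
  then show ?thesis unfolding rep_def using assms by auto
qed

lemma rep_unique:
  assumes "rep s a" "rep t b" "\<And>k. a k \<ominus> b k \<in> P k"
  shows "s = t"
proof -
  have "P k +> a k = P k +> b k" for k
    using assms coset_eq unfolding rep_def coherent_def by blast
  then have "h s = h t" using assms unfolding rep_def by simp
  then show ?thesis
    using h_iso assms unfolding ring_iso_def bij_betw_def rep_def inj_on_def by blast
qed

lemma rep_add:
  assumes "rep s a" "rep t b"
  shows "rep (s \<oplus>\<^bsub>S\<^esub> t) (\<lambda>k. a k \<oplus> b k)"
proof -
  have ab: "coherent a" "coherent b" using assms by (auto simp: rep_def)
  have "coherent (\<lambda>k. a k \<oplus> b k)"
    unfolding coherent_def
  proof (intro allI conjI)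
    fix k
    have c: "a k \<in> carrier A" "b k \<in> carrier A" "a (Suc k) \<in> carrier A" "b (Suc k) \<in> carrier A"
      using ab by (auto simp: coherent_def)
    then show "a k \<oplus> b k \<in> carrier A" by simp
    have "(a (Suc k) \<oplus> b (Suc k)) \<ominus> (a k \<oplus> b k) = (a (Suc k) \<ominus> a k) \<oplus> (b (Suc k) \<ominus> b k)"
      using c by algebra
    then show "(a (Suc k) \<oplus> b (Suc k)) \<ominus> (a k \<oplus> b k) \<in> P k"
      using ab P_add by (simp add: coherent_def)
  qed
  moreover have "h (s \<oplus>\<^bsub>S\<^esub> t) = (\<lambda>k. P k +> (a k \<oplus> b k))"
  proof -
    have "h (s \<oplus>\<^bsub>S\<^esub> t) = (\<lambda>k. h s k \<oplus>\<^bsub>adic_quot A I k\<^esub> h t k)"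
      using h_iso assms unfolding ring_iso_def ring_hom_def rep_def adic_completion_def by simp
    also have "\<dots> = (\<lambda>k. (P k +> a k) <+> (P k +> b k))"
      using assms by (simp add: rep_def adic_quot_def FactRing_def)
    also have "\<dots> = (\<lambda>k. P k +> (a k \<oplus> b k))"
      using ab abelian_subgroup.a_rcos_sum[OF abelian_subgroupI3[OF ideal.axioms(1)[OF P_ideal]
            A.is_abelian_group]] by (auto simp: coherent_def)
    finally show ?thesis .
  qed
  ultimately show ?thesis using assms by (simp add: rep_def)
qed

lemma rep_mult:
  assumes "rep s a" "rep t b"
  shows "rep (s \<otimes>\<^bsub>S\<^esub> t) (\<lambda>k. a k \<otimes> b k)"
proof -
  have ab: "coherent a" "coherent b" using assms by (auto simp: rep_def)
  have "coherent (\<lambda>k. a k \<otimes> b k)"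
    unfolding coherent_def
  proof (intro allI conjI)
    fix k
    have c: "a k \<in> carrier A" "b k \<in> carrier A" "a (Suc k) \<in> carrier A" "b (Suc k) \<in> carrier A"
      using ab by (auto simp: coherent_def)
    then show "a k \<otimes> b k \<in> carrier A" by simp
    have "(a (Suc k) \<otimes> b (Suc k)) \<ominus> (a k \<otimes> b k)
        = (a (Suc k) \<ominus> a k) \<otimes> b (Suc k) \<oplus> (b (Suc k) \<ominus> b k) \<otimes> a k"
      using c by algebra
    then show "(a (Suc k) \<otimes> b (Suc k)) \<ominus> (a k \<otimes> b k) \<in> P k"
      using ab c P_add P_mult by (simp add: coherent_def)
  qed
  moreover have "h (s \<otimes>\<^bsub>S\<^esub> t) = (\<lambda>k. P k +> (a k \<otimes> b k))"
  proof -
    have "h (s \<otimes>\<^bsub>S\<^esub> t) = (\<lambda>k. h s k \<otimes>\<^bsub>adic_quot A I k\<^esub> h t k)"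
      using h_iso assms unfolding ring_iso_def ring_hom_def rep_def adic_completion_def by simp
    also have "\<dots> = (\<lambda>k. [mod P k:] (P k +> a k) \<Otimes> (P k +> b k))"
      using assms by (simp add: rep_def adic_quot_def FactRing_def ideal_power_def)
    also have "\<dots> = (\<lambda>k. P k +> (a k \<otimes> b k))"
      using ab ideal.rcoset_mult_add[OF P_ideal] by (auto simp: coherent_def)
    finally show ?thesis .
  qed
  ultimately show ?thesis using assms by (simp add: rep_def)
qed

lemma rep_one: "rep \<one>\<^bsub>S\<^esub> (\<lambda>_. \<one>)"
proof -
  have "h \<one>\<^bsub>S\<^esub> = (\<lambda>k. P k +> \<one>)"
    using h_iso unfolding ring_iso_def ring_hom_def
    by (simp add: adic_completion_def adic_quot_def FactRing_def ideal_power_def)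
  then show ?thesis using coherent_const[of \<one>] by (simp add: rep_def)
qed

lemma rep_zero: "rep \<zero>\<^bsub>S\<^esub> (\<lambda>_. \<zero>)"
proof -
  obtain s where s: "rep s (\<lambda>_. \<zero>)" using rep_of_coherent[OF coherent_const[of \<zero>]] by auto
  have "s \<oplus>\<^bsub>S\<^esub> s = s"
    using rep_unique[OF rep_add[OF s s] s] by (simp add: P_zero a_minus_def)
  then have "s = \<zero>\<^bsub>S\<^esub>" using s by (simp add: rep_def)
  then show ?thesis using s by simp
qed

lemma rep_neg:
  assumes "rep s a"
  shows "rep (\<ominus>\<^bsub>S\<^esub> s) (\<lambda>k. \<ominus> a k)"
proof -
  obtain t where t: "rep t (\<lambda>_. \<ominus> \<one>)" using rep_of_coherent[OF coherent_const[of "\<ominus> \<one>"]] by auto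
  have s: "s \<in> carrier S" "coherent a" and tS: "t \<in> carrier S" using assms t by (auto simp: rep_def)
  have "t \<oplus>\<^bsub>S\<^esub> \<one>\<^bsub>S\<^esub> = \<zero>\<^bsub>S\<^esub>"
    using rep_unique[OF rep_add[OF t rep_one] rep_zero] by (simp add: P_zero a_minus_def A.l_neg)
  then have "t = \<ominus>\<^bsub>S\<^esub> \<one>\<^bsub>S\<^esub>" using tS by (simp add: S.minus_equality)
  then have "t \<otimes>\<^bsub>S\<^esub> s = \<ominus>\<^bsub>S\<^esub> s" using s by (simp add: S.l_minus)
  moreover have "(\<lambda>k. \<ominus> \<one> \<otimes> a k) = (\<lambda>k. \<ominus> a k)"
    using coherentD(1)[OF s(2)] by (simp add: A.l_minus)
  ultimately show ?thesis using rep_mult[OF t assms] by simp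
qed

lemma rep_finsum:
  assumes "finite F" "\<And>f. f \<in> F \<Longrightarrow> rep (s f) (a f)"
  shows "rep (\<Oplus>\<^bsub>S\<^esub>f\<in>F. s f) (\<lambda>k. \<Oplus>f\<in>F. a f k)"
  using assms
proof (induction F rule: finite_induct)
  case empty
  show ?case using rep_zero by simp
next
  case (insert g F)
  have *: "s f \<in> carrier S" "a f k \<in> carrier A" if "f \<in> insert g F" for f k
    using insert.prems[OF that] by (auto simp: rep_def coherent_def)
  have "rep (s g \<oplus>\<^bsub>S\<^esub> (\<Oplus>\<^bsub>S\<^esub>f\<in>F. s f)) (\<lambda>k. a g k \<oplus> (\<Oplus>f\<in>F. a f k))"
    using insert by (intro rep_add) auto
  then show ?case using insert.hyps * by (simp add: Pi_def)
qed

text \<open>The canonical homomorphism from \<open>A\<close> to its completion.\<close>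

definition \<iota> :: "'a \<Rightarrow> 's" where
  "\<iota> a = (SOME s. rep s (\<lambda>_. a))"

lemma rep_iota: "a \<in> carrier A \<Longrightarrow> rep (\<iota> a) (\<lambda>_. a)"
  unfolding \<iota>_def using rep_of_coherent[OF coherent_const] by (rule someI_ex)

lemma iota_hom: "\<iota> \<in> ring_hom A S"
proof (rule ring_hom_memI)
  fix x y assume xy: "x \<in> carrier A" "y \<in> carrier A"
  show "\<iota> x \<in> carrier S" using rep_iota[OF xy(1)] by (simp add: rep_def)
  show "\<iota> (x \<otimes> y) = \<iota> x \<otimes>\<^bsub>S\<^esub> \<iota> y"
    using xy by (intro rep_unique[OF rep_iota rep_mult[OF rep_iota rep_iota]])
      (auto simp: a_minus_def A.r_neg P_zero)
  show "\<iota> (x \<oplus> y) = \<iota> x \<oplus>\<^bsub>S\<^esub> \<iota> y"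
    using xy by (intro rep_unique[OF rep_iota rep_add[OF rep_iota rep_iota]])
      (auto simp: a_minus_def A.r_neg P_zero)
next
  show "\<iota> \<one> = \<one>\<^bsub>S\<^esub>"
    by (intro rep_unique[OF rep_iota rep_one]) (auto simp: a_minus_def A.r_neg P_zero)
qed

text \<open>The kernel of the projection to \<open>A / I\<^sup>k\<close>.\<close>

definition K :: "nat \<Rightarrow> 's set" where
  "K k = {s. \<exists>a. rep s a \<and> a k \<in> P k}"

lemma K_carrier: "K k \<subseteq> carrier S"
  by (auto simp: K_def rep_def)

lemma K_Suc_le: "K (Suc k) \<subseteq> K k"
proof
  fix s assume "s \<in> K (Suc k)"
  then obtain a where a: "rep s a" "a (Suc k) \<in> P (Suc k)" by (auto simp: K_def)
  have c: "a k \<in> carrier A" "a (Suc k) \<in> carrier A" "a (Suc k) \<ominus> a k \<in> P k"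
    using a(1) by (auto simp: rep_def coherent_def)
  have "a k = a (Suc k) \<ominus> (a (Suc k) \<ominus> a k)" using c by algebra
  also have "\<dots> \<in> P k" using a(2) P_Suc_le by (intro P_diff[OF _ c(3)]) auto
  finally show "s \<in> K k" using a(1) by (auto simp: K_def)
qed

lemma K_mono: "k \<le> l \<Longrightarrow> K l \<subseteq> K k"
  by (rule lift_Suc_antimono_le[of K]) (rule K_Suc_le)

lemma iota_dense:
  assumes "s \<in> carrier S"
  obtains a where "a \<in> carrier A" "s \<ominus>\<^bsub>S\<^esub> \<iota> a \<in> K k"
proof -
  obtain a where a: "rep s a" using rep_ex[OF assms] by auto
  have ak: "a k \<in> carrier A" using a by (auto simp: rep_def coherent_def)
  have "rep (s \<ominus>\<^bsub>S\<^esub> \<iota> (a k)) (\<lambda>l. a l \<oplus> \<ominus> a k)"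
    unfolding a_minus_def by (rule rep_add[OF a rep_neg[OF rep_iota[OF ak]]])
  moreover have "a k \<oplus> \<ominus> a k \<in> P k" using ak by (simp add: A.r_neg P_zero)
  ultimately have "s \<ominus>\<^bsub>S\<^esub> \<iota> (a k) \<in> K k" unfolding K_def by blast
  then show thesis using ak that by blast
qed

text \<open>For \<open>g \<in> I\<close> the geometric series in \<open>g\<close> converges to an inverse of \<open>1 - g\<close>.\<close>

lemma one_minus_unit:
  assumes g: "g \<in> I"
  obtains u where "u \<in> carrier S" "(\<one>\<^bsub>S\<^esub> \<ominus>\<^bsub>S\<^esub> \<iota> g) \<otimes>\<^bsub>S\<^esub> u = \<one>\<^bsub>S\<^esub>"
proof -
  have gA: "g \<in> carrier A" using g by (rule Icarr)
  define y where "y = rec_nat \<zero> (\<lambda>_ y. \<one> \<oplus> g \<otimes> y)"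
  have y0: "y 0 = \<zero>" and yS: "y (Suc k) = \<one> \<oplus> g \<otimes> y k" for k by (auto simp: y_def)
  have yA: "y k \<in> carrier A" for k using gA by (induction k) (auto simp: y0 yS)
  have d: "y (Suc k) \<ominus> y k = g [^] k" for k
  proof (induction k)
    case 0
    show ?case using gA by (simp add: y0 yS a_minus_def)
  next
    case (Suc k)
    have "y (Suc (Suc k)) \<ominus> y (Suc k) = g \<otimes> (y (Suc k) \<ominus> y k)"
      unfolding yS[of "Suc k"] yS[of k] using gA yA[of k] by algebra
    then show ?case unfolding Suc using gA by (simp add: A.m_comm)
  qed
  have "coherent y" unfolding coherent_def using yA d pow_in_P[OF g] by simp
  then obtain u where u: "rep u y" using rep_of_coherent by auto
  have v: "rep (\<one>\<^bsub>S\<^esub> \<ominus>\<^bsub>S\<^esub> \<iota> g) (\<lambda>_. \<one> \<oplus> \<ominus> g)"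
    unfolding a_minus_def by (rule rep_add[OF rep_one rep_neg[OF rep_iota[OF gA]]])
  have "(\<one> \<oplus> \<ominus> g) \<otimes> y k \<ominus> \<one> \<in> P k" for k
  proof -
    have "(\<one> \<oplus> \<ominus> g) \<otimes> y k \<ominus> \<one> = \<ominus> (y (Suc k) \<ominus> y k)"
      unfolding yS using gA yA[of k] by algebra
    then show ?thesis unfolding d using P_neg[OF pow_in_P[OF g]] by simp
  qed
  then have "(\<one>\<^bsub>S\<^esub> \<ominus>\<^bsub>S\<^esub> \<iota> g) \<otimes>\<^bsub>S\<^esub> u = \<one>\<^bsub>S\<^esub>"
    by (rule rep_unique[OF rep_mult[OF v u] rep_one])
  then show thesis using u that by (auto simp: rep_def)
qed

text \<open>
  The finite generation of \<open>I\<close> enters here: an element that vanishes modulo \<open>I\<^sup>k\<^sup>+\<^sup>1\<close> is a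
  combination of generators of \<open>I\<close> with coefficients that vanish modulo \<open>I\<^sup>k\<close>.
\<close>

lemma K_Suc_expand:
  assumes F: "finite F" "F \<subseteq> I" "I \<subseteq> lin_span A (carrier A) F" and s: "s \<in> K (Suc k)"
  obtains c where "\<And>f. f \<in> F \<Longrightarrow> c f \<in> K k" "s = (\<Oplus>\<^bsub>S\<^esub>f\<in>F. \<iota> f \<otimes>\<^bsub>S\<^esub> c f)"
proof -
  have FA: "f \<in> carrier A" if "f \<in> F" for f using that F(2) Icarr by auto
  obtain a where a: "rep s a" "a (Suc k) \<in> P (Suc k)" using s by (auto simp: K_def)
  have coh: "coherent a" using a(1) by (simp add: rep_def)
  have aA: "a j \<in> carrier A" for j using coherentD(1)[OF coh] .
  \<comment> \<open>The coefficients \<open>u n\<close> express \<open>a (k + n + 1)\<close> in the generators, and \<open>u (n + 1)\<close> differs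
    from \<open>u n\<close> by elements of \<open>I\<^sup>k\<^sup>+\<^sup>n\<close>, so that they converge in \<open>S\<close>.\<close>
  let ?Q = "\<lambda>n u. (\<forall>f\<in>F. u f \<in> carrier A) \<and> (\<Oplus>f\<in>F. f \<otimes> u f) = a (Suc (k + n)) \<and>
    (n = 0 \<longrightarrow> (\<forall>f\<in>F. u f \<in> P k))"
  let ?D = "\<lambda>n u v. \<forall>f\<in>F. v f \<ominus> u f \<in> P (k + n)"
  have "\<exists>u. \<forall>n. ?Q n (u n) \<and> ?D n (u n) (u (Suc n))"
  proof (rule dependent_nat_choice)
    obtain c where "\<And>f. f \<in> F \<Longrightarrow> c f \<in> P k" "a (Suc k) = (\<Oplus>f\<in>F. f \<otimes> c f)"
      using P_Suc_expand[OF F a(2)] by blast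
    then show "\<exists>u. ?Q 0 u" using P_carrier by (intro exI[of _ c]) auto
  next
    fix u n assume u: "?Q n u"
    have "a (Suc (Suc (k + n))) \<ominus> a (Suc (k + n)) \<in> P (Suc (k + n))"
      by (rule coherentD(2)[OF coh])
    then obtain c where c: "\<And>f. f \<in> F \<Longrightarrow> c f \<in> P (k + n)"
      "a (Suc (Suc (k + n))) \<ominus> a (Suc (k + n)) = (\<Oplus>f\<in>F. f \<otimes> c f)"
      using P_Suc_expand[OF F] by blast
    have cA: "c f \<in> carrier A" if "f \<in> F" for f using c(1)[OF that] by (rule P_carrier)
    have uA: "u f \<in> carrier A" if "f \<in> F" for f using u that by auto
    have "(\<Oplus>f\<in>F. f \<otimes> (u f \<oplus> c f)) = (\<Oplus>f\<in>F. f \<otimes> u f \<oplus> f \<otimes> c f)"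
      using FA cA uA by (intro A.finsum_cong') (auto simp: A.r_distr)
    also have "\<dots> = (\<Oplus>f\<in>F. f \<otimes> u f) \<oplus> (\<Oplus>f\<in>F. f \<otimes> c f)"
      using FA cA uA by (intro A.finsum_addf) auto
    also have "\<dots> = a (Suc (k + n)) \<oplus> (a (Suc (Suc (k + n))) \<ominus> a (Suc (k + n)))"
      using u c(2) by simp
    also have "\<dots> = a (Suc (k + Suc n))"
      using aA[of "Suc (k + n)"] aA[of "Suc (Suc (k + n))"] unfolding add_Suc_right by algebra
    finally have Q: "?Q (Suc n) (\<lambda>f. u f \<oplus> c f)" using cA uA by simp
    have D: "?D n u (\<lambda>f. u f \<oplus> c f)"
    proof
      fix f assume f: "f \<in> F"
      have "u f \<oplus> c f \<ominus> u f = c f" using uA[OF f] cA[OF f] by algebra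
      then show "u f \<oplus> c f \<ominus> u f \<in> P (k + n)" using c(1)[OF f] by simp
    qed
    show "\<exists>v. ?Q (Suc n) v \<and> ?D n u v"
      by (rule exI[where x = "\<lambda>f. u f \<oplus> c f"]) (rule conjI[OF Q D])
  qed
  then obtain u where u_all: "\<forall>n. ?Q n (u n) \<and> ?D n (u n) (u (Suc n))" by (rule exE)
  have u: "?Q n (u n)" "?D n (u n) (u (Suc n))" for n
    using spec[OF u_all, of n] by (rule conjunct1, rule conjunct2)
  define y where "y f j = (if j < k then \<zero> else u (j - k) f)" for f j
  have yA: "y f j \<in> carrier A" if "f \<in> F" for f j using u(1) that by (auto simp: y_def)
  have "coherent (y f)" if f: "f \<in> F" for f
    unfolding coherent_def
  proof (intro allI conjI)
    fix j
    show "y f j \<in> carrier A" using yA f by blast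
    consider "Suc j < k" | "Suc j = k" | "j \<ge> k" by linarith
    then show "y f (Suc j) \<ominus> y f j \<in> P j"
    proof cases
      case 1
      then show ?thesis by (simp add: y_def P_zero a_minus_def)
    next
      case 2
      have "u 0 f \<in> P k" using u(1)[of 0] f by auto
      then have "u 0 f \<in> P j" "u 0 f \<in> carrier A" using 2 P_Suc_le P_carrier by auto
      then show ?thesis using 2 by (auto simp: y_def a_minus_def)
    next
      case 3
      then show ?thesis using u(2)[of "j - k"] f by (simp add: y_def Suc_diff_le)
    qed
  qed
  then have "\<exists>c. rep c (y f)" if "f \<in> F" for f using rep_of_coherent that by blast
  then obtain c where c: "\<And>f. f \<in> F \<Longrightarrow> rep (c f) (y f)" by metis
  have "c f \<in> K k" if "f \<in> F" for f
  proof -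
    have "y f k \<in> P k" using u(1)[of 0] that by (simp add: y_def)
    then show ?thesis unfolding K_def using c[OF that] by blast
  qed
  moreover have "s = (\<Oplus>\<^bsub>S\<^esub>f\<in>F. \<iota> f \<otimes>\<^bsub>S\<^esub> c f)"
  proof (rule rep_unique[OF a(1)])
    show "rep (\<Oplus>\<^bsub>S\<^esub>f\<in>F. \<iota> f \<otimes>\<^bsub>S\<^esub> c f) (\<lambda>j. \<Oplus>f\<in>F. f \<otimes> y f j)"
      by (intro rep_finsum[OF F(1)] rep_mult rep_iota FA c)
    fix j
    show "a j \<ominus> (\<Oplus>f\<in>F. f \<otimes> y f j) \<in> P j"
    proof (cases "j < k")
      case True
      have "(\<Oplus>f\<in>F. f \<otimes> y f j) = (\<Oplus>f\<in>F. \<zero>)"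
        using True FA by (intro A.finsum_cong') (auto simp: y_def)
      then have 1: "a j \<ominus> (\<Oplus>f\<in>F. f \<otimes> y f j) = a j" using aA by (simp add: a_minus_def)
      have "a (Suc k) \<ominus> a j \<in> P j" using coherent_diff[OF coh, of j "Suc k"] True by simp
      moreover have "a (Suc k) \<in> P j" using a(2) P_mono[of j "Suc k"] True by auto
      ultimately have "a (Suc k) \<ominus> (a (Suc k) \<ominus> a j) \<in> P j" by (rule P_diff[rotated])
      moreover have "a (Suc k) \<ominus> (a (Suc k) \<ominus> a j) = a j"
        using aA[of j] aA[of "Suc k"] by algebra
      ultimately show ?thesis unfolding 1 by simp
    next
      case False
      then have "(\<Oplus>f\<in>F. f \<otimes> y f j) = (\<Oplus>f\<in>F. f \<otimes> u (j - k) f)"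
        using u(1) FA by (intro A.finsum_cong') (auto simp: y_def)
      also have "\<dots> = a (Suc j)" using u(1)[of "j - k"] False by simp
      finally have "a j \<ominus> (\<Oplus>f\<in>F. f \<otimes> y f j) = \<ominus> (a (Suc j) \<ominus> a j)"
        using aA[of j] aA[of "Suc j"] by (simp) algebra
      then show ?thesis using P_neg[OF coherentD(2)[OF coh]] by simp
    qed
  qed
  ultimately show thesis by (rule that)
qed

text \<open>
  Modulo \<open>J\<close> the powers of \<open>g\<close> repeat, so \<open>g\<^sup>p (1 - g\<^sup>r) \<in> J\<close> for some \<open>r > 0\<close>, and \<open>1 - g\<^sup>r\<close> is a
  unit.
\<close>

lemma iota_nilpotent_mod:
  assumes J: "ideal J S" and fin: "finite (a_rcosets\<^bsub>S\<^esub> J)" and g: "g \<in> I"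
  shows "\<exists>n::nat. \<iota> g [^]\<^bsub>S\<^esub> n \<in> J"
proof -
  interpret J: ideal J S by fact
  let ?x = "\<iota> g"
  have gA: "g \<in> carrier A" using g by (rule Icarr)
  have x: "?x \<in> carrier S" using iota_hom gA by (rule ring_hom_closed)
  have xp: "?x [^]\<^bsub>S\<^esub> n \<in> carrier S" for n :: nat using x by simp
  have pow: "?x [^]\<^bsub>S\<^esub> n = \<iota> (g [^] n)" for n :: nat
    using gA iota_hom by (induction n) (auto simp: ring_hom_one ring_hom_mult)
  have "(\<lambda>n::nat. J +>\<^bsub>S\<^esub> ?x [^]\<^bsub>S\<^esub> n) ` UNIV \<subseteq> a_rcosets\<^bsub>S\<^esub> J"
    using xp J.a_subset by (auto intro: S.a_rcosetsI)
  then have "finite ((\<lambda>n::nat. J +>\<^bsub>S\<^esub> ?x [^]\<^bsub>S\<^esub> n) ` UNIV)" using fin by (rule finite_subset)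
  then have "\<not> inj (\<lambda>n::nat. J +>\<^bsub>S\<^esub> ?x [^]\<^bsub>S\<^esub> n)"
    using finite_imageD infinite_UNIV_nat by blast
  then obtain p q :: nat where pq: "p \<noteq> q" "J +>\<^bsub>S\<^esub> ?x [^]\<^bsub>S\<^esub> p = J +>\<^bsub>S\<^esub> ?x [^]\<^bsub>S\<^esub> q"
    unfolding inj_def by blast
  have "\<exists>p r::nat. r > 0 \<and> ?x [^]\<^bsub>S\<^esub> p \<ominus>\<^bsub>S\<^esub> ?x [^]\<^bsub>S\<^esub> (p + r) \<in> J"
  proof (cases "p < q")
    case True
    then show ?thesis
      using pq J.a_rcos_eq_iff[OF xp xp] by (intro exI[of _ p] exI[of _ "q - p"]) simp
  next
    case False
    then show ?thesis
      using pq(1) J.a_rcos_eq_iff[OF xp xp, of q p] pq(2)[symmetric]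
      by (intro exI[of _ q] exI[of _ "p - q"]) simp
  qed
  then obtain p r :: nat where pr: "r > 0" "?x [^]\<^bsub>S\<^esub> p \<ominus>\<^bsub>S\<^esub> ?x [^]\<^bsub>S\<^esub> (p + r) \<in> J" by blast
  have "g [^] r \<in> I" using pr(1) gA g by (cases r) (auto intro: I_l_closed)
  then obtain u where u: "u \<in> carrier S" "(\<one>\<^bsub>S\<^esub> \<ominus>\<^bsub>S\<^esub> ?x [^]\<^bsub>S\<^esub> r) \<otimes>\<^bsub>S\<^esub> u = \<one>\<^bsub>S\<^esub>"
    using one_minus_unit unfolding pow by blast
  have "(?x [^]\<^bsub>S\<^esub> p \<ominus>\<^bsub>S\<^esub> ?x [^]\<^bsub>S\<^esub> (p + r)) \<otimes>\<^bsub>S\<^esub> u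
      = ?x [^]\<^bsub>S\<^esub> p \<otimes>\<^bsub>S\<^esub> ((\<one>\<^bsub>S\<^esub> \<ominus>\<^bsub>S\<^esub> ?x [^]\<^bsub>S\<^esub> r) \<otimes>\<^bsub>S\<^esub> u)"
    unfolding S.nat_pow_mult[OF x, symmetric] using xp[of p] xp[of r] u(1) by algebra
  also have "\<dots> = ?x [^]\<^bsub>S\<^esub> p" unfolding u(2) using xp by simp
  finally show ?thesis using J.I_r_closed[OF pr(2) u(1)] by auto
qed

text \<open>
  Ideals \<open>J\<close> of finite index are open. The images of the \<open>K k\<close> modulo \<open>J\<close> become stationary, so
  for large \<open>k\<close> every element of \<open>K k\<close> is congruent to one of \<open>K (k + 1)\<close>, that is, to a
  combination of generators of \<open>I\<close> with coefficients in \<open>K k\<close>. If \<open>K k\<close> were not contained in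
  \<open>J\<close>, some multiple \<open>a K k\<close> would not be contained in \<open>J\<close> but annihilated by these nilpotent
  generators, hence be contained in \<open>J\<close>.
\<close>

lemma finite_index_contains_K:
  assumes A: "fg_cring A" and J: "ideal J S" and fin: "finite (a_rcosets\<^bsub>S\<^esub> J)"
  shows "\<exists>k. K k \<subseteq> J"
proof (rule ccontr)
  assume no: "\<nexists>k. K k \<subseteq> J"
  interpret J: ideal J S by fact
  obtain F where F: "finite F" "F \<subseteq> I" "I \<subseteq> lin_span A (carrier A) F"
    using fg_cring_ideal_finite_span[OF A ideal_axioms] .
  have FS: "\<iota> ` F \<subseteq> carrier S" using F(2) Icarr ring_hom_closed[OF iota_hom] by auto
  define Q where "Q k = (\<lambda>s. J +>\<^bsub>S\<^esub> s) ` K k" for k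
  have finQ: "finite (Q k)" for k
    by (rule finite_subset[OF _ fin])
      (use K_carrier J.a_subset in \<open>auto simp: Q_def intro!: S.a_rcosetsI\<close>)
  obtain k where k: "\<And>l. card (Q k) \<le> card (Q l)"
    using ex_has_least_nat[of "\<lambda>_. True" 0 "\<lambda>k. card (Q k)"] by auto
  have "Q (Suc k) = Q k"
    by (rule card_seteq[OF finQ]) (use K_Suc_le k in \<open>auto simp: Q_def\<close>)
  have stable: "\<exists>s'\<in>K (Suc k). s \<ominus>\<^bsub>S\<^esub> s' \<in> J" if s: "s \<in> K k" for s
  proof -
    have "J +>\<^bsub>S\<^esub> s \<in> Q (Suc k)" unfolding \<open>Q (Suc k) = Q k\<close> using s by (auto simp: Q_def)
    then obtain s' where s': "s' \<in> K (Suc k)" "J +>\<^bsub>S\<^esub> s = J +>\<^bsub>S\<^esub> s'" by (auto simp: Q_def)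
    then show ?thesis using J.a_rcos_eq_iff[of s s'] s K_carrier by blast
  qed
  have "\<exists>a\<in>carrier S. (\<exists>x\<in>K k. a \<otimes>\<^bsub>S\<^esub> x \<notin> J) \<and>
      (\<forall>f\<in>\<iota> ` F. \<forall>x\<in>K k. f \<otimes>\<^bsub>S\<^esub> (a \<otimes>\<^bsub>S\<^esub> x) \<in> J)"
    by (rule S.exists_annihilated_multiple[OF J K_carrier])
      (use no F FS iota_nilpotent_mod[OF J fin] in auto)
  then obtain a where a: "a \<in> carrier S" "\<exists>x\<in>K k. a \<otimes>\<^bsub>S\<^esub> x \<notin> J"
    "\<And>f x. f \<in> F \<Longrightarrow> x \<in> K k \<Longrightarrow> \<iota> f \<otimes>\<^bsub>S\<^esub> (a \<otimes>\<^bsub>S\<^esub> x) \<in> J" by blast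
  have "a \<otimes>\<^bsub>S\<^esub> s \<in> J" if s: "s \<in> K k" for s
  proof -
    obtain s' where s': "s' \<in> K (Suc k)" "s \<ominus>\<^bsub>S\<^esub> s' \<in> J" using stable[OF s] by blast
    obtain c where c: "\<And>f. f \<in> F \<Longrightarrow> c f \<in> K k" "s' = (\<Oplus>\<^bsub>S\<^esub>f\<in>F. \<iota> f \<otimes>\<^bsub>S\<^esub> c f)"
      using K_Suc_expand[OF F s'(1)] by blast
    have fc: "\<iota> f \<in> carrier S" "c f \<in> carrier S" if "f \<in> F" for f
      using FS c(1) K_carrier that by auto
    have "a \<otimes>\<^bsub>S\<^esub> s' = (\<Oplus>\<^bsub>S\<^esub>f\<in>F. a \<otimes>\<^bsub>S\<^esub> (\<iota> f \<otimes>\<^bsub>S\<^esub> c f))"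
      unfolding c(2) using F(1) a(1) fc by (intro S.finsum_rdistr) auto
    also have "\<dots> \<in> J"
    proof -
      have summand: "a \<otimes>\<^bsub>S\<^esub> (\<iota> f \<otimes>\<^bsub>S\<^esub> c f) \<in> J" if "f \<in> F" for f
        using a(3)[OF that c(1)[OF that]] S.m_lcomm[OF a(1) fc[OF that]] by simp
      have "(\<Oplus>\<^bsub>S\<^esub>f\<in>B. a \<otimes>\<^bsub>S\<^esub> (\<iota> f \<otimes>\<^bsub>S\<^esub> c f)) \<in> J" if "finite B" "B \<subseteq> F" for B
        using that
      proof (induction B rule: finite_induct)
        case (insert b B)
        then show ?case
          using a(1) fc summand by (subst S.finsum_insert) auto
      qed simp
      then show ?thesis using F(1) by blast
    qed
    finally have "a \<otimes>\<^bsub>S\<^esub> s' \<in> J" .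
    moreover have "a \<otimes>\<^bsub>S\<^esub> (s \<ominus>\<^bsub>S\<^esub> s') \<in> J" using J.I_l_closed[OF s'(2) a(1)] .
    ultimately have "a \<otimes>\<^bsub>S\<^esub> s' \<oplus>\<^bsub>S\<^esub> a \<otimes>\<^bsub>S\<^esub> (s \<ominus>\<^bsub>S\<^esub> s') \<in> J" by (rule J.a_closed)
    moreover have "a \<otimes>\<^bsub>S\<^esub> s' \<oplus>\<^bsub>S\<^esub> a \<otimes>\<^bsub>S\<^esub> (s \<ominus>\<^bsub>S\<^esub> s') = a \<otimes>\<^bsub>S\<^esub> s"
    proof -
      have "s \<in> carrier S" "s' \<in> carrier S" using s s'(1) K_carrier by auto
      then show ?thesis using a(1) by algebra
    qed
    ultimately show ?thesis by simp
  qed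
  then show False using a(2) by blast
qed

end

section \<open>The free algebra\<close>

text \<open>
  The product of the free algebra, for arbitrary functions on words. Associativity and the unit
  laws do not need finite supports.
\<close>

definition word_conv ::
    "('s, 'b) ring_scheme \<Rightarrow> (nat list \<Rightarrow> 's) \<Rightarrow> (nat list \<Rightarrow> 's) \<Rightarrow> nat list \<Rightarrow> 's" where
  "word_conv S f g w = (\<Oplus>\<^bsub>S\<^esub>k\<in>{..length w}. f (take k w) \<otimes>\<^bsub>S\<^esub> g (drop k w))"

text \<open>The scalar multiple \<open>c u\<close> of the word \<open>u\<close>.\<close>

definition word_single :: "('s, 'b) ring_scheme \<Rightarrow> nat list \<Rightarrow> 's \<Rightarrow> nat list \<Rightarrow> 's" where
  "word_single S u c = (\<lambda>w. if w = u then c else \<zero>\<^bsub>S\<^esub>)"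

context ring
begin

lemma word_conv_closed:
  assumes "\<And>w. f w \<in> carrier R" "\<And>w. g w \<in> carrier R"
  shows "word_conv R f g w \<in> carrier R"
  unfolding word_conv_def using assms by (intro finsum_closed) auto

lemma word_conv_Nil:
  assumes "\<And>w. f w \<in> carrier R" "\<And>w. g w \<in> carrier R"
  shows "word_conv R f g [] = f [] \<otimes> g []"
  unfolding word_conv_def using assms by simp

text \<open>Multiplication by recursion on words: \<open>\<lambda>w. f (a # w)\<close> is the left derivative of \<open>f\<close>.\<close>

lemma word_conv_Cons:
  assumes "\<And>w. f w \<in> carrier R" "\<And>w. g w \<in> carrier R"
  shows "word_conv R f g (a # w)
    = f [] \<otimes> g (a # w) \<oplus> word_conv R (\<lambda>w. f (a # w)) g w"
proof -
  have "word_conv R f g (a # w)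
      = (\<Oplus>k\<in>{..length w}. f (take (Suc k) (a # w)) \<otimes> g (drop (Suc k) (a # w)))
        \<oplus> f (take 0 (a # w)) \<otimes> g (drop 0 (a # w))"
    unfolding word_conv_def list.size(4) add_0_right add_Suc_right One_nat_def
    by (rule finsum_Suc2) (use assms in auto)
  also have "\<dots> = word_conv R (\<lambda>w. f (a # w)) g w \<oplus> f [] \<otimes> g (a # w)"
    by (simp add: word_conv_def)
  finally show ?thesis
    using word_conv_closed[of "\<lambda>w. f (a # w)" g w] assms by (simp add: a_comm)
qed

lemma word_conv_zero_left:
  assumes "\<And>w. g w \<in> carrier R"
  shows "word_conv R (\<lambda>_. \<zero>) g w = \<zero>"
  unfolding word_conv_def using assms by simp

lemma word_conv_linear_left:
  assumes "c \<in> carrier R" "\<And>w. p w \<in> carrier R" "\<And>w. q w \<in> carrier R" "\<And>w. g w \<in> carrier R"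
  shows "word_conv R (\<lambda>w. c \<otimes> p w \<oplus> q w) g w = c \<otimes> word_conv R p g w \<oplus> word_conv R q g w"
proof -
  have "word_conv R (\<lambda>w. c \<otimes> p w \<oplus> q w) g w
      = (\<Oplus>k\<in>{..length w}. c \<otimes> (p (take k w) \<otimes> g (drop k w)) \<oplus> q (take k w) \<otimes> g (drop k w))"
    unfolding word_conv_def using assms
    by (intro finsum_cong') (auto simp: l_distr m_assoc)
  also have "\<dots> = (\<Oplus>k\<in>{..length w}. c \<otimes> (p (take k w) \<otimes> g (drop k w)))
      \<oplus> (\<Oplus>k\<in>{..length w}. q (take k w) \<otimes> g (drop k w))"
    using assms by (intro finsum_addf) auto
  also have "(\<Oplus>k\<in>{..length w}. c \<otimes> (p (take k w) \<otimes> g (drop k w)))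
      = c \<otimes> word_conv R p g w"
    unfolding word_conv_def using assms by (intro finsum_rdistr[symmetric]) auto
  finally show ?thesis by (simp add: word_conv_def)
qed

lemma word_conv_add_left:
  assumes "\<And>w. p w \<in> carrier R" "\<And>w. q w \<in> carrier R" "\<And>w. g w \<in> carrier R"
  shows "word_conv R (\<lambda>w. p w \<oplus> q w) g w = word_conv R p g w \<oplus> word_conv R q g w"
  using word_conv_linear_left[of \<one> p q g w] word_conv_closed[of p g w] assms by simp

lemma word_conv_add_right:
  assumes "\<And>w. f w \<in> carrier R" "\<And>w. p w \<in> carrier R" "\<And>w. q w \<in> carrier R"
  shows "word_conv R f (\<lambda>w. p w \<oplus> q w) w = word_conv R f p w \<oplus> word_conv R f q w"
proof -
  have "word_conv R f (\<lambda>w. p w \<oplus> q w) w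
      = (\<Oplus>k\<in>{..length w}. f (take k w) \<otimes> p (drop k w) \<oplus> f (take k w) \<otimes> q (drop k w))"
    unfolding word_conv_def using assms
    by (intro finsum_cong') (auto simp: r_distr)
  also have "\<dots> = word_conv R f p w \<oplus> word_conv R f q w"
    unfolding word_conv_def using assms by (intro finsum_addf) auto
  finally show ?thesis .
qed

lemma word_conv_assoc:
  assumes "\<And>w. f w \<in> carrier R" "\<And>w. g w \<in> carrier R" "\<And>w. h w \<in> carrier R"
  shows "word_conv R (word_conv R f g) h w = word_conv R f (word_conv R g h) w"
  using assms(1)
proof (induction w arbitrary: f)
  case Nil
  then show ?case
    using assms(2,3) by (simp add: word_conv_Nil word_conv_closed m_assoc)
next
  case (Cons a w)
  note fg = word_conv_closed[OF Cons.prems assms(2)] word_conv_closed[OF assms(2,3)]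
  have "word_conv R (word_conv R f g) h (a # w)
      = word_conv R f g [] \<otimes> h (a # w) \<oplus> word_conv R (\<lambda>w. word_conv R f g (a # w)) h w"
    by (rule word_conv_Cons[OF fg(1) assms(3)])
  also have "word_conv R (\<lambda>w. word_conv R f g (a # w)) h w
      = word_conv R (\<lambda>w. f [] \<otimes> g (a # w) \<oplus> word_conv R (\<lambda>w. f (a # w)) g w) h w"
    using Cons.prems assms(2) by (simp add: word_conv_Cons)
  also have "\<dots> = f [] \<otimes> word_conv R (\<lambda>w. g (a # w)) h w
      \<oplus> word_conv R (word_conv R (\<lambda>w. f (a # w)) g) h w"
    using Cons.prems assms(2,3) by (intro word_conv_linear_left word_conv_closed)
  also have "word_conv R (word_conv R (\<lambda>w. f (a # w)) g) h w
      = word_conv R (\<lambda>w. f (a # w)) (word_conv R g h) w"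
    using Cons.prems by (intro Cons.IH)
  finally have "word_conv R (word_conv R f g) h (a # w) = (f [] \<otimes> g []) \<otimes> h (a # w)
      \<oplus> (f [] \<otimes> word_conv R (\<lambda>w. g (a # w)) h w
        \<oplus> word_conv R (\<lambda>w. f (a # w)) (word_conv R g h) w)"
    using Cons.prems assms(2) by (simp add: word_conv_Nil)
  moreover have "word_conv R f (word_conv R g h) (a # w)
      = f [] \<otimes> (g [] \<otimes> h (a # w) \<oplus> word_conv R (\<lambda>w. g (a # w)) h w)
        \<oplus> word_conv R (\<lambda>w. f (a # w)) (word_conv R g h) w"
    using word_conv_Cons[OF Cons.prems fg(2), where a = a and w = w] assms(2,3) by (simp add: word_conv_Cons)
  moreover have "f [] \<in> carrier R" "g [] \<in> carrier R" "h (a # w) \<in> carrier R"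
    "word_conv R (\<lambda>w. g (a # w)) h w \<in> carrier R"
    "word_conv R (\<lambda>w. f (a # w)) (word_conv R g h) w \<in> carrier R"
    using Cons.prems assms fg(2) by (auto intro!: word_conv_closed)
  ultimately show ?case by (simp add: r_distr m_assoc a_assoc)
qed

lemma word_single_closed: "c \<in> carrier R \<Longrightarrow> word_single R u c w \<in> carrier R"
  by (simp add: word_single_def)

lemma word_conv_one_left:
  assumes "\<And>w. g w \<in> carrier R"
  shows "word_conv R (word_single R [] \<one>) g w = g w"
proof (cases w)
  case Nil
  then show ?thesis
    using word_conv_Nil[of "word_single R [] \<one>" g] assms
    by (simp add: word_single_closed) (simp add: word_single_def)
next
  case (Cons a v)
  have "(\<lambda>w. word_single R [] \<one> (a # w)) = (\<lambda>_. \<zero>)" by (auto simp: word_single_def)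
  then have "word_conv R (word_single R [] \<one>) g (a # v)
      = word_single R [] \<one> [] \<otimes> g (a # v) \<oplus> word_conv R (\<lambda>_. \<zero>) g v"
    using word_conv_Cons[of "word_single R [] \<one>" g a v] assms by (simp add: word_single_closed)
  then show ?thesis
    using Cons assms by (simp add: word_single_def word_conv_zero_left)
qed

lemma word_conv_one_right:
  assumes "\<And>w. f w \<in> carrier R"
  shows "word_conv R f (word_single R [] \<one>) w = f w"
  using assms
proof (induction w arbitrary: f)
  case Nil
  then show ?case
    using word_conv_Nil[of f "word_single R [] \<one>"]
    by (simp add: word_single_closed) (simp add: word_single_def)
next
  case (Cons a w)
  have "word_conv R f (word_single R [] \<one>) (a # w)
      = f [] \<otimes> word_single R [] \<one> (a # w) \<oplus> f (a # w)"
    using word_conv_Cons[of f "word_single R [] \<one>" a w] Cons.IH[of "\<lambda>w. f (a # w)"] Cons.prems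
    by (simp add: word_single_closed)
  then show ?case using Cons.prems by (simp add: word_single_def)
qed

text \<open>A letter \<open>T\<^sub>a\<close> times \<open>c u\<close> is \<open>c T\<^sub>a u\<close>.\<close>

lemma word_conv_letter:
  assumes "c \<in> carrier R"
  shows "word_conv R (word_single R [a] \<one>) (word_single R u c) = word_single R (a # u) c"
proof
  fix w
  show "word_conv R (word_single R [a] \<one>) (word_single R u c) w = word_single R (a # u) c w"
  proof (cases w)
    case Nil
    then show ?thesis
      using word_conv_Nil[of "word_single R [a] \<one>" "word_single R u c"] assms
      by (simp add: word_single_closed) (simp add: word_single_def)
  next
    case (Cons b v)
    have "(\<lambda>w. word_single R [a] \<one> (b # w))
        = (if b = a then word_single R [] \<one> else (\<lambda>_. \<zero>))"
      by (auto simp: word_single_def)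
    moreover have "word_single R [a] \<one> [] = \<zero>" by (simp add: word_single_def)
    ultimately have "word_conv R (word_single R [a] \<one>) (word_single R u c) (b # v)
        = (if b = a then word_single R u c v else \<zero>)"
      using word_conv_Cons[of "word_single R [a] \<one>" "word_single R u c" b v] assms
        word_conv_one_left[of "word_single R u c" v] word_conv_zero_left[of "word_single R u c" v]
      by (simp add: word_single_closed)
    then show ?thesis using Cons by (simp add: word_single_def)
  qed
qed

end

lemma free_algebra_mem:
  assumes "f \<in> carrier (free_algebra S m)"
  shows "f w \<in> carrier S" "finite {w. f w \<noteq> \<zero>\<^bsub>S\<^esub>}" "w \<notin> lists {..<m} \<Longrightarrow> f w = \<zero>\<^bsub>S\<^esub>"
  using assms by (auto simp: free_algebra_def)

lemma free_algebra_mult: "f \<otimes>\<^bsub>free_algebra S m\<^esub> g = word_conv S f g"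
  by (simp add: free_algebra_def word_conv_def[abs_def])

lemma free_algebra_add: "f \<oplus>\<^bsub>free_algebra S m\<^esub> g = (\<lambda>w. f w \<oplus>\<^bsub>S\<^esub> g w)"
  by (simp add: free_algebra_def)

lemma free_algebra_zero: "\<zero>\<^bsub>free_algebra S m\<^esub> = (\<lambda>w. \<zero>\<^bsub>S\<^esub>)"
  by (simp add: free_algebra_def)

lemma free_algebra_one: "\<one>\<^bsub>free_algebra S m\<^esub> = word_single S [] \<one>\<^bsub>S\<^esub>"
  by (simp add: free_algebra_def word_single_def)

lemma free_algebra_const_eq: "free_algebra_const S s = word_single S [] s"
  by (simp add: free_algebra_const_def word_single_def)

lemma (in ring) word_single_mem:
  assumes "c \<in> carrier R" "u \<in> lists {..<m}"
  shows "word_single R u c \<in> carrier (free_algebra R m)"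
proof -
  have "{w. word_single R u c w \<noteq> \<zero>} \<subseteq> {u}" by (auto simp: word_single_def)
  then have "finite {w. word_single R u c w \<noteq> \<zero>}" by (rule finite_subset) simp
  then show ?thesis using assms by (auto simp: free_algebra_def word_single_def)
qed

lemma (in ring) free_algebra_ring: "ring (free_algebra R m)"
proof -
  let ?A = "free_algebra R m"
  note mem = free_algebra_mem[of _ R m]
  have add_closed: "(\<lambda>w. f w \<oplus> g w) \<in> carrier ?A"
    if "f \<in> carrier ?A" "g \<in> carrier ?A" for f g
  proof -
    have "{w. f w \<oplus> g w \<noteq> \<zero>} \<subseteq> {w. f w \<noteq> \<zero>} \<union> {w. g w \<noteq> \<zero>}" by auto
    then have "finite {w. f w \<oplus> g w \<noteq> \<zero>}"
      using mem(2)[OF that(1)] mem(2)[OF that(2)] finite_subset by blast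
    then show ?thesis
      using mem[OF that(1)] mem[OF that(2)] by (simp add: free_algebra_def)
  qed
  have mult_closed: "word_conv R f g \<in> carrier ?A"
    if f: "f \<in> carrier ?A" and g: "g \<in> carrier ?A" for f g
  proof -
    have nz: "\<exists>k\<le>length w. f (take k w) \<noteq> \<zero> \<and> g (drop k w) \<noteq> \<zero>" if "word_conv R f g w \<noteq> \<zero>" for w
    proof (rule ccontr)
      assume *: "\<not> ?thesis"
      have "f (take k w) \<otimes> g (drop k w) = \<zero>" if "k \<le> length w" for k
        using * that mem(1)[OF f] mem(1)[OF g] by (cases "f (take k w) = \<zero>") auto
      then have "word_conv R f g w = (\<Oplus>k\<in>{..length w}. \<zero>)"
        unfolding word_conv_def by (intro finsum_cong') auto
      then show False using that by simp
    qed
    have "{w. word_conv R f g w \<noteq> \<zero>}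
        \<subseteq> (\<lambda>(u, v). u @ v) ` ({w. f w \<noteq> \<zero>} \<times> {w. g w \<noteq> \<zero>})"
    proof
      fix w assume "w \<in> {w. word_conv R f g w \<noteq> \<zero>}"
      then obtain k where "f (take k w) \<noteq> \<zero>" "g (drop k w) \<noteq> \<zero>" using nz by auto
      then show "w \<in> (\<lambda>(u, v). u @ v) ` ({w. f w \<noteq> \<zero>} \<times> {w. g w \<noteq> \<zero>})"
        by (intro image_eqI[of _ _ "(take k w, drop k w)"]) auto
    qed
    then have "finite {w. word_conv R f g w \<noteq> \<zero>}"
      using mem(2)[OF f] mem(2)[OF g] by (auto intro: finite_subset)
    moreover have "word_conv R f g w = \<zero>" if w: "w \<notin> lists {..<m}" for w
    proof (rule ccontr)
      assume "word_conv R f g w \<noteq> \<zero>"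
      then obtain k where k: "f (take k w) \<noteq> \<zero>" "g (drop k w) \<noteq> \<zero>" using nz by auto
      have "take k w \<in> lists {..<m}" "drop k w \<in> lists {..<m}"
        using k mem(3)[OF f] mem(3)[OF g] by blast+
      then have "take k w @ drop k w \<in> lists {..<m}" by (simp only: append_in_lists_conv)
      then show False using w by simp
    qed
    ultimately show ?thesis
      using word_conv_closed[OF mem(1)[OF f] mem(1)[OF g]] by (simp add: free_algebra_def)
  qed
  show ?thesis
  proof (rule ringI)
    show "abelian_group ?A"
    proof (rule abelian_groupI)
      fix f g k assume f: "f \<in> carrier ?A" and g: "g \<in> carrier ?A" and k: "k \<in> carrier ?A"
      show "f \<oplus>\<^bsub>?A\<^esub> g \<oplus>\<^bsub>?A\<^esub> k = f \<oplus>\<^bsub>?A\<^esub> (g \<oplus>\<^bsub>?A\<^esub> k)"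
        using mem(1)[OF f] mem(1)[OF g] mem(1)[OF k] by (simp add: free_algebra_add a_assoc)
    next
      fix f g assume f: "f \<in> carrier ?A" and g: "g \<in> carrier ?A"
      show "f \<oplus>\<^bsub>?A\<^esub> g \<in> carrier ?A" unfolding free_algebra_add by (rule add_closed[OF f g])
      show "f \<oplus>\<^bsub>?A\<^esub> g = g \<oplus>\<^bsub>?A\<^esub> f"
        using mem(1)[OF f] mem(1)[OF g] by (simp add: free_algebra_add a_comm)
    next
      show "\<zero>\<^bsub>?A\<^esub> \<in> carrier ?A" by (simp add: free_algebra_def)
    next
      fix f assume f: "f \<in> carrier ?A"
      show "\<zero>\<^bsub>?A\<^esub> \<oplus>\<^bsub>?A\<^esub> f = f"
        using mem(1)[OF f] by (simp add: free_algebra_add free_algebra_zero)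
      have "{w. \<ominus> f w \<noteq> \<zero>} \<subseteq> {w. f w \<noteq> \<zero>}" by auto
      then have "finite {w. \<ominus> f w \<noteq> \<zero>}" using mem(2)[OF f] by (rule finite_subset)
      then have "(\<lambda>w. \<ominus> f w) \<in> carrier ?A" using mem[OF f] by (simp add: free_algebra_def)
      moreover have "(\<lambda>w. \<ominus> f w) \<oplus>\<^bsub>?A\<^esub> f = \<zero>\<^bsub>?A\<^esub>"
        using mem(1)[OF f] by (simp add: free_algebra_add free_algebra_zero l_neg)
      ultimately show "\<exists>g\<in>carrier ?A. g \<oplus>\<^bsub>?A\<^esub> f = \<zero>\<^bsub>?A\<^esub>" by blast
    qed
    show "monoid ?A"
    proof (rule monoidI)
      fix f g assume f: "f \<in> carrier ?A" and g: "g \<in> carrier ?A"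
      show "f \<otimes>\<^bsub>?A\<^esub> g \<in> carrier ?A" unfolding free_algebra_mult by (rule mult_closed[OF f g])
    next
      show "\<one>\<^bsub>?A\<^esub> \<in> carrier ?A" unfolding free_algebra_one by (rule word_single_mem) auto
    next
      fix f g k assume f: "f \<in> carrier ?A" and g: "g \<in> carrier ?A" and k: "k \<in> carrier ?A"
      show "f \<otimes>\<^bsub>?A\<^esub> g \<otimes>\<^bsub>?A\<^esub> k = f \<otimes>\<^bsub>?A\<^esub> (g \<otimes>\<^bsub>?A\<^esub> k)"
        unfolding free_algebra_mult
        using word_conv_assoc[OF mem(1)[OF f] mem(1)[OF g] mem(1)[OF k]] by (intro ext)
    next
      fix f assume f: "f \<in> carrier ?A"
      show "\<one>\<^bsub>?A\<^esub> \<otimes>\<^bsub>?A\<^esub> f = f"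
        unfolding free_algebra_mult free_algebra_one
        using word_conv_one_left[OF mem(1)[OF f]] by (intro ext)
      show "f \<otimes>\<^bsub>?A\<^esub> \<one>\<^bsub>?A\<^esub> = f"
        unfolding free_algebra_mult free_algebra_one
        using word_conv_one_right[OF mem(1)[OF f]] by (intro ext)
    qed
  next
    fix f g k assume f: "f \<in> carrier ?A" and g: "g \<in> carrier ?A" and k: "k \<in> carrier ?A"
    show "(f \<oplus>\<^bsub>?A\<^esub> g) \<otimes>\<^bsub>?A\<^esub> k = f \<otimes>\<^bsub>?A\<^esub> k \<oplus>\<^bsub>?A\<^esub> g \<otimes>\<^bsub>?A\<^esub> k"
      unfolding free_algebra_mult free_algebra_add
      using word_conv_add_left[OF mem(1)[OF f] mem(1)[OF g] mem(1)[OF k]] by (intro ext)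
    show "k \<otimes>\<^bsub>?A\<^esub> (f \<oplus>\<^bsub>?A\<^esub> g) = k \<otimes>\<^bsub>?A\<^esub> f \<oplus>\<^bsub>?A\<^esub> k \<otimes>\<^bsub>?A\<^esub> g"
      unfolding free_algebra_mult free_algebra_add
      using word_conv_add_right[OF mem(1)[OF k] mem(1)[OF f] mem(1)[OF g]] by (intro ext)
  qed
qed

lemma (in ring) free_algebra_induct [consumes 1, case_names const letter add mult]:
  assumes f: "f \<in> carrier (free_algebra R m)"
    and const: "\<And>s. s \<in> carrier R \<Longrightarrow> Q (free_algebra_const R s)"
    and letter: "\<And>i. i < m \<Longrightarrow> Q (word_single R [i] \<one>)"
    and add: "\<And>f g. \<lbrakk>f \<in> carrier (free_algebra R m); g \<in> carrier (free_algebra R m); Q f; Q g\<rbrakk>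
      \<Longrightarrow> Q (f \<oplus>\<^bsub>free_algebra R m\<^esub> g)"
    and mult: "\<And>f g. \<lbrakk>f \<in> carrier (free_algebra R m); g \<in> carrier (free_algebra R m); Q f; Q g\<rbrakk>
      \<Longrightarrow> Q (f \<otimes>\<^bsub>free_algebra R m\<^esub> g)"
  shows "Q f"
proof -
  have single: "Q (word_single R u c)" if "u \<in> lists {..<m}" "c \<in> carrier R" for u c
    using that(1)
  proof (induction u)
    case Nil
    then show ?case using const[OF that(2)] by (simp add: free_algebra_const_eq)
  next
    case (Cons a u)
    have "word_single R (a # u) c
        = word_single R [a] \<one> \<otimes>\<^bsub>free_algebra R m\<^esub> word_single R u c"
      unfolding free_algebra_mult using word_conv_letter[OF that(2)] by simp
    then show ?case
      using mult[OF word_single_mem word_single_mem letter Cons.IH] Cons.hyps that(2) by simp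
  qed
  have "Q f" if "finite W" "{w. f w \<noteq> \<zero>} \<subseteq> W" "f \<in> carrier (free_algebra R m)" for W f
    using that
  proof (induction W arbitrary: f rule: finite_induct)
    case empty
    then have "f = free_algebra_const R \<zero>" by (auto simp: free_algebra_const_def)
    then show ?case using const[of \<zero>] by simp
  next
    case (insert u W)
    note fm = free_algebra_mem[OF insert.prems(2)]
    show ?case
    proof (cases "f u = \<zero>")
      case True
      then have "{w. f w \<noteq> \<zero>} \<subseteq> W" using insert.prems(1) by auto
      then show ?thesis using insert.IH insert.prems(2) by blast
    next
      case False
      then have u: "u \<in> lists {..<m}" using fm(3) by blast
      define g where "g = f(u := \<zero>)"
      have "{w. g w \<noteq> \<zero>} \<subseteq> {w. f w \<noteq> \<zero>}" by (auto simp: g_def)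
      then have "finite {w. g w \<noteq> \<zero>}" using fm(2) by (rule finite_subset)
      then have gm: "g \<in> carrier (free_algebra R m)"
        using fm by (auto simp: free_algebra_def g_def)
      have "{w. g w \<noteq> \<zero>} \<subseteq> W" using insert.prems(1) by (auto simp: g_def)
      then have "Q g" using insert.IH gm by blast
      moreover have "f = g \<oplus>\<^bsub>free_algebra R m\<^esub> word_single R u (f u)"
        using fm(1) by (auto simp: free_algebra_add g_def word_single_def)
      ultimately show ?thesis
        using add[OF gm word_single_mem[OF fm(1) u] _ single[OF u fm(1)]] by metis
    qed
  qed
  from this[OF free_algebra_mem(2)[OF f] order_refl f] show ?thesis .
qed

section \<open>Finite modules are determined by finitely many scalars\<close>

text \<open>
  On a given finite abelian group, a left module structure is determined by the action of the
  scalars in \<open>Y\<close>. The elements of the group are natural numbers, as in the representatives of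
  the isomorphism classes.
\<close>

definition smult_determined_by :: "('r, 'c) ring_scheme \<Rightarrow> 'r set \<Rightarrow> bool" where
  "smult_determined_by R Y \<longleftrightarrow> Y \<subseteq> carrier R \<and>
    (\<forall>(M :: ('r, nat) module) (N :: ('r, nat) module). left_module R M \<longrightarrow> left_module R N \<longrightarrow> finite (carrier M) \<longrightarrow>
      carrier N = carrier M \<longrightarrow>
      (\<forall>x\<in>carrier M. \<forall>y\<in>carrier M. x \<oplus>\<^bsub>N\<^esub> y = x \<oplus>\<^bsub>M\<^esub> y) \<longrightarrow>
      (\<forall>r\<in>Y. \<forall>x\<in>carrier M. r \<odot>\<^bsub>N\<^esub> x = r \<odot>\<^bsub>M\<^esub> x) \<longrightarrow>
      (\<forall>r\<in>carrier R. \<forall>x\<in>carrier M. r \<odot>\<^bsub>N\<^esub> x = r \<odot>\<^bsub>M\<^esub> x))"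

lemma smult_determined_byD:
  fixes M N :: "('r, nat) module"
  assumes "smult_determined_by R Y"
    and "left_module R M" "left_module R N" "finite (carrier M)" "carrier N = carrier M"
    and "\<And>x y. x \<in> carrier M \<Longrightarrow> y \<in> carrier M \<Longrightarrow> x \<oplus>\<^bsub>N\<^esub> y = x \<oplus>\<^bsub>M\<^esub> y"
    and "\<And>r x. r \<in> Y \<Longrightarrow> x \<in> carrier M \<Longrightarrow> r \<odot>\<^bsub>N\<^esub> x = r \<odot>\<^bsub>M\<^esub> x"
    and "r \<in> carrier R" "x \<in> carrier M"
  shows "r \<odot>\<^bsub>N\<^esub> x = r \<odot>\<^bsub>M\<^esub> x"
proof -
  have "\<forall>x\<in>carrier M. \<forall>y\<in>carrier M. x \<oplus>\<^bsub>N\<^esub> y = x \<oplus>\<^bsub>M\<^esub> y"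
    "\<forall>r\<in>Y. \<forall>x\<in>carrier M. r \<odot>\<^bsub>N\<^esub> x = r \<odot>\<^bsub>M\<^esub> x"
    using assms(6,7) by blast+
  note * = conjunct2[OF assms(1)[unfolded smult_determined_by_def], THEN spec, THEN spec,
      THEN mp, OF assms(2), THEN mp, OF assms(3), THEN mp, OF assms(4), THEN mp, OF assms(5),
      THEN mp, OF this(1), THEN mp, OF this(2)]
  show ?thesis using bspec[OF bspec[OF * assms(8)] assms(9)] .
qed

text \<open>The scalars that act in the same way on \<open>M\<close> and \<open>N\<close>.\<close>

definition smult_agree ::
    "('r, 'c) ring_scheme \<Rightarrow> ('r, 'm, 'd) module_scheme \<Rightarrow> ('r, 'm, 'e) module_scheme \<Rightarrow> 'r set"
  where
  "smult_agree R M N = {r \<in> carrier R. \<forall>x\<in>carrier M. r \<odot>\<^bsub>N\<^esub> x = r \<odot>\<^bsub>M\<^esub> x}"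

lemma smult_agree_subring:
  assumes "left_module R M" "left_module R N" and car: "carrier N = carrier M"
    and add: "\<And>x y. x \<in> carrier M \<Longrightarrow> y \<in> carrier M \<Longrightarrow> x \<oplus>\<^bsub>N\<^esub> y = x \<oplus>\<^bsub>M\<^esub> y"
  shows "subring (smult_agree R M N) R"
proof -
  interpret M: left_module R M by fact
  interpret N: left_module R N by fact
  have z: "\<zero>\<^bsub>N\<^esub> = \<zero>\<^bsub>M\<^esub>"
    using add[of "\<zero>\<^bsub>N\<^esub>" "\<zero>\<^bsub>N\<^esub>"] N.M.zero_closed car N.M.l_zero M.M.add.l_cancel_one by metis
  have neg: "\<ominus>\<^bsub>N\<^esub> x = \<ominus>\<^bsub>M\<^esub> x" if "x \<in> carrier M" for x
  proof -
    have "\<ominus>\<^bsub>N\<^esub> x \<in> carrier M" using N.M.a_inv_closed car that by simp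
    moreover from this have "\<ominus>\<^bsub>N\<^esub> x \<oplus>\<^bsub>M\<^esub> x = \<zero>\<^bsub>M\<^esub>"
      using add[of "\<ominus>\<^bsub>N\<^esub> x" x] N.M.l_neg[of x] car that z by simp
    ultimately show ?thesis using M.M.minus_equality that by metis
  qed
  show ?thesis
  proof (rule M.R.subringI)
    show "smult_agree R M N \<subseteq> carrier R" by (auto simp: smult_agree_def)
    show "\<one>\<^bsub>R\<^esub> \<in> smult_agree R M N"
      by (simp add: smult_agree_def M.smult_one N.smult_one car)
  next
    fix a assume "a \<in> smult_agree R M N"
    then show "\<ominus>\<^bsub>R\<^esub> a \<in> smult_agree R M N"
      by (simp add: smult_agree_def M.smult_l_minus N.smult_l_minus car neg M.smult_closed)
  next
    fix a b assume "a \<in> smult_agree R M N" "b \<in> smult_agree R M N"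
    then show "a \<otimes>\<^bsub>R\<^esub> b \<in> smult_agree R M N" "a \<oplus>\<^bsub>R\<^esub> b \<in> smult_agree R M N"
      by (simp_all add: smult_agree_def M.smult_assoc N.smult_assoc M.smult_l_distr
          N.smult_l_distr car add M.smult_closed)
  qed
qed

text \<open>
  A finitely presented algebra is generated as a ring by \<open>\<sigma> S\<close> and the finite set \<open>T\<close> of the
  images of the letters.
\<close>

lemma finitely_presented_generated:
  assumes "finitely_presented_algebra S R \<sigma>"
  obtains T where "finite T" "T \<subseteq> carrier R"
    "\<And>D. subring D R \<Longrightarrow> \<sigma> ` carrier S \<subseteq> D \<Longrightarrow> T \<subseteq> D \<Longrightarrow> carrier R \<subseteq> D"
proof -
  have alg: "assoc_algebra S R \<sigma>" using assms by (simp add: finitely_presented_algebra_def)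
  interpret S: cring S using alg by (simp add: assoc_algebra_def)
  interpret R: ring R using alg by (simp add: assoc_algebra_def)
  from assms obtain m F h where F: "F \<subseteq> carrier (free_algebra S m)"
    and h: "h \<in> ring_iso (free_algebra S m Quot (Idl\<^bsub>free_algebra S m\<^esub> F)) R"
    and hs: "\<forall>s\<in>carrier S.
      h ((Idl\<^bsub>free_algebra S m\<^esub> F) +>\<^bsub>free_algebra S m\<^esub> free_algebra_const S s) = \<sigma> s"
    unfolding finitely_presented_algebra_def by (elim conjE exE)
  let ?A = "free_algebra S m"
  interpret A: ring ?A by (rule S.free_algebra_ring)
  let ?I = "Idl\<^bsub>?A\<^esub> F"
  interpret I: ideal ?I ?A by (rule A.genideal_ideal[OF F])
  define q where "q f = h (?I +>\<^bsub>?A\<^esub> f)" for f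
  have "h \<circ> (+>\<^bsub>?A\<^esub>) ?I \<in> ring_hom ?A R"
    using I.rcos_ring_hom h by (intro ring_hom_trans) (auto simp: ring_iso_def)
  then have q: "q \<in> ring_hom ?A R" unfolding q_def[abs_def] comp_def .
  have surj: "q ` carrier ?A = carrier R"
  proof -
    have "q ` carrier ?A = h ` carrier (?A Quot ?I)"
      by (auto simp: q_def FactRing_def A_RCOSETS_def')
    then show ?thesis using h by (simp add: ring_iso_def bij_betw_def)
  qed
  let ?T = "(\<lambda>i. q (word_single S [i] \<one>\<^bsub>S\<^esub>)) ` {..<m}"
  show thesis
  proof (rule that)
    show "finite ?T" by simp
    show "?T \<subseteq> carrier R"
      using ring_hom_closed[OF q S.word_single_mem] by auto
    fix D assume D: "subring D R" "\<sigma> ` carrier S \<subseteq> D" "?T \<subseteq> D"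
    have "q f \<in> D" if "f \<in> carrier ?A" for f
      using that
    proof (induction f rule: S.free_algebra_induct)
      case (const s)
      then show ?case using hs D(2) by (auto simp: q_def)
    next
      case (letter i)
      then show ?case using D(3) by auto
    next
      case (add f g)
      then show ?case using ring_hom_add[OF q] subringE(7)[OF D(1)] by simp
    next
      case (mult f g)
      then show ?case using ring_hom_mult[OF q] subringE(6)[OF D(1)] by simp
    qed
    then show "carrier R \<subseteq> D" unfolding surj[symmetric] by auto
  qed
qed

lemma generate_ring_hom_subset:
  assumes "ring A" "ring B" "\<phi> \<in> ring_hom A B" "G \<subseteq> carrier A" "subring D B" "\<phi> ` G \<subseteq> D"
  shows "\<phi> ` generate_ring A G \<subseteq> D"
proof -
  interpret A: ring A by fact
  interpret B: ring B by fact
  interpret h: ring_hom_ring A B \<phi> using assms(3) by unfold_locales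
  have "\<phi> x \<in> D" if "x \<in> generate_ring A G" for x
    using that
  proof induction
    case (a_inv x)
    then show ?case
      using A.generate_ring_in_carrier[OF assms(4)] subringE(5)[OF assms(5)] by simp
  next
    case (eng_add x y)
    then show ?case
      using A.generate_ring_in_carrier[OF assms(4)] subringE(7)[OF assms(5)] by simp
  next
    case (eng_mult x y)
    then show ?case
      using A.generate_ring_in_carrier[OF assms(4)] subringE(6)[OF assms(5)] by simp
  qed (use assms(6) subringE(3)[OF assms(5)] in auto)
  then show ?thesis by auto
qed

lemma annihilator_finite_index:
  assumes M: "left_module R M" and S: "cring S" and \<sigma>: "\<sigma> \<in> ring_hom S R"
    and fin: "finite (carrier M)"
  defines "J \<equiv> {s \<in> carrier S. \<forall>x\<in>carrier M. \<sigma> s \<odot>\<^bsub>M\<^esub> x = \<zero>\<^bsub>M\<^esub>}"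
  shows "ideal J S" "finite (a_rcosets\<^bsub>S\<^esub> J)"
proof -
  interpret M: left_module R M by fact
  interpret S: cring S by fact
  interpret h: ring_hom_ring S R \<sigma> using \<sigma> by unfold_locales
  have J: "ideal J S"
  proof (rule idealI)
    show "ring S" by (rule S.ring_axioms)
    show "subgroup J (add_monoid S)"
    proof (rule S.add.subgroupI)
      show "J \<subseteq> carrier S" by (auto simp: J_def)
      have "\<zero>\<^bsub>S\<^esub> \<in> J" by (simp add: J_def M.smult_l_null)
      then show "J \<noteq> {}" by auto
    next
      fix a assume "a \<in> J"
      then show "\<ominus>\<^bsub>S\<^esub> a \<in> J" by (simp add: J_def M.smult_l_minus)
    next
      fix a b assume "a \<in> J" "b \<in> J"
      then show "a \<oplus>\<^bsub>S\<^esub> b \<in> J" by (simp add: J_def M.smult_l_distr)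
    qed
  next
    fix a s assume "a \<in> J" "s \<in> carrier S"
    then show "s \<otimes>\<^bsub>S\<^esub> a \<in> J" by (simp add: J_def M.smult_assoc M.smult_r_null)
    then show "a \<otimes>\<^bsub>S\<^esub> s \<in> J" using \<open>a \<in> J\<close> \<open>s \<in> carrier S\<close> by (simp add: J_def S.m_comm)
  qed
  then show "ideal J S" .
  interpret J: ideal J S by (rule J)
  let ?f = "\<lambda>s. \<lambda>x\<in>carrier M. \<sigma> s \<odot>\<^bsub>M\<^esub> x"
  have "finite (?f ` carrier S)"
    by (rule finite_subset[of _ "carrier M \<rightarrow>\<^sub>E carrier M"])
      (auto intro!: finite_PiE fin M.smult_closed)
  moreover have "J +>\<^bsub>S\<^esub> s = J +>\<^bsub>S\<^esub> t"
    if s: "s \<in> carrier S" and t: "t \<in> carrier S" and eq: "?f s = ?f t" for s t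
  proof -
    have "\<sigma> (s \<ominus>\<^bsub>S\<^esub> t) \<odot>\<^bsub>M\<^esub> x = \<zero>\<^bsub>M\<^esub>" if x: "x \<in> carrier M" for x
    proof -
      have "\<sigma> s \<odot>\<^bsub>M\<^esub> x = \<sigma> t \<odot>\<^bsub>M\<^esub> x" using fun_cong[OF eq, of x] x by simp
      then show ?thesis
        using s t x M.smult_closed
        by (simp add: a_minus_def M.smult_l_distr M.smult_l_minus M.M.r_neg)
    qed
    then have "s \<ominus>\<^bsub>S\<^esub> t \<in> J" unfolding J_def using S.minus_closed[OF s t] by blast
    then show ?thesis using J.a_rcos_eq_iff[OF s t] by simp
  qed
  ultimately have "finite ((\<lambda>s. J +>\<^bsub>S\<^esub> s) ` carrier S)" by (rule finite_image_factor)
  moreover have "a_rcosets\<^bsub>S\<^esub> J = (\<lambda>s. J +>\<^bsub>S\<^esub> s) ` carrier S"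
    by (auto simp: A_RCOSETS_def')
  ultimately show "finite (a_rcosets\<^bsub>S\<^esub> J)" by simp
qed

text \<open>
  Generators of \<open>S\<close>, or of \<open>A\<close> if \<open>S\<close> is a completion of \<open>A\<close>, together with the letters suffice. In
  the second case the annihilators in \<open>S\<close> of two finite modules are open, so every element of
  \<open>S\<close> acts on both like an element of \<open>A\<close>.
\<close>

lemma exists_determining_set:
  fixes A :: "'a ring" and I :: "'a set"
    and S :: "'s ring" and R :: "'r ring" and \<sigma> :: "'s \<Rightarrow> 'r"
  assumes base: "fg_cring S \<or> (fg_cring A \<and> ideal I A \<and> S \<simeq> adic_completion A I)"
    and algebra: "finitely_presented_algebra S R \<sigma>"
  obtains Y where "finite Y" "smult_determined_by R Y"
proof -
  have alg: "cring S" "ring R" "\<sigma> \<in> ring_hom S R"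
    using algebra by (auto simp: finitely_presented_algebra_def assoc_algebra_def)
  interpret S: cring S by (rule alg)
  interpret R: ring R by (rule alg)
  obtain T where T: "finite T" "T \<subseteq> carrier R"
    "\<And>D. subring D R \<Longrightarrow> \<sigma> ` carrier S \<subseteq> D \<Longrightarrow> T \<subseteq> D \<Longrightarrow> carrier R \<subseteq> D"
    by (rule finitely_presented_generated[OF algebra], rule that)
  have crit: "smult_determined_by R (U \<union> T)"
    if U: "U \<subseteq> carrier R"
      and *: "\<And>(M :: ('r, nat) module) N :: ('r, nat) module.
        \<lbrakk>left_module R M; left_module R N; finite (carrier M); carrier N = carrier M;
          subring (smult_agree R M N) R; U \<subseteq> smult_agree R M N\<rbrakk>
        \<Longrightarrow> \<sigma> ` carrier S \<subseteq> smult_agree R M N" for U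
    unfolding smult_determined_by_def
  proof (intro conjI allI impI)
    show "U \<union> T \<subseteq> carrier R" using U T(2) by simp
  next
    fix M :: "('r, nat) module" and N :: "('r, nat) module"
    assume MN: "left_module R M" "left_module R N" "finite (carrier M)" "carrier N = carrier M"
      and add: "\<forall>x\<in>carrier M. \<forall>y\<in>carrier M. x \<oplus>\<^bsub>N\<^esub> y = x \<oplus>\<^bsub>M\<^esub> y"
      and UT: "\<forall>r\<in>U \<union> T. \<forall>x\<in>carrier M. r \<odot>\<^bsub>N\<^esub> x = r \<odot>\<^bsub>M\<^esub> x"
    have sub: "subring (smult_agree R M N) R"
      by (rule smult_agree_subring[OF MN(1,2,4)]) (use add in blast)
    have UTa: "U \<subseteq> smult_agree R M N" "T \<subseteq> smult_agree R M N"
      using UT U T(2) by (auto simp: smult_agree_def)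
    have "carrier R \<subseteq> smult_agree R M N" by (rule T(3)[OF sub *[OF MN sub UTa(1)] UTa(2)])
    then show "\<forall>r\<in>carrier R. \<forall>x\<in>carrier M. r \<odot>\<^bsub>N\<^esub> x = r \<odot>\<^bsub>M\<^esub> x"
      by (auto simp: smult_agree_def)
  qed
  show thesis
  proof (cases "fg_cring S")
    case True
    then obtain G where G: "finite G" "G \<subseteq> carrier S" "generate_ring S G = carrier S"
      by (auto simp: fg_cring_def)
    have "smult_determined_by R (\<sigma> ` G \<union> T)"
    proof (rule crit)
      show "\<sigma> ` G \<subseteq> carrier R" using G(2) ring_hom_closed[OF alg(3)] by auto
      fix M :: "('r, nat) module" and N :: "('r, nat) module"
      assume "subring (smult_agree R M N) R" "\<sigma> ` G \<subseteq> smult_agree R M N"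
      then show "\<sigma> ` carrier S \<subseteq> smult_agree R M N"
        using generate_ring_hom_subset[OF S.ring_axioms R.ring_axioms alg(3) G(2)]
        unfolding G(3) by blast
    qed
    then show thesis using that[of "\<sigma> ` G \<union> T"] G(1) T(1) by simp
  next
    case False
    then have fgA: "fg_cring A" and I: "ideal I A" and iso: "S \<simeq> adic_completion A I"
      using base by auto
    interpret A: cring A using fgA by (simp add: fg_cring_def)
    from iso obtain h where h: "h \<in> ring_iso S (adic_completion A I)"
      by (auto simp: is_ring_iso_def)
    interpret I: ideal I A by (rule I)
    interpret C: completed_ring A I S h by unfold_locales (rule h)
    obtain G where G: "finite G" "G \<subseteq> carrier A" "generate_ring A G = carrier A"
      using fgA by (auto simp: fg_cring_def)
    have \<sigma>\<iota>: "\<sigma> \<circ> C.\<iota> \<in> ring_hom A R" by (rule ring_hom_trans[OF C.iota_hom alg(3)])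
    have "smult_determined_by R ((\<sigma> \<circ> C.\<iota>) ` G \<union> T)"
    proof (rule crit)
      show "(\<sigma> \<circ> C.\<iota>) ` G \<subseteq> carrier R" using G(2) ring_hom_closed[OF \<sigma>\<iota>] by auto
      fix M :: "('r, nat) module" and N :: "('r, nat) module"
      assume M: "left_module R M" and N: "left_module R N"
        and fin: "finite (carrier M)" and car: "carrier N = carrier M"
        and sub: "subring (smult_agree R M N) R" and GE: "(\<sigma> \<circ> C.\<iota>) ` G \<subseteq> smult_agree R M N"
      interpret M: left_module R M by fact
      interpret N: left_module R N by fact
      have AE: "(\<sigma> \<circ> C.\<iota>) ` carrier A \<subseteq> smult_agree R M N"
        using generate_ring_hom_subset[OF A.ring_axioms R.ring_axioms \<sigma>\<iota> G(2) sub GE]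
        unfolding G(3) .
      define J where "J = {s \<in> carrier S. \<forall>x\<in>carrier M. \<sigma> s \<odot>\<^bsub>M\<^esub> x = \<zero>\<^bsub>M\<^esub>}"
      define J' where "J' = {s \<in> carrier S. \<forall>x\<in>carrier N. \<sigma> s \<odot>\<^bsub>N\<^esub> x = \<zero>\<^bsub>N\<^esub>}"
      have finN: "finite (carrier N)" using fin car by simp
      obtain k where k: "C.K k \<subseteq> J"
        using C.finite_index_contains_K[OF fgA annihilator_finite_index[OF M alg(1,3) fin]]
        unfolding J_def by blast
      obtain k' where k': "C.K k' \<subseteq> J'"
        using C.finite_index_contains_K[OF fgA annihilator_finite_index[OF N alg(1,3) finN]]
        unfolding J'_def by blast
      show "\<sigma> ` carrier S \<subseteq> smult_agree R M N"
      proof (rule image_subsetI)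
        fix s assume s: "s \<in> carrier S"
        obtain a where a: "a \<in> carrier A" "s \<ominus>\<^bsub>S\<^esub> C.\<iota> a \<in> C.K (max k k')"
          using C.iota_dense[OF s] .
        have \<iota>a: "C.\<iota> a \<in> carrier S" using ring_hom_closed[OF C.iota_hom a(1)] .
        let ?c = "s \<ominus>\<^bsub>S\<^esub> C.\<iota> a"
        have "?c \<in> J" "?c \<in> J'"
          using a(2) C.K_mono[of k "max k k'"] C.K_mono[of k' "max k k'"] k k' by auto
        moreover have "\<zero>\<^bsub>R\<^esub> \<in> smult_agree R M N" using subringE(2)[OF sub] .
        moreover have "\<zero>\<^bsub>M\<^esub> = \<zero>\<^bsub>N\<^esub>"
          using \<open>\<zero>\<^bsub>R\<^esub> \<in> smult_agree R M N\<close> M.smult_l_null[OF M.M.zero_closed]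
            N.smult_l_null[of "\<zero>\<^bsub>M\<^esub>"] car by (simp add: smult_agree_def)
        ultimately have "\<sigma> ?c \<in> smult_agree R M N"
          using ring_hom_closed[OF alg(3)] by (simp add: smult_agree_def J_def J'_def car)
        moreover have "\<sigma> (C.\<iota> a) \<in> smult_agree R M N" using AE a(1) by auto
        ultimately have "\<sigma> ?c \<oplus>\<^bsub>R\<^esub> \<sigma> (C.\<iota> a) \<in> smult_agree R M N"
          by (rule subringE(7)[OF sub])
        moreover have "?c \<oplus>\<^bsub>S\<^esub> C.\<iota> a = s" using s \<iota>a by algebra
        ultimately show "\<sigma> s \<in> smult_agree R M N"
          using ring_hom_add[OF alg(3), of ?c "C.\<iota> a"] s \<iota>a by simp
      qed
    qed
    then show thesis using that[of "(\<sigma> \<circ> C.\<iota>) ` G \<union> T"] G(1) T(1) by simp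
  qed
qed

section \<open>Isomorphism classes of finite modules\<close>

text \<open>
  A map on a module whose fibres form a congruence transports the module structure to its
  image. This yields quotient modules as well as isomorphic copies with other underlying sets.
\<close>

lemma left_module_transport:
  fixes F :: "('r, 'm, 'd) module_scheme" and \<pi> :: "'m \<Rightarrow> 'n"
  assumes F: "left_module R F"
    and cong_add: "\<And>x x' y y'. \<lbrakk>x \<in> carrier F; x' \<in> carrier F; y \<in> carrier F; y' \<in> carrier F;
      \<pi> x = \<pi> x'; \<pi> y = \<pi> y'\<rbrakk> \<Longrightarrow> \<pi> (x \<oplus>\<^bsub>F\<^esub> y) = \<pi> (x' \<oplus>\<^bsub>F\<^esub> y')"
    and cong_smult: "\<And>a x x'. \<lbrakk>a \<in> carrier R; x \<in> carrier F; x' \<in> carrier F; \<pi> x = \<pi> x'\<rbrakk>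
      \<Longrightarrow> \<pi> (a \<odot>\<^bsub>F\<^esub> x) = \<pi> (a \<odot>\<^bsub>F\<^esub> x')"
  obtains N :: "('r, 'n) module" where "left_module R N" "carrier N = \<pi> ` carrier F"
    "\<pi> \<in> left_module_hom R F N"
proof -
  interpret F: left_module R F by fact
  define sec where "sec = inv_into (carrier F) \<pi>"
  have sec: "sec (\<pi> x) \<in> carrier F" "\<pi> (sec (\<pi> x)) = \<pi> x" if "x \<in> carrier F" for x
    unfolding sec_def using that by (auto intro: inv_into_into f_inv_into_f)
  define N :: "('r, 'n) module" where
    "N = \<lparr>carrier = \<pi> ` carrier F, monoid.mult = (\<lambda>u v. u), one = \<pi> \<zero>\<^bsub>F\<^esub>, ring.zero = \<pi> \<zero>\<^bsub>F\<^esub>,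
      ring.add = (\<lambda>u v. \<pi> (sec u \<oplus>\<^bsub>F\<^esub> sec v)), smult = (\<lambda>a u. \<pi> (a \<odot>\<^bsub>F\<^esub> sec u))\<rparr>"
  have car: "carrier N = \<pi> ` carrier F" and zero: "\<zero>\<^bsub>N\<^esub> = \<pi> \<zero>\<^bsub>F\<^esub>" by (auto simp: N_def)
  have add: "\<pi> x \<oplus>\<^bsub>N\<^esub> \<pi> y = \<pi> (x \<oplus>\<^bsub>F\<^esub> y)" if "x \<in> carrier F" "y \<in> carrier F" for x y
    using cong_add[of "sec (\<pi> x)" x "sec (\<pi> y)" y] sec that by (simp add: N_def)
  have smult: "a \<odot>\<^bsub>N\<^esub> \<pi> x = \<pi> (a \<odot>\<^bsub>F\<^esub> x)" if "a \<in> carrier R" "x \<in> carrier F" for a x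
    using cong_smult[of a "sec (\<pi> x)" x] sec that by (simp add: N_def)
  have "abelian_group N"
  proof (rule abelian_groupI)
    show "\<zero>\<^bsub>N\<^esub> \<in> carrier N" by (simp add: car zero)
  next
    fix u v w assume "u \<in> carrier N" "v \<in> carrier N" "w \<in> carrier N"
    then obtain x y z where "x \<in> carrier F" "y \<in> carrier F" "z \<in> carrier F"
      "u = \<pi> x" "v = \<pi> y" "w = \<pi> z" unfolding car by (elim imageE)
    then show "u \<oplus>\<^bsub>N\<^esub> v \<oplus>\<^bsub>N\<^esub> w = u \<oplus>\<^bsub>N\<^esub> (v \<oplus>\<^bsub>N\<^esub> w)" by (simp add: add F.M.a_assoc)
  next
    fix u v assume "u \<in> carrier N" "v \<in> carrier N"
    then obtain x y where "x \<in> carrier F" "y \<in> carrier F" "u = \<pi> x" "v = \<pi> y"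
      unfolding car by (elim imageE)
    then show "u \<oplus>\<^bsub>N\<^esub> v = v \<oplus>\<^bsub>N\<^esub> u" "u \<oplus>\<^bsub>N\<^esub> v \<in> carrier N"
      by (simp_all add: add F.M.a_comm car)
  next
    fix u assume "u \<in> carrier N"
    then obtain x where x: "x \<in> carrier F" "u = \<pi> x" unfolding car by (elim imageE)
    then show "\<zero>\<^bsub>N\<^esub> \<oplus>\<^bsub>N\<^esub> u = u" by (simp add: add zero)
    show "\<exists>v\<in>carrier N. v \<oplus>\<^bsub>N\<^esub> u = \<zero>\<^bsub>N\<^esub>"
      using x by (intro bexI[of _ "\<pi> (\<ominus>\<^bsub>F\<^esub> x)"]) (simp_all add: add zero car F.M.l_neg)
  qed
  then have "left_module R N"
  proof (intro left_module.intro left_module_axioms.intro F.R.ring_axioms)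
    fix u assume "u \<in> carrier N"
    then obtain x where x: "x \<in> carrier F" "u = \<pi> x" unfolding car by (elim imageE)
    then show "\<one>\<^bsub>R\<^esub> \<odot>\<^bsub>N\<^esub> u = u" by (simp add: smult F.smult_one)
    fix a assume a: "a \<in> carrier R"
    then show "a \<odot>\<^bsub>N\<^esub> u \<in> carrier N" using x by (simp add: smult car F.smult_closed)
    fix b assume b: "b \<in> carrier R"
    show "(a \<oplus>\<^bsub>R\<^esub> b) \<odot>\<^bsub>N\<^esub> u = a \<odot>\<^bsub>N\<^esub> u \<oplus>\<^bsub>N\<^esub> b \<odot>\<^bsub>N\<^esub> u"
      using x a b by (simp add: smult add F.smult_l_distr F.smult_closed)
    show "(a \<otimes>\<^bsub>R\<^esub> b) \<odot>\<^bsub>N\<^esub> u = a \<odot>\<^bsub>N\<^esub> (b \<odot>\<^bsub>N\<^esub> u)"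
      using x a b by (simp add: smult F.smult_assoc F.smult_closed)
  next
    fix a u v assume a: "a \<in> carrier R" and "u \<in> carrier N" "v \<in> carrier N"
    then obtain x y where "x \<in> carrier F" "y \<in> carrier F" "u = \<pi> x" "v = \<pi> y"
      unfolding car by (elim imageE)
    then show "a \<odot>\<^bsub>N\<^esub> (u \<oplus>\<^bsub>N\<^esub> v) = a \<odot>\<^bsub>N\<^esub> u \<oplus>\<^bsub>N\<^esub> a \<odot>\<^bsub>N\<^esub> v"
      using a by (simp add: smult add F.smult_r_distr F.smult_closed)
  qed
  moreover have "\<pi> \<in> left_module_hom R F N"
    by (simp add: left_module_hom_def car add smult)
  ultimately show thesis using car by (intro that)
qed

text \<open>Isomorphism of modules of order \<open>n\<close>, as a relation on modules with natural numbers as elements.\<close>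

abbreviation iso_rel :: "('r, 'c) ring_scheme \<Rightarrow> nat \<Rightarrow> (('r, nat) module \<times> ('r, nat) module) set"
  where
  "iso_rel R n \<equiv> {(M, N). M \<in> finite_left_modules R n \<and> N \<in> finite_left_modules R n \<and>
    left_module_iso R M N \<noteq> {}}"

lemma finite_left_modulesD:
  assumes "M \<in> finite_left_modules R n"
  shows "left_module R M" "finite (carrier M)" "card (carrier M) = n"
  using assms by (auto simp: finite_left_modules_def)

lemma equiv_iso_rel: "equiv (finite_left_modules R n) (iso_rel R n)"
proof (rule equivI)
  show "iso_rel R n \<subseteq> finite_left_modules R n \<times> finite_left_modules R n" by auto
  show "refl_on (finite_left_modules R n) (iso_rel R n)"
    using left_module_iso_id by (auto simp: refl_on_def)
  show "sym (iso_rel R n)"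
  proof (rule symI)
    fix M N assume "(M, N) \<in> iso_rel R n"
    then obtain g where "M \<in> finite_left_modules R n" "N \<in> finite_left_modules R n"
      "g \<in> left_module_iso R M N" by auto
    then show "(N, M) \<in> iso_rel R n"
      using left_module_iso_inv[OF finite_left_modulesD(1)] by blast
  qed
  show "trans (iso_rel R n)"
  proof (rule transI)
    fix L M N assume "(L, M) \<in> iso_rel R n" "(M, N) \<in> iso_rel R n"
    then obtain f g where "L \<in> finite_left_modules R n" "N \<in> finite_left_modules R n"
      "f \<in> left_module_iso R L M" "g \<in> left_module_iso R M N" by auto
    then show "(L, N) \<in> iso_rel R n" using left_module_iso_comp by blast
  qed
qed

lemma left_module_classes_eq: "left_module_classes R n = finite_left_modules R n // iso_rel R n"
  by (simp add: left_module_classes_def)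

text \<open>Each class has a member with underlying set \<open>{0, \<dots>, n - 1}\<close>.\<close>

lemma iso_standard_carrier:
  assumes "M \<in> finite_left_modules R n"
  obtains N where "N \<in> finite_left_modules R n" "carrier N = {..<n}" "(M, N) \<in> iso_rel R n"
proof -
  note M = finite_left_modulesD[OF assms]
  obtain b where b: "bij_betw b (carrier M) {..<n}"
    using ex_bij_betw_finite_nat[OF M(2)] M(3) by (auto simp: atLeast0LessThan)
  have inj: "x = y" if "x \<in> carrier M" "y \<in> carrier M" "b x = b y" for x y
    using b that by (auto simp: bij_betw_def inj_on_def)
  obtain N :: "('a, nat) module" where N: "left_module R N" "carrier N = b ` carrier M"
    "b \<in> left_module_hom R M N"
    by (rule left_module_transport[OF M(1), of b]) (use inj in blast)+
  have cN: "carrier N = {..<n}" using N(2) b by (simp add: bij_betw_def)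
  then have "N \<in> finite_left_modules R n" using N(1) by (simp add: finite_left_modules_def)
  moreover have "b \<in> left_module_iso R M N" using N(3) b cN by (simp add: left_module_iso_iff)
  ultimately show thesis using that[of N] cN assms by blast
qed

text \<open>
  A module on \<open>{0, \<dots>, n - 1}\<close> is determined up to isomorphism by its addition table and the
  multiplication table of the scalars in \<open>Y\<close>.
\<close>

lemma finite_left_module_classes:
  assumes Y: "finite Y" "smult_determined_by R Y"
  shows "finite (left_module_classes R n)"
proof -
  let ?Std = "{M \<in> finite_left_modules R n. carrier M = {..<n}}"
  let ?V = "{..<n}"
  let ?add = "\<lambda>M :: ('a, nat) module. \<lambda>(x, y)\<in>?V \<times> ?V. x \<oplus>\<^bsub>M\<^esub> y"
  let ?smult = "\<lambda>M :: ('a, nat) module. \<lambda>(r, x)\<in>Y \<times> ?V. r \<odot>\<^bsub>M\<^esub> x"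
  let ?table = "\<lambda>M. (?add M, ?smult M)"
  let ?class = "\<lambda>M. iso_rel R n `` {M}"
  have "?table ` ?Std \<subseteq> (?V \<times> ?V \<rightarrow>\<^sub>E ?V) \<times> (Y \<times> ?V \<rightarrow>\<^sub>E ?V)"
  proof (rule image_subsetI)
    fix M assume M: "M \<in> ?Std"
    then have car: "carrier M = ?V" by simp
    interpret left_module R M using M finite_left_modulesD(1) by blast
    have "Y \<subseteq> carrier R" using Y(2) by (simp add: smult_determined_by_def)
    then
    show "?table M \<in> (?V \<times> ?V \<rightarrow>\<^sub>E ?V) \<times> (Y \<times> ?V \<rightarrow>\<^sub>E ?V)"
      using M.a_closed smult_closed unfolding car by auto
  qed
  then have "finite (?table ` ?Std)"
    by (rule finite_subset) (auto intro!: finite_cartesian_product finite_PiE Y(1))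
  moreover have "?class M = ?class N"
    if M: "M \<in> ?Std" and N: "N \<in> ?Std" and eq: "?table M = ?table N" for M N
  proof -
    have MN: "left_module R M" "left_module R N" "finite (carrier M)" "carrier N = carrier M"
      "carrier M = ?V"
      using M N finite_left_modulesD by auto
    interpret M: left_module R M by (rule MN(1))
    interpret N: left_module R N by (rule MN(2))
    have tables: "?add M = ?add N" "?smult M = ?smult N"
      using eq by (simp_all only: prod.inject)
    have add: "x \<oplus>\<^bsub>N\<^esub> y = x \<oplus>\<^bsub>M\<^esub> y" if "x \<in> carrier M" "y \<in> carrier M" for x y
      using fun_cong[OF tables(1), of "(x, y)"] that MN(5) by simp
    have smult: "r \<odot>\<^bsub>N\<^esub> x = r \<odot>\<^bsub>M\<^esub> x" if "r \<in> Y" "x \<in> carrier M" for r x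
      using fun_cong[OF tables(2), of "(r, x)"] that MN(5) by simp
    have "\<forall>r\<in>carrier R. \<forall>x\<in>carrier M. r \<odot>\<^bsub>N\<^esub> x = r \<odot>\<^bsub>M\<^esub> x"
      using smult_determined_byD[OF Y(2) MN(1-4) add smult] by blast
    then have "id \<in> left_module_iso R M N"
      using add MN(4) by (simp add: left_module_iso_def)
    then have "(M, N) \<in> iso_rel R n" using M N by auto
    then show ?thesis by (rule equiv_class_eq[OF equiv_iso_rel])
  qed
  ultimately have "finite (?class ` ?Std)" by (rule finite_image_factor)
  moreover have "left_module_classes R n \<subseteq> ?class ` ?Std"
  proof
    fix C assume "C \<in> left_module_classes R n"
    then obtain M where M: "M \<in> finite_left_modules R n" "C = ?class M"
      unfolding left_module_classes_eq by (rule quotientE)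
    obtain N where N: "N \<in> finite_left_modules R n" "carrier N = {..<n}" "(M, N) \<in> iso_rel R n"
      using iso_standard_carrier[OF M(1)] .
    have "C = ?class N" using equiv_class_eq[OF equiv_iso_rel N(3)] M(2) by simp
    then show "C \<in> ?class ` ?Std" using N by blast
  qed
  ultimately show ?thesis using finite_subset by blast
qed

lemma class_rep:
  assumes "C \<in> left_module_classes R n"
  shows "(SOME M. M \<in> C) \<in> C" "(SOME M. M \<in> C) \<in> finite_left_modules R n"
proof -
  show "(SOME M. M \<in> C) \<in> C"
    using in_quotient_imp_non_empty[OF equiv_iso_rel assms[unfolded left_module_classes_eq]]
    by (simp add: some_in_eq)
  then show "(SOME M. M \<in> C) \<in> finite_left_modules R n"
    using in_quotient_imp_subset[OF equiv_iso_rel assms[unfolded left_module_classes_eq]] by blast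
qed

section \<open>Submodules of the free module and generating tuples\<close>

text \<open>Every submodule of index \<open>n\<close> is the module of relations of a generating tuple.\<close>

lemma submodule_is_relations:
  assumes R: "ring R" and E: "E \<in> submodules_of_index R (free_left_module R d) n"
  obtains M t where "M \<in> finite_left_modules R n" "t \<in> generating_tuples R M d"
    "E = tuple_relations R M d t"
proof -
  let ?F = "free_left_module R d"
  interpret F: left_module R ?F by (rule left_module_free[OF R])
  have sub: "submodule E R ?F" and fin: "finite (a_rcosets\<^bsub>?F\<^esub> E)"
    and card: "card (a_rcosets\<^bsub>?F\<^esub> E) = n"
    using E by (auto simp: submodules_of_index_def)
  interpret E: abelian_subgroup E ?F
    by (rule submodule_abelian_subgroup[OF sub F.M.abelian_group_axioms])
  have cosets: "a_rcosets\<^bsub>?F\<^esub> E = (\<lambda>x. E +>\<^bsub>?F\<^esub> x) ` carrier ?F" by (auto simp: A_RCOSETS_def')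
  obtain b where b: "bij_betw b (a_rcosets\<^bsub>?F\<^esub> E) {..<n}"
    using ex_bij_betw_finite_nat[OF fin] card by (auto simp: atLeast0LessThan)
  define \<pi> where "\<pi> x = b (E +>\<^bsub>?F\<^esub> x)" for x
  have eq: "\<pi> x = \<pi> y \<longleftrightarrow> x \<ominus>\<^bsub>?F\<^esub> y \<in> E" if "x \<in> carrier ?F" "y \<in> carrier ?F" for x y
  proof -
    have "\<pi> x = \<pi> y \<longleftrightarrow> E +>\<^bsub>?F\<^esub> x = E +>\<^bsub>?F\<^esub> y"
      using b that unfolding \<pi>_def cosets by (auto simp: bij_betw_def inj_on_def)
    then show ?thesis using E.rcos_eq_iff[OF that] by simp
  qed
  have im: "\<pi> ` carrier ?F = {..<n}"
    using b unfolding \<pi>_def cosets bij_betw_def by (simp add: image_image)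
  obtain M :: "('a, nat) module" where M: "left_module R M" "carrier M = \<pi> ` carrier ?F"
    "\<pi> \<in> left_module_hom R ?F M"
  proof (rule left_module_transport[OF F.left_module_axioms, of \<pi>])
    fix x x' y y'
    assume c: "x \<in> carrier ?F" "x' \<in> carrier ?F" "y \<in> carrier ?F" "y' \<in> carrier ?F"
      and "\<pi> x = \<pi> x'" "\<pi> y = \<pi> y'"
    then have "x \<ominus>\<^bsub>?F\<^esub> x' \<in> E" "y \<ominus>\<^bsub>?F\<^esub> y' \<in> E" using eq by auto
    then have "(x \<ominus>\<^bsub>?F\<^esub> x') \<oplus>\<^bsub>?F\<^esub> (y \<ominus>\<^bsub>?F\<^esub> y') \<in> E" by (rule E.a_closed)
    also have "(x \<ominus>\<^bsub>?F\<^esub> x') \<oplus>\<^bsub>?F\<^esub> (y \<ominus>\<^bsub>?F\<^esub> y') = (x \<oplus>\<^bsub>?F\<^esub> y) \<ominus>\<^bsub>?F\<^esub> (x' \<oplus>\<^bsub>?F\<^esub> y')"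
      using c by (simp add: a_minus_def F.M.minus_add F.M.a_ac)
    finally show "\<pi> (x \<oplus>\<^bsub>?F\<^esub> y) = \<pi> (x' \<oplus>\<^bsub>?F\<^esub> y')" using c eq by simp
  next
    fix a x x' assume a: "a \<in> carrier R" and c: "x \<in> carrier ?F" "x' \<in> carrier ?F"
      and "\<pi> x = \<pi> x'"
    then have "a \<odot>\<^bsub>?F\<^esub> (x \<ominus>\<^bsub>?F\<^esub> x') \<in> E" using eq submodule.smult_closed[OF sub] by simp
    moreover have "a \<odot>\<^bsub>?F\<^esub> (\<ominus>\<^bsub>?F\<^esub> x') = \<ominus>\<^bsub>?F\<^esub> (a \<odot>\<^bsub>?F\<^esub> x')"
    proof -
      have "a \<odot>\<^bsub>?F\<^esub> (\<ominus>\<^bsub>?F\<^esub> x') \<oplus>\<^bsub>?F\<^esub> a \<odot>\<^bsub>?F\<^esub> x' = \<zero>\<^bsub>?F\<^esub>"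
        using F.smult_r_distr[OF a, of "\<ominus>\<^bsub>?F\<^esub> x'" x'] c a by (simp add: F.M.l_neg F.smult_r_null)
      then show ?thesis using F.M.minus_equality F.smult_closed[OF a] c by simp
    qed
    ultimately have "(a \<odot>\<^bsub>?F\<^esub> x) \<ominus>\<^bsub>?F\<^esub> (a \<odot>\<^bsub>?F\<^esub> x') \<in> E"
      using c a F.smult_r_distr[OF a, of x "\<ominus>\<^bsub>?F\<^esub> x'"] by (simp add: a_minus_def)
    then show "\<pi> (a \<odot>\<^bsub>?F\<^esub> x) = \<pi> (a \<odot>\<^bsub>?F\<^esub> x')" using eq F.smult_closed[OF a] c by simp
  qed
  have Mn: "M \<in> finite_left_modules R n" using M(1,2) im by (simp add: finite_left_modules_def)
  define t where "t = (\<lambda>i\<in>{..<d}. \<pi> (unit_tuple R d i))"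
  have u: "(\<lambda>i. \<pi> (unit_tuple R d i)) \<in> {..<d} \<rightarrow> carrier M"
    using unit_tuple_closed[OF R] M(2) by blast
  have lc: "lincomb M d t x = \<pi> x" if "x \<in> carrier ?F" for x
    using lincomb_cong[OF M(1) u that, of t] left_module_hom_free[OF M(1,3) that]
    by (simp add: t_def)
  have "lincomb M d t ` carrier ?F = \<pi> ` carrier ?F" using lc by simp
  then have t: "t \<in> generating_tuples R M d"
    using u M(2) by (auto simp: generating_tuples_def t_def)
  have "\<zero>\<^bsub>M\<^esub> = \<pi> \<zero>\<^bsub>?F\<^esub>" using left_module_hom_zero[OF F.left_module_axioms M(1,3)] by simp
  then have "\<pi> x = \<zero>\<^bsub>M\<^esub> \<longleftrightarrow> x \<in> E" if "x \<in> carrier ?F" for x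
    using eq[OF that F.M.zero_closed] that F.M.minus_equality[of "\<zero>\<^bsub>?F\<^esub>" "\<zero>\<^bsub>?F\<^esub>"]
    by (simp add: a_minus_def)
  then have "tuple_relations R M d t = E"
    unfolding tuple_relations_def using lc E.a_subset by auto
  then show thesis using that[OF Mn t] by simp
qed

lemma submodules_of_index_eq:
  assumes R: "ring R"
  shows "submodules_of_index R (free_left_module R d) n
    = (\<Union>C\<in>left_module_classes R n.
        tuple_relations R (SOME M. M \<in> C) d ` generating_tuples R (SOME M. M \<in> C) d)"
    (is "?L = ?U")
proof (intro equalityI subsetI)
  fix E assume "E \<in> ?L"
  then obtain M t where M: "M \<in> finite_left_modules R n" and t: "t \<in> generating_tuples R M d"
    and E: "E = tuple_relations R M d t" by (rule submodule_is_relations[OF R])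
  define C where "C = iso_rel R n `` {M}"
  have C: "C \<in> left_module_classes R n"
    unfolding left_module_classes_eq C_def using M by (rule quotientI)
  let ?N = "SOME M. M \<in> C"
  note N = class_rep[OF C]
  from N(1) obtain g where g: "g \<in> left_module_iso R M ?N" unfolding C_def by auto
  note * = generating_tuples_iso[OF finite_left_modulesD(1)[OF M] finite_left_modulesD(1)[OF N(2)] g t]
  have "E \<in> tuple_relations R ?N d ` generating_tuples R ?N d"
    by (rule image_eqI[OF _ *(1)]) (simp only: *(2) E)
  then show "E \<in> ?U" using C by blast
next
  fix E assume "E \<in> ?U"
  then obtain C t where C: "C \<in> left_module_classes R n"
    and t: "t \<in> generating_tuples R (SOME M. M \<in> C) d"
    and E: "E = tuple_relations R (SOME M. M \<in> C) d t" by blast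
  note N = finite_left_modulesD[OF class_rep(2)[OF C]]
  show "E \<in> ?L" using tuple_relations_index[OF N(1,2) t] E N(3) by simp
qed

lemma relations_disjoint:
  assumes C: "C \<in> left_module_classes R n" "C' \<in> left_module_classes R n" "C \<noteq> C'"
  shows "tuple_relations R (SOME M. M \<in> C) d ` generating_tuples R (SOME M. M \<in> C) d \<inter>
    tuple_relations R (SOME M. M \<in> C') d ` generating_tuples R (SOME M. M \<in> C') d = {}"
proof (rule ccontr)
  let ?M = "SOME M. M \<in> C" and ?N = "SOME M. M \<in> C'"
  assume "\<not> ?thesis"
  then obtain t t' where t: "t \<in> generating_tuples R ?M d" "t' \<in> generating_tuples R ?N d"
    "tuple_relations R ?M d t = tuple_relations R ?N d t'" by blast
  note M = class_rep[OF C(1)] and N = class_rep[OF C(2)]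
  obtain g where "g \<in> left_module_iso R ?M ?N"
    using iso_of_tuple_relations[OF finite_left_modulesD(1)[OF M(2)]
        finite_left_modulesD(1)[OF N(2)] t] by metis
  then have "(?M, ?N) \<in> iso_rel R n" using M(2) N(2) by auto
  then have "C = C'"
    using quotient_eqI[OF equiv_iso_rel C(1,2)[unfolded left_module_classes_eq] M(1) N(1)] by simp
  then show False using C(3) by simp
qed

lemma card_left_module_auto:
  assumes M: "left_module R M" and fin: "finite (carrier M)"
  shows "0 < card (left_module_auto R M)"
proof -
  have "left_module_auto R M \<subseteq> carrier M \<rightarrow>\<^sub>E carrier M"
    by (auto simp: left_module_auto_def left_module_iso_iff left_module_hom_def PiE_def)
  then have "finite (left_module_auto R M)" using fin by (auto intro: finite_subset finite_PiE)
  moreover have "restrict id (carrier M) \<in> left_module_auto R M"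
  proof -
    have "restrict id (carrier M) \<in> left_module_hom R M M"
      by (rule left_module_hom_cong[OF M, of id]) (auto simp: left_module_hom_def)
    moreover have "bij_betw (restrict id (carrier M)) (carrier M) (carrier M)"
      by (rule bij_betw_cong[THEN iffD2, OF _ bij_betw_id]) simp
    ultimately show ?thesis by (simp add: left_module_auto_def left_module_iso_iff)
  qed
  ultimately show ?thesis by (auto simp: card_gt_0_iff)
qed

text \<open>
  The coefficient of \<open>\<zeta>(s + d)\<close> of \<open>R\<^sup>d\<close> is the sum of \<open>1 / |Aut M|\<close>, weighted with the
  proportion of generating tuples among all \<open>d\<close>-tuples in \<open>M\<close>.
\<close>

lemma dirichlet_coeff_eq:
  assumes R: "ring R" and fin: "finite (left_module_classes R n)"
  shows "finite (submodules_of_index R (free_left_module R d) n)"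
    and "dirichlet_shift (int d) (submodule_zeta R (free_left_module R d)) n
      = (\<Sum>C\<in>left_module_classes R n. 1 / real (card (left_module_auto R (SOME M. M \<in> C)))
          * (real (card (generating_tuples R (SOME M. M \<in> C) d)) / real n ^ d))"
proof -
  let ?K = "\<lambda>C. tuple_relations R (SOME M. M \<in> C) d ` generating_tuples R (SOME M. M \<in> C) d"
  let ?A = "\<lambda>C. left_module_auto R (SOME M. M \<in> C)"
  let ?G = "\<lambda>C. generating_tuples R (SOME M. M \<in> C) d"
  have finK: "finite (?K C)" if "C \<in> left_module_classes R n" for C
    using left_module.finite_generating_tuples finite_left_modulesD[OF class_rep(2)[OF that]]
    by blast
  show "finite (submodules_of_index R (free_left_module R d) n)"
    unfolding submodules_of_index_eq[OF R] using fin finK by (rule finite_UN_I)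
  have "card (submodules_of_index R (free_left_module R d) n)
      = (\<Sum>C\<in>left_module_classes R n. card (?K C))"
    unfolding submodules_of_index_eq[OF R]
    using fin finK relations_disjoint by (intro card_UN_disjoint) blast+
  then have "real (card (submodules_of_index R (free_left_module R d) n))
      = (\<Sum>C\<in>left_module_classes R n. real (card (?K C)))" by simp
  also have "\<dots> = (\<Sum>C\<in>left_module_classes R n. 1 / real (card (?A C)) * real (card (?G C)))"
  proof (rule sum.cong[OF refl])
    fix C assume "C \<in> left_module_classes R n"
    note M = finite_left_modulesD[OF class_rep(2)[OF this]]
    show "real (card (?K C)) = 1 / real (card (?A C)) * real (card (?G C))"
      using card_generating_tuples[OF M(1,2), of d] card_left_module_auto[OF M(1,2)] by simp
  qed
  finally show "dirichlet_shift (int d) (submodule_zeta R (free_left_module R d)) n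
      = (\<Sum>C\<in>left_module_classes R n. 1 / real (card (?A C)) * (real (card (?G C)) / real n ^ d))"
    by (simp add: dirichlet_shift_def submodule_zeta_def power_int_minus power_int_of_nat
        divide_inverse sum_distrib_right mult.assoc)
qed

lemma (in left_module) generating_tuples_trivial:
  assumes "card (carrier M) = 1"
  shows "card (generating_tuples R M d) = 1"
proof -
  obtain z where z: "carrier M = {z}" using assms by (rule card_1_singletonE)
  have "generating_tuples R M d = {..<d} \<rightarrow>\<^sub>E carrier M"
  proof (intro equalityI subsetI)
    fix t assume t: "t \<in> {..<d} \<rightarrow>\<^sub>E carrier M"
    then have "t \<in> {..<d} \<rightarrow> carrier M" by auto
    then have "lincomb M d t ` carrier (free_left_module R d) \<subseteq> {z}"
      using lincomb_hom[OF left_module_axioms] z unfolding left_module_hom_def by blast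
    moreover have "carrier (free_left_module R d) \<noteq> {}"
      using unit_tuple_closed[OF R.ring_axioms] by blast
    ultimately have "lincomb M d t ` carrier (free_left_module R d) = {z}"
      by (auto simp: subset_singleton_iff)
    then show "t \<in> generating_tuples R M d" using t z by (simp add: generating_tuples_def)
  qed (simp add: generating_tuples_def)
  then show ?thesis using assms by (simp add: card_PiE)
qed

text \<open>
  The general bound is \<open>n / 2\<^sup>d\<close>, and \<open>n \<le> 2 n log n\<close> for \<open>n \<ge> 2\<close>. For \<open>n = 1\<close> the claimed bound
  vanishes, but then every tuple generates.
\<close>

lemma nongenerating_proportion:
  assumes M: "left_module R M" and n: "card (carrier M) = n" "n \<ge> 1"
  shows "0 \<le> 1 - real (card (generating_tuples R M d)) / real n ^ d"
    and "1 - real (card (generating_tuples R M d)) / real n ^ d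
      \<le> 2 * real n * ln (real n) * (1 / 2 ^ d)"
proof -
  interpret left_module R M by fact
  have fin: "finite (carrier M)" using n by (auto intro: card_ge_0_finite)
  have "real (card (generating_tuples R M d)) \<le> real n ^ d"
    using card_generating_tuples_le[OF fin, of d] n(1) by (metis of_nat_le_iff of_nat_power)
  then show "0 \<le> 1 - real (card (generating_tuples R M d)) / real n ^ d"
    using n(2) by (simp add: divide_le_eq)
  show "1 - real (card (generating_tuples R M d)) / real n ^ d
      \<le> 2 * real n * ln (real n) * (1 / 2 ^ d)"
  proof (cases "n = 1")
    case True
    then show ?thesis using generating_tuples_trivial[of d] n(1) by simp
  next
    case False
    have "ln (1 / 2 :: real) \<le> 1 / 2 - 1" by (rule ln_le_minus_one) simp
    then have "1 / 2 \<le> ln (2 :: real)" by (simp add: ln_div)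
    also have "\<dots> \<le> ln (real n)" using False n(2) by simp
    finally have ln: "real n * 1 \<le> real n * (2 * ln (real n))" by (intro mult_left_mono) auto
    have "(real n ^ d - real (card (generating_tuples R M d))) / real n ^ d
        \<le> (real n * (real n / 2) ^ d) / real n ^ d"
      using card_generating_tuples_ge[OF fin, of d] n(1) by (intro divide_right_mono) auto
    also have "\<dots> = real n * 1 * (1 / 2 ^ d)"
      using n(2) by (simp add: power_divide)
    also have "\<dots> \<le> real n * (2 * ln (real n)) * (1 / 2 ^ d)"
      using ln by (intro mult_right_mono) auto
    finally show ?thesis using n(2) by (simp add: diff_divide_distrib mult_ac)
  qed
qed

section \<open>Comparison of the zeta functions\<close>

theorem proposition3p15:
  fixes A :: "'a ring" and I :: "'a set"
    and S :: "'s ring" and R :: "'r ring" and \<sigma> :: "'s \<Rightarrow> 'r"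
  assumes base: "fg_cring S \<or>
      (fg_cring A \<and> ideal I A \<and> S \<simeq> adic_completion A I)"
    and algebra: "finitely_presented_algebra S R \<sigma>"
  shows "(\<forall>n\<ge>1. finite (left_module_classes R n) \<and>
             (\<forall>d. finite (submodules_of_index R (free_left_module R d) n))) \<and>
         (\<forall>d. \<forall>n\<ge>1.
             0 \<le> zeta_hat R n
                   - dirichlet_shift (int d) (submodule_zeta R (free_left_module R d)) n \<and>
             zeta_hat R n
                   - dirichlet_shift (int d) (submodule_zeta R (free_left_module R d)) n
               \<le> 2 * real n * ln (real n) * zeta_hat R n * (1 / 2 ^ d)) \<and>
         (\<forall>n\<ge>1.
             (\<lambda>d. dirichlet_shift (int d) (submodule_zeta R (free_left_module R d)) n)
               \<longlonglongrightarrow> zeta_hat R n)"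
proof -
  have R: "ring R"
    using algebra by (simp add: finitely_presented_algebra_def assoc_algebra_def)
  obtain Y where Y: "finite Y" "smult_determined_by R Y"
    using exists_determining_set[OF base algebra] .
  have fin: "finite (left_module_classes R n)" for n
    by (rule finite_left_module_classes[OF Y])
  let ?a = "\<lambda>d n. dirichlet_shift (int d) (submodule_zeta R (free_left_module R d)) n"
  let ?B = "\<lambda>n. 2 * real n * ln (real n)"
  have bounds: "0 \<le> zeta_hat R n - ?a d n"
    "zeta_hat R n - ?a d n \<le> ?B n * zeta_hat R n * (1 / 2 ^ d)"
    if n: "n \<ge> 1" for d n
  proof -
    let ?w = "\<lambda>C. 1 / real (card (left_module_auto R (SOME M. M \<in> C)))"
    let ?p = "\<lambda>C. 1 - real (card (generating_tuples R (SOME M. M \<in> C) d)) / real n ^ d"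
    have diff: "zeta_hat R n - ?a d n = (\<Sum>C\<in>left_module_classes R n. ?w C * ?p C)"
      unfolding zeta_hat_def dirichlet_coeff_eq(2)[OF R fin]
      by (simp add: sum_subtractf[symmetric] right_diff_distrib)
    have p: "0 \<le> ?p C" "?p C \<le> ?B n * (1 / 2 ^ d)" if "C \<in> left_module_classes R n" for C
      using nongenerating_proportion[of R "SOME M. M \<in> C" n d]
        finite_left_modulesD[OF class_rep(2)[OF that]] n by auto
    show "0 \<le> zeta_hat R n - ?a d n"
      unfolding diff using p(1) by (intro sum_nonneg mult_nonneg_nonneg) auto
    have "zeta_hat R n - ?a d n \<le> (\<Sum>C\<in>left_module_classes R n. ?w C * (?B n * (1 / 2 ^ d)))"
      unfolding diff using p(2) by (intro sum_mono mult_left_mono) auto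
    also have "\<dots> = ?B n * zeta_hat R n * (1 / 2 ^ d)"
      unfolding zeta_hat_def by (simp add: sum_distrib_left sum_distrib_right mult_ac)
    finally show "zeta_hat R n - ?a d n \<le> ?B n * zeta_hat R n * (1 / 2 ^ d)" .
  qed
  have lim: "(\<lambda>d. ?a d n) \<longlonglongrightarrow> zeta_hat R n" if n: "n \<ge> 1" for n
  proof (rule tendsto_sandwich)
    have "(\<lambda>d. zeta_hat R n - ?B n * zeta_hat R n * (1 / 2) ^ d)
        \<longlonglongrightarrow> zeta_hat R n - ?B n * zeta_hat R n * 0"
      by (intro tendsto_intros LIMSEQ_realpow_zero) auto
    then show "(\<lambda>d. zeta_hat R n - ?B n * zeta_hat R n * (1 / 2) ^ d) \<longlonglongrightarrow> zeta_hat R n" by simp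
    show "\<forall>\<^sub>F d in sequentially. zeta_hat R n - ?B n * zeta_hat R n * (1 / 2) ^ d \<le> ?a d n"
    proof (rule always_eventually, rule allI)
      fix d show "zeta_hat R n - ?B n * zeta_hat R n * (1 / 2) ^ d \<le> ?a d n"
        using bounds(2)[OF n, of d] by (simp add: power_one_over)
    qed
    show "\<forall>\<^sub>F d in sequentially. ?a d n \<le> zeta_hat R n"
    proof (rule always_eventually, rule allI)
      fix d show "?a d n \<le> zeta_hat R n" using bounds(1)[OF n, of d] by simp
    qed
  qed (rule tendsto_const)
  show ?thesis using fin dirichlet_coeff_eq(1)[OF R fin] bounds lim by blast
qed

end
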